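(* Let $(M^{4n+3},\eta,\mathbb{PQ})$ be a $(4n+3)$-dimensional pqc manifold with fixed $g\in[g]$, normalized pqc scalar curvature $\lambda$, canonical pqc connection with $sp(1,\mathbb R)$-connection 1-forms $\alpha_s$, Ricci 2-forms $\rho_s$, and fundamental four-form $\Omega=-\omega_1\wedge\omega_1-\omega_2\wedge\omega_2+\omega_3\wedge\omega_3$. Then for every cyclic permutation $(i,j,k)$ of $(1,2,3)$ the following equations hold: $$d\eta_i=-2\epsilon_i\omega_i+\eta_j\wedge\alpha_k+\epsilon_j\eta_k\wedge\alpha_j+\epsilon_i\lambda\,\eta_j\wedge\eta_k,$$ $$\epsilon_id\omega_i=\omega_j\wedge[-\epsilon_j\alpha_k+\epsilon_k\lambda\eta_k]+\omega_k\wedge[\epsilon_i\alpha_j-\epsilon_j\lambda\eta_j]-\epsilon_j\rho_k\wedge\eta_j+\epsilon_k\rho_j\wedge\eta_k+\tfrac12\epsilon_id\lambda\wedge\eta_j\wedge\eta_k,$$ $$d\Omega=\sum_{(ijk)}-\epsilon_i\Big[2\eta_i\wedge(\rho^0_k\wedge\omega_j-\rho^0_j\wedge\omega_k)+d\lambda\wedge\omega_i\wedge\eta_j\wedge\eta_k\Big],$$ where $\sum_{(ijk)}$ is the cyclic sum over the even permutations of $\{1,2,3\}$ and $$\rho^0_s(X,Y)=\frac12\big[\tau(X,I_sY)-\tau(I_sX,Y)\big]+2\mu(X,I_sY),\qquad X,Y\in H,$$ are the trace-free part of the Ricci 2-forms.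
   Context: Put $\epsilon_1=\epsilon_2=1$, $\epsilon_3=-1$; $(i,j,k)$ denotes any cyclic permutation of $(1,2,3)$, $s,t\in\{1,2,3\}$; $X,Y,\dots$ denote horizontal vectors. $d\eta(A,B)=A\eta(B)-B\eta(A)-\eta([A,B])$, $(\alpha\wedge\beta)(A,B)=\alpha(A)\beta(B)-\alpha(B)\beta(A)$ for 1-forms. A pqc manifold is a smooth $(4n+3)$-dimensional manifold $M$ with a codimension-three distribution $H$, a conformal class $[g]$ of metrics of signature $(2n,2n)$ on $H$, and a rank-three bundle $\mathbb{PQ}\subset\mathrm{End}(H)$ locally spanned by $I_1,I_2,I_3$ with $I_s^2=\epsilon_s\,\mathrm{id}_H$, $I_iI_j=-I_jI_i=-\epsilon_kI_k$, $g(I_s\cdot,I_s\cdot)=-\epsilon_s g$, and such that locally $H=\bigcap_s\ker\eta_s$ for 1-forms $\eta_s$ with $d\eta_s(X,Y)=-2\epsilon_s g(I_sX,Y)$ on $H$. With $g$ fixed, $(\eta_s,I_s)$ denotes such compatible local data; $\omega_s$ are the horizontal 2-forms given by $\omega_s(X,Y)=g(I_sX,Y)$ on $H$ and vanishing when an argument lies in the space $V$ below. Reeb vector fields: local $\xi_1,\xi_2,\xi_3$ with $\eta_s(\xi_t)=\delta_{st}$, $(\xi_s\lrcorner d\eta_s)_{|H}=0$, $(\xi_j\lrcorner d\eta_i)_{|H}=\epsilon_k(\xi_i\lrcorner d\eta_j)_{|H}$; they exist and are unique for $n>1$, and for $n=1$ their existence is part of the definition of a pqc structure. $V=\mathrm{span}\{\xi_s\}$,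 $TM=H\oplus V$; $g$ is extended to $M$ by $g=g_{|H}-\sum_s\epsilon_s\eta_s\otimes\eta_s$, $H\perp V$. The canonical pqc connection is the unique linear connection $\nabla$ preserving $H\oplus V$, $g$ and $\mathbb{PQ}$, with torsion $T(A,B)=\nabla_AB-\nabla_BA-[A,B]$ satisfying $T(X,Y)=-[X,Y]_{|V}$ for $X,Y\in H$, with $X\mapsto T(\xi,X)_{|H}$ in $(sp(n,\mathbb R)\oplus sp(1,\mathbb R))^\perp\subset\mathrm{End}(H)$ for $\xi\in V$, and with the map $V\to\mathbb{PQ}$, $\xi_s\mapsto I_s$, parallel. Here $sp(1,\mathbb R)=\mathrm{span}\{I_s\}$, $sp(n,\mathbb R)$ is the space of $g$-skew endomorphisms of $H$ commuting with all $I_s$, and $\langle A,B\rangle=\sum_ag(e_a,e_a)g(Ae_a,Be_a)$. The connection 1-forms are defined by $\nabla I_i=\alpha_jI_k+\epsilon_k\alpha_kI_j$, equivalently $\nabla\xi_i=\alpha_j\xi_k+\epsilon_k\alpha_k\xi_j$. Torsion tensors: with $T(\xi,X,Y)=g(T(\xi,X),Y)=T^{sym}+T^a$ (symmetric and skew parts in $X,Y\in H$), $\tau(X,Y)=-\sum_s\epsilon_sT^{sym}(\xi_s,I_sX,Y)$ and $\mu(X,Y)=\epsilon_sT^a(\xi_s,I_sX,Y)$ (independent of $s$). Curvature: $R(A,B)=[\nabla_A,\nabla_B]-\nabla_{[A,B]}$, $R(A,B,C,D)=g(R(A,B)C,D)$; repeated $e_a$ means the $g$-trace over a $g$-orthonormal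 basis of $H$; $\rho_s(B,C)=\frac1{4n}R(B,C,e_a,I_se_a)$, $Ric(B,C)=R(e_a,B,C,e_a)$, $Scal=Ric(e_a,e_a)$, $\lambda=\frac{Scal}{8n(n+2)}$ (equivalently $\lambda=-g(T(\xi_1,\xi_2),\xi_3)$). *)

theory Defs
  imports "HOL-Analysis.Analysis"
begin

section \<open>Smooth manifolds\<close>

fun Ck_on :: "nat \<Rightarrow> 'a::real_normed_vector set \<Rightarrow> ('a \<Rightarrow> 'b::real_normed_vector) \<Rightarrow> bool" where
  "Ck_on 0 S f \<longleftrightarrow> continuous_on S f"
| "Ck_on (Suc k) S f \<longleftrightarrow> (\<forall>x\<in>S. f differentiable (at x)) \<and>
     (\<forall>v. Ck_on k S (\<lambda>x. frechet_derivative f (at x) v))"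

text \<open>Only used for open \<open>S\<close>, where \<open>at x\<close> is the right filter.\<close>
definition Cinf_on :: "'a::real_normed_vector set \<Rightarrow> ('a \<Rightarrow> 'b::real_normed_vector) \<Rightarrow> bool" where
  "Cinf_on S f \<longleftrightarrow> (\<forall>k. Ck_on k S f)"

text \<open>A chart is a pair of its domain and its coordinate map. The manifold is the whole type
  \<open>'m\<close>, which will be of class \<open>t2_space\<close> and \<open>second_countable_topology\<close>;
  its dimension is \<open>DIM('e)\<close>.\<close>
type_synonym ('m, 'e) chart = "'m set \<times> ('m \<Rightarrow> 'e)"

definition smooth_atlas :: "('m::topological_space, 'e::euclidean_space) chart set \<Rightarrow> bool" where
  "smooth_atlas A \<longleftrightarrow> (\<Union>(C, \<phi>)\<in>A. C) = UNIV \<and>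
     (\<forall>(C, \<phi>)\<in>A. open C \<and> open (\<phi> ` C) \<and> homeomorphism C (\<phi> ` C) \<phi> (inv_into C \<phi>)) \<and>
     (\<forall>(C, \<phi>)\<in>A. \<forall>(D, \<psi>)\<in>A. Cinf_on (\<phi> ` (C \<inter> D)) (\<psi> \<circ> inv_into C \<phi>))"

definition smooth_fun :: "('m::topological_space, 'e::euclidean_space) chart set \<Rightarrow> 'm set \<Rightarrow> ('m \<Rightarrow> real) \<Rightarrow> bool" where
  "smooth_fun A W f \<longleftrightarrow> open W \<and> (\<forall>(C, \<phi>)\<in>A. Cinf_on (\<phi> ` (C \<inter> W)) (f \<circ> inv_into C \<phi>))"

definition smooth_at :: "('m::topological_space, 'e::euclidean_space) chart set \<Rightarrow> 'm \<Rightarrow> ('m \<Rightarrow> real) \<Rightarrow> bool" where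
  "smooth_at A p f \<longleftrightarrow> (\<exists>W. p \<in> W \<and> smooth_fun A W f)"

text \<open>Tangent vectors at \<open>p\<close> are derivations of the algebra of germs of smooth functions at
  \<open>p\<close>. The type \<open>tvec\<close> of all operators on functions carries the ambient vector space
  structure; the value on functions that are not smooth near \<open>p\<close> is normalised to 0.\<close>
typedef 'm tvec = "UNIV :: (('m \<Rightarrow> real) \<Rightarrow> real) set"
  morphisms act Tvec by simp

instantiation tvec :: (type) real_vector
begin
definition "0 = Tvec (\<lambda>f. 0)"
definition "v + w = Tvec (\<lambda>f. act v f + act w f)"
definition "v - w = Tvec (\<lambda>f. act v f - act w f)"
definition "- v = Tvec (\<lambda>f. - act v f)"
definition "c *\<^sub>R v = Tvec (\<lambda>f. c * act v f)"
instance
  by standard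
    (simp_all add: zero_tvec_def plus_tvec_def minus_tvec_def uminus_tvec_def scaleR_tvec_def
      Tvec_inverse act_inverse algebra_simps)
end

type_synonym 'm vfield = "'m \<Rightarrow> 'm tvec"

definition lin_on :: "'a::real_vector set \<Rightarrow> ('a \<Rightarrow> 'b::real_vector) \<Rightarrow> bool" where
  "lin_on S f \<longleftrightarrow> (\<forall>x\<in>S. \<forall>y\<in>S. \<forall>a b. f (a *\<^sub>R x + b *\<^sub>R y) = a *\<^sub>R f x + b *\<^sub>R f y)"

definition tangent_space :: "('m::topological_space, 'e::euclidean_space) chart set \<Rightarrow> 'm \<Rightarrow> 'm tvec set" where
  "tangent_space A p = {v.
     (\<forall>f. \<not> smooth_at A p f \<longrightarrow> act v f = 0) \<and>
     (\<forall>f h. smooth_at A p f \<and> smooth_at A p h \<longrightarrow>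
        (\<forall>a b. act v (\<lambda>q. a * f q + b * h q) = a * act v f + b * act v h) \<and>
        act v (\<lambda>q. f q * h q) = act v f * h p + f p * act v h \<and>
        ((\<forall>\<^sub>F q in nhds p. f q = h q) \<longrightarrow> act v f = act v h))}"

text \<open>Local objects are total functions of which only the values on the stated open set matter.\<close>
definition smooth_vfield :: "('m::topological_space, 'e::euclidean_space) chart set \<Rightarrow> 'm set \<Rightarrow> 'm vfield \<Rightarrow> bool" where
  "smooth_vfield A W X \<longleftrightarrow> open W \<and> (\<forall>p\<in>W. X p \<in> tangent_space A p) \<and>
     (\<forall>W' f. W' \<subseteq> W \<and> smooth_fun A W' f \<longrightarrow> smooth_fun A W' (\<lambda>p. act (X p) f))"

definition bracket :: "('m::topological_space, 'e::euclidean_space) chart set \<Rightarrow> 'm vfield \<Rightarrow> 'm vfield \<Rightarrow> 'm vfield" where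
  "bracket A X Y p = Tvec (\<lambda>f. if smooth_at A p f
     then act (X p) (\<lambda>q. act (Y q) f) - act (Y p) (\<lambda>q. act (X q) f) else 0)"

definition smooth_1form :: "('m::topological_space, 'e::euclidean_space) chart set \<Rightarrow> 'm set \<Rightarrow> ('m \<Rightarrow> 'm tvec \<Rightarrow> real) \<Rightarrow> bool" where
  "smooth_1form A U a \<longleftrightarrow> open U \<and> (\<forall>p\<in>U. lin_on (tangent_space A p) (a p)) \<and>
     (\<forall>W X. W \<subseteq> U \<and> smooth_vfield A W X \<longrightarrow> smooth_fun A W (\<lambda>p. a p (X p)))"

section \<open>Differential forms\<close>

text \<open>A \<open>k\<close>-form sends a list of \<open>k\<close> vector fields to a function.\<close>
type_synonym 'm dform = "'m vfield list \<Rightarrow> 'm \<Rightarrow> real"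

definition form0 :: "('m \<Rightarrow> real) \<Rightarrow> 'm dform" where
  "form0 f Xs = f"

definition form1 :: "('m \<Rightarrow> 'm tvec \<Rightarrow> real) \<Rightarrow> 'm dform" where
  "form1 a Xs p = a p ((Xs ! 0) p)"

definition form2 :: "('m \<Rightarrow> 'm tvec \<Rightarrow> 'm tvec \<Rightarrow> real) \<Rightarrow> 'm dform" where
  "form2 b Xs p = b p ((Xs ! 0) p) ((Xs ! 1) p)"

text \<open>\<open>wedge k a b\<close> is the wedge product of a \<open>k\<close>-form \<open>a\<close> with a form \<open>b\<close>, as the sum over
  shuffles with no numerical factor: \<open>S\<close> is the set of positions handed to \<open>a\<close>, and the sign
  counts the inversions of the shuffle. For 1-forms this is \<open>a(A)b(B) - a(B)b(A)\<close>.\<close>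
definition wedge :: "nat \<Rightarrow> 'm dform \<Rightarrow> 'm dform \<Rightarrow> 'm dform" where
  "wedge k a b Xs p = (\<Sum>S | S \<subseteq> {..<length Xs} \<and> card S = k.
     (- 1) ^ card {(i, j). i \<in> S \<and> j \<notin> S \<and> j < i} * a (nths Xs S) p * b (nths Xs (- S)) p)"

text \<open>The invariant formula; for 1-forms it is \<open>d a(A,B) = A a(B) - B a(A) - a([A,B])\<close>.\<close>
definition ext_d :: "('m::topological_space, 'e::euclidean_space) chart set \<Rightarrow> 'm dform \<Rightarrow> 'm dform" where
  "ext_d A a Xs p =
     (\<Sum>i<length Xs. (- 1) ^ i * act ((Xs ! i) p) (a (nths Xs (- {i})))) +
     (\<Sum>j<length Xs. \<Sum>i<j. (- 1) ^ (i + j) * a (bracket A (Xs ! i) (Xs ! j) # nths Xs (- {i, j})) p)"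

definition form_eq :: "('m::topological_space, 'e::euclidean_space) chart set \<Rightarrow> 'm set \<Rightarrow> nat \<Rightarrow> 'm dform \<Rightarrow> 'm dform \<Rightarrow> bool" where
  "form_eq A U k a b \<longleftrightarrow> (\<forall>W Xs. W \<subseteq> U \<and> length Xs = k \<and> (\<forall>X\<in>set Xs. smooth_vfield A W X) \<longrightarrow>
     (\<forall>p\<in>W. a Xs p = b Xs p))"

section \<open>Linear connections\<close>

text \<open>\<open>D p v B\<close> is the derivative at \<open>p\<close> of the local vector field \<open>B\<close> in direction \<open>v\<close>.\<close>
type_synonym 'm conn = "'m \<Rightarrow> 'm tvec \<Rightarrow> 'm vfield \<Rightarrow> 'm tvec"

definition linear_connection :: "('m::topological_space, 'e::euclidean_space) chart set \<Rightarrow> 'm conn \<Rightarrow> bool" where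
  "linear_connection A D \<longleftrightarrow>
     (\<forall>W B. smooth_vfield A W B \<longrightarrow>
       (\<forall>p\<in>W. lin_on (tangent_space A p) (\<lambda>v. D p v B) \<and>
         (\<forall>v\<in>tangent_space A p.
            D p v B \<in> tangent_space A p \<and>
            (\<forall>f. smooth_fun A W f \<longrightarrow> D p v (\<lambda>q. f q *\<^sub>R B q) = act v f *\<^sub>R B p + f p *\<^sub>R D p v B) \<and>
            (\<forall>B'. smooth_vfield A W B' \<longrightarrow> D p v (\<lambda>q. B q + B' q) = D p v B + D p v B') \<and>
            (\<forall>B'. (\<forall>q\<in>W. B' q = B q) \<longrightarrow> D p v B' = D p v B))) \<and>
       (\<forall>X. smooth_vfield A W X \<longrightarrow> smooth_vfield A W (\<lambda>p. D p (X p) B)))"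

definition torsion :: "('m::topological_space, 'e::euclidean_space) chart set \<Rightarrow> 'm conn \<Rightarrow> 'm vfield \<Rightarrow> 'm vfield \<Rightarrow> 'm vfield" where
  "torsion A D X Y p = D p (X p) Y - D p (Y p) X - bracket A X Y p"

definition curvature :: "('m::topological_space, 'e::euclidean_space) chart set \<Rightarrow> 'm conn \<Rightarrow>
    'm vfield \<Rightarrow> 'm vfield \<Rightarrow> 'm vfield \<Rightarrow> 'm vfield" where
  "curvature A D X Y Z p = D p (X p) (\<lambda>q. D q (Y q) Z) - D p (Y p) (\<lambda>q. D q (X q) Z)
     - D p (bracket A X Y p) Z"

section \<open>Paraquaternionic contact structures\<close>

definition eps :: "nat \<Rightarrow> real" where
  "eps s = (if s = 3 then - 1 else 1)"

definition cyc :: "(nat \<times> nat \<times> nat) set" where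
  "cyc = {(1, 2, 3), (2, 3, 1), (3, 1, 2)}"

type_synonym 'm endo = "'m \<Rightarrow> 'm tvec \<Rightarrow> 'm tvec"
type_synonym 'm metric = "'m \<Rightarrow> 'm tvec \<Rightarrow> 'm tvec \<Rightarrow> real"

text \<open>Metrics and endomorphisms of the fibre \<open>H p\<close> are total functions of which only the values
  on \<open>H p\<close> matter; accordingly \<open>PQ p\<close> will contain every total function whose restriction
  to \<open>H p\<close> lies in the fibre of the bundle.\<close>
record ('m, 'e) pqc =
  atlas :: "('m, 'e) chart set"
  qdim :: nat
  H :: "'m \<Rightarrow> 'm tvec set"
  conf :: "'m metric set"
  PQ :: "'m \<Rightarrow> ('m tvec \<Rightarrow> 'm tvec) set"

text \<open>Local data \<open>(\<eta>\<^sub>s, I\<^sub>s, \<xi>\<^sub>s)\<close>, used for \<open>s \<in> {1,2,3}\<close>.\<close>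
record 'm local_data =
  eta :: "nat \<Rightarrow> 'm \<Rightarrow> 'm tvec \<Rightarrow> real"
  cI :: "nat \<Rightarrow> 'm endo"
  xi :: "nat \<Rightarrow> 'm vfield"

definition distribution :: "('m::topological_space, 'e::euclidean_space) chart set \<Rightarrow> nat \<Rightarrow> ('m \<Rightarrow> 'm tvec set) \<Rightarrow> bool" where
  "distribution A d E \<longleftrightarrow>
     (\<forall>p. subspace (E p) \<and> E p \<subseteq> tangent_space A p \<and> dim (E p) = d \<and>
       (\<exists>W X. p \<in> W \<and> (\<forall>a<d. smooth_vfield A W (X a)) \<and>
          (\<forall>q\<in>W. E q = span ((\<lambda>a. X a q) ` {..<d}))))"

definition hfield :: "('m::topological_space, 'e::euclidean_space) pqc \<Rightarrow> 'm set \<Rightarrow> 'm vfield \<Rightarrow> bool" where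
  "hfield M W X \<longleftrightarrow> smooth_vfield (atlas M) W X \<and> (\<forall>p\<in>W. X p \<in> H M p)"

definition neutral_metric :: "('m::topological_space, 'e::euclidean_space) pqc \<Rightarrow> 'm metric \<Rightarrow> bool" where
  "neutral_metric M g \<longleftrightarrow>
     (\<forall>p. \<forall>X\<in>H M p. lin_on (H M p) (g p X) \<and> (\<forall>Y\<in>H M p. g p X Y = g p Y X)) \<and>
     (\<forall>p. \<exists>e. (\<forall>a<4 * qdim M. e a \<in> H M p) \<and>
        (\<forall>a<4 * qdim M. \<forall>b<4 * qdim M.
           g p (e a) (e b) = (if a \<noteq> b then 0 else if a < 2 * qdim M then 1 else - 1))) \<and>
     (\<forall>W X Y. hfield M W X \<and> hfield M W Y \<longrightarrow> smooth_fun (atlas M) W (\<lambda>p. g p (X p) (Y p)))"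

definition conformal_class :: "('m::topological_space, 'e::euclidean_space) pqc \<Rightarrow> 'm metric set \<Rightarrow> bool" where
  "conformal_class M C \<longleftrightarrow> (\<exists>g. neutral_metric M g \<and>
     C = {g'. \<exists>f. smooth_fun (atlas M) UNIV f \<and>
            (\<forall>p. f p > 0 \<and> (\<forall>X\<in>H M p. \<forall>Y\<in>H M p. g' p X Y = f p * g p X Y))})"

definition h_endo :: "('m::topological_space, 'e::euclidean_space) pqc \<Rightarrow> 'm \<Rightarrow> ('m tvec \<Rightarrow> 'm tvec) \<Rightarrow> bool" where
  "h_endo M p E \<longleftrightarrow> lin_on (H M p) E \<and> (\<forall>X\<in>H M p. E X \<in> H M p)"

definition smooth_h_endo :: "('m::topological_space, 'e::euclidean_space) pqc \<Rightarrow> 'm set \<Rightarrow> 'm endo \<Rightarrow> bool" where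
  "smooth_h_endo M U J \<longleftrightarrow> open U \<and> (\<forall>p\<in>U. h_endo M p (J p)) \<and>
     (\<forall>W X. W \<subseteq> U \<and> hfield M W X \<longrightarrow> smooth_vfield (atlas M) W (\<lambda>p. J p (X p)))"

definition compatible :: "('m::topological_space, 'e::euclidean_space) pqc \<Rightarrow> 'm metric \<Rightarrow> 'm set \<Rightarrow> 'm local_data \<Rightarrow> bool" where
  "compatible M g U L \<longleftrightarrow> open U \<and>
     (\<forall>s\<in>{1,2,3}. smooth_1form (atlas M) U (eta L s) \<and> smooth_h_endo M U (cI L s)) \<and>
     (\<forall>p\<in>U. PQ M p = {E. \<exists>c. \<forall>X\<in>H M p. E X = (\<Sum>s\<in>{1,2,3}. c s *\<^sub>R cI L s p X)}) \<and>
     (\<forall>p\<in>U. \<forall>X\<in>H M p. \<forall>Y\<in>H M p.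
        (\<forall>s\<in>{1,2,3}. cI L s p (cI L s p X) = eps s *\<^sub>R X \<and>
           g p (cI L s p X) (cI L s p Y) = - eps s * g p X Y) \<and>
        (\<forall>(i, j, k)\<in>cyc. cI L i p (cI L j p X) = - cI L j p (cI L i p X) \<and>
           cI L i p (cI L j p X) = - (eps k *\<^sub>R cI L k p X))) \<and>
     (\<forall>p\<in>U. H M p = {v \<in> tangent_space (atlas M) p. \<forall>s\<in>{1,2,3}. eta L s p v = 0}) \<and>
     (\<forall>W X Y. W \<subseteq> U \<and> hfield M W X \<and> hfield M W Y \<longrightarrow> (\<forall>p\<in>W. \<forall>s\<in>{1,2,3}.
        ext_d (atlas M) (form1 (eta L s)) [X, Y] p = - 2 * eps s * g p (cI L s p (X p)) (Y p)))"

definition reeb :: "('m::topological_space, 'e::euclidean_space) pqc \<Rightarrow> 'm set \<Rightarrow> 'm local_data \<Rightarrow> bool" where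
  "reeb M U L \<longleftrightarrow>
     (\<forall>s\<in>{1,2,3}. smooth_vfield (atlas M) U (xi L s)) \<and>
     (\<forall>p\<in>U. \<forall>s\<in>{1,2,3}. \<forall>t\<in>{1,2,3}. eta L s p (xi L t p) = (if s = t then 1 else 0)) \<and>
     (\<forall>W X. W \<subseteq> U \<and> hfield M W X \<longrightarrow> (\<forall>p\<in>W.
        (\<forall>s\<in>{1,2,3}. ext_d (atlas M) (form1 (eta L s)) [xi L s, X] p = 0) \<and>
        (\<forall>(i, j, k)\<in>cyc. ext_d (atlas M) (form1 (eta L i)) [xi L j, X] p =
           eps k * ext_d (atlas M) (form1 (eta L j)) [xi L i, X] p)))"

text \<open>Since \<open>H p\<close> has dimension \<open>4n\<close> in a tangent space of dimension \<open>4n + 3\<close>, it has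
  codimension three.\<close>
definition pqc_manifold :: "('m::{t2_space, second_countable_topology}, 'e::euclidean_space) pqc \<Rightarrow> bool" where
  "pqc_manifold M \<longleftrightarrow>
     smooth_atlas (atlas M) \<and> qdim M \<ge> 1 \<and> DIM('e) = 4 * qdim M + 3 \<and>
     distribution (atlas M) (4 * qdim M) (H M) \<and> conformal_class M (conf M) \<and>
     (\<forall>g\<in>conf M. \<forall>p. \<exists>U L. p \<in> U \<and> compatible M g U L \<and> (qdim M = 1 \<longrightarrow> reeb M U L))"

definition hproj :: "'m local_data \<Rightarrow> 'm \<Rightarrow> 'm tvec \<Rightarrow> 'm tvec" where
  "hproj L p v = v - (\<Sum>s\<in>{1,2,3}. eta L s p v *\<^sub>R xi L s p)"

definition vert :: "'m local_data \<Rightarrow> 'm \<Rightarrow> 'm tvec set" where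
  "vert L p = span {xi L 1 p, xi L 2 p, xi L 3 p}"

text \<open>The extension of \<open>g\<close> to the whole tangent bundle.\<close>
definition gext :: "'m metric \<Rightarrow> 'm local_data \<Rightarrow> 'm metric" where
  "gext g L p u v = g p (hproj L p u) (hproj L p v) - (\<Sum>s\<in>{1,2,3}. eps s * eta L s p u * eta L s p v)"

definition omega :: "'m metric \<Rightarrow> 'm local_data \<Rightarrow> nat \<Rightarrow> 'm dform" where
  "omega g L s = form2 (\<lambda>p u v. g p (cI L s p (hproj L p u)) (hproj L p v))"

definition Omega :: "'m metric \<Rightarrow> 'm local_data \<Rightarrow> 'm dform" where
  "Omega g L = (\<lambda>Xs p. - wedge 2 (omega g L 1) (omega g L 1) Xs p
     - wedge 2 (omega g L 2) (omega g L 2) Xs p + wedge 2 (omega g L 3) (omega g L 3) Xs p)"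

definition orthonormal_frame :: "('m::topological_space, 'e::euclidean_space) pqc \<Rightarrow> 'm metric \<Rightarrow> 'm \<Rightarrow> (nat \<Rightarrow> 'm vfield) \<Rightarrow> bool" where
  "orthonormal_frame M g p e \<longleftrightarrow> (\<exists>W. p \<in> W \<and> (\<forall>a<4 * qdim M. hfield M W (e a)) \<and>
     (\<forall>q\<in>W. \<forall>a<4 * qdim M. g q (e a q) (e a q) \<in> {1, - 1} \<and>
        (\<forall>b<4 * qdim M. a \<noteq> b \<longrightarrow> g q (e a q) (e b q) = 0)))"

text \<open>The \<open>g\<close>-trace over \<open>H p\<close>. It is only applied to \<open>F\<close> that are tensorial, so that the
  value does not depend on the local orthonormal frame that is chosen.\<close>
definition htrace :: "('m::topological_space, 'e::euclidean_space) pqc \<Rightarrow> 'm metric \<Rightarrow> 'm \<Rightarrow> ('m vfield \<Rightarrow> 'm vfield \<Rightarrow> real) \<Rightarrow> real" where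
  "htrace M g p F = (let e = (SOME e. orthonormal_frame M g p e)
     in \<Sum>a<4 * qdim M. g p (e a p) (e a p) * F (e a) (e a))"

definition sp_n :: "('m::topological_space, 'e::euclidean_space) pqc \<Rightarrow> 'm metric \<Rightarrow> 'm local_data \<Rightarrow> 'm \<Rightarrow> ('m tvec \<Rightarrow> 'm tvec) set" where
  "sp_n M g L p = {E. h_endo M p E \<and>
     (\<forall>X\<in>H M p. \<forall>Y\<in>H M p. g p (E X) Y = - g p X (E Y)) \<and>
     (\<forall>s\<in>{1,2,3}. \<forall>X\<in>H M p. E (cI L s p X) = cI L s p (E X))}"

definition sp_1 :: "('m::topological_space, 'e::euclidean_space) pqc \<Rightarrow> 'm local_data \<Rightarrow> 'm \<Rightarrow> ('m tvec \<Rightarrow> 'm tvec) set" where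
  "sp_1 M L p = {E. \<exists>c. \<forall>X\<in>H M p. E X = (\<Sum>s\<in>{1,2,3}. c s *\<^sub>R cI L s p X)}"

text \<open>The bundle map \<open>V \<rightarrow> PQ\<close> with \<open>\<xi>\<^sub>s \<mapsto> I\<^sub>s\<close>.\<close>
definition phi :: "'m local_data \<Rightarrow> 'm \<Rightarrow> 'm tvec \<Rightarrow> 'm tvec \<Rightarrow> 'm tvec" where
  "phi L p w X = (\<Sum>s\<in>{1,2,3}. eta L s p w *\<^sub>R cI L s p X)"

definition vfield_in_V :: "('m::topological_space, 'e::euclidean_space) pqc \<Rightarrow> 'm local_data \<Rightarrow> 'm set \<Rightarrow> 'm vfield \<Rightarrow> bool" where
  "vfield_in_V M L W Z \<longleftrightarrow> smooth_vfield (atlas M) W Z \<and> (\<forall>p\<in>W. Z p \<in> vert L p)"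

text \<open>The induced derivative \<open>(\<nabla>\<^sub>v J) X\<close> of a section \<open>J\<close> of \<open>End(H)\<close>, for horizontal \<open>X\<close>.\<close>
definition D_endo :: "'m conn \<Rightarrow> 'm \<Rightarrow> 'm tvec \<Rightarrow> 'm endo \<Rightarrow> 'm vfield \<Rightarrow> 'm tvec" where
  "D_endo D p v J X = D p v (\<lambda>q. J q (X q)) - J p (D p v X)"

definition preserves_splitting :: "('m::topological_space, 'e::euclidean_space) pqc \<Rightarrow> 'm conn \<Rightarrow> 'm set \<Rightarrow> 'm local_data \<Rightarrow> bool" where
  "preserves_splitting M D U L \<longleftrightarrow>
     (\<forall>W. W \<subseteq> U \<longrightarrow> (\<forall>p\<in>W. \<forall>v\<in>tangent_space (atlas M) p.
        (\<forall>X. hfield M W X \<longrightarrow> D p v X \<in> H M p) \<and>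
        (\<forall>Z. vfield_in_V M L W Z \<longrightarrow> D p v Z \<in> vert L p)))"

definition preserves_metric :: "('m::topological_space, 'e::euclidean_space) pqc \<Rightarrow> 'm metric \<Rightarrow> 'm conn \<Rightarrow> 'm set \<Rightarrow> 'm local_data \<Rightarrow> bool" where
  "preserves_metric M g D U L \<longleftrightarrow>
     (\<forall>W X Y. W \<subseteq> U \<and> smooth_vfield (atlas M) W X \<and> smooth_vfield (atlas M) W Y \<longrightarrow>
        (\<forall>p\<in>W. \<forall>v\<in>tangent_space (atlas M) p.
           act v (\<lambda>q. gext g L q (X q) (Y q)) =
             gext g L p (D p v X) (Y p) + gext g L p (X p) (D p v Y)))"

definition preserves_PQ :: "('m::topological_space, 'e::euclidean_space) pqc \<Rightarrow> 'm conn \<Rightarrow> bool" where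
  "preserves_PQ M D \<longleftrightarrow>
     (\<forall>W J. smooth_h_endo M W J \<and> (\<forall>q\<in>W. J q \<in> PQ M q) \<longrightarrow>
        (\<forall>p\<in>W. \<forall>v\<in>tangent_space (atlas M) p. \<exists>E\<in>PQ M p.
           \<forall>W' X. p \<in> W' \<and> W' \<subseteq> W \<and> hfield M W' X \<longrightarrow> D_endo D p v J X = E (X p)))"

definition torsion_conditions :: "('m::topological_space, 'e::euclidean_space) pqc \<Rightarrow> 'm metric \<Rightarrow> 'm conn \<Rightarrow> 'm set \<Rightarrow> 'm local_data \<Rightarrow> bool" where
  "torsion_conditions M g D U L \<longleftrightarrow>
     (\<forall>W X Y. W \<subseteq> U \<and> hfield M W X \<and> hfield M W Y \<longrightarrow> (\<forall>p\<in>W. torsion (atlas M) D X Y p =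
        - (\<Sum>s\<in>{1,2,3}. eta L s p (bracket (atlas M) X Y p) *\<^sub>R xi L s p))) \<and>
     (\<forall>W Z. W \<subseteq> U \<and> vfield_in_V M L W Z \<longrightarrow> (\<forall>p\<in>W. \<forall>E\<in>sp_n M g L p. \<forall>F\<in>sp_1 M L p.
        htrace M g p (\<lambda>X Y. g p (hproj L p (torsion (atlas M) D Z X p)) (E (Y p) + F (Y p))) = 0))"

definition phi_parallel :: "('m::topological_space, 'e::euclidean_space) pqc \<Rightarrow> 'm conn \<Rightarrow> 'm set \<Rightarrow> 'm local_data \<Rightarrow> bool" where
  "phi_parallel M D U L \<longleftrightarrow>
     (\<forall>W Z X. W \<subseteq> U \<and> vfield_in_V M L W Z \<and> hfield M W X \<longrightarrow>
        (\<forall>p\<in>W. \<forall>v\<in>tangent_space (atlas M) p.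
           D_endo D p v (\<lambda>q. phi L q (Z q)) X = phi L p (D p v Z) (X p)))"

definition canonical_connection :: "('m::topological_space, 'e::euclidean_space) pqc \<Rightarrow> 'm metric \<Rightarrow> 'm conn \<Rightarrow> bool" where
  "canonical_connection M g D \<longleftrightarrow> linear_connection (atlas M) D \<and> preserves_PQ M D \<and>
     (\<forall>U L. compatible M g U L \<and> reeb M U L \<longrightarrow>
        preserves_splitting M D U L \<and> preserves_metric M g D U L \<and>
        torsion_conditions M g D U L \<and> phi_parallel M D U L)"

text \<open>The \<open>sp(1,\<real>)\<close>-connection 1-forms: \<open>\<nabla>I\<^sub>i = \<alpha>\<^sub>j I\<^sub>k + \<epsilon>\<^sub>k \<alpha>\<^sub>k I\<^sub>j\<close>.\<close>
definition connection_forms :: "('m::topological_space, 'e::euclidean_space) pqc \<Rightarrow> 'm conn \<Rightarrow> 'm set \<Rightarrow> 'm local_data \<Rightarrow>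
    (nat \<Rightarrow> 'm \<Rightarrow> 'm tvec \<Rightarrow> real) \<Rightarrow> bool" where
  "connection_forms M D U L \<alpha> \<longleftrightarrow>
     (\<forall>W X. W \<subseteq> U \<and> hfield M W X \<longrightarrow> (\<forall>p\<in>W. \<forall>v\<in>tangent_space (atlas M) p. \<forall>(i, j, k)\<in>cyc.
        D_endo D p v (cI L i) X =
          \<alpha> j p v *\<^sub>R cI L k p (X p) + (eps k * \<alpha> k p v) *\<^sub>R cI L j p (X p)))"

definition Tor3 :: "('m::topological_space, 'e::euclidean_space) pqc \<Rightarrow> 'm metric \<Rightarrow> 'm local_data \<Rightarrow> 'm conn \<Rightarrow>
    'm vfield \<Rightarrow> 'm vfield \<Rightarrow> 'm vfield \<Rightarrow> 'm \<Rightarrow> real" where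
  "Tor3 M g L D Z X Y p = gext g L p (torsion (atlas M) D Z X p) (Y p)"

definition Tor_sym :: "('m::topological_space, 'e::euclidean_space) pqc \<Rightarrow> 'm metric \<Rightarrow> 'm local_data \<Rightarrow> 'm conn \<Rightarrow>
    'm vfield \<Rightarrow> 'm vfield \<Rightarrow> 'm vfield \<Rightarrow> 'm \<Rightarrow> real" where
  "Tor_sym M g L D Z X Y p = (Tor3 M g L D Z X Y p + Tor3 M g L D Z Y X p) / 2"

definition Tor_skew :: "('m::topological_space, 'e::euclidean_space) pqc \<Rightarrow> 'm metric \<Rightarrow> 'm local_data \<Rightarrow> 'm conn \<Rightarrow>
    'm vfield \<Rightarrow> 'm vfield \<Rightarrow> 'm vfield \<Rightarrow> 'm \<Rightarrow> real" where
  "Tor_skew M g L D Z X Y p = (Tor3 M g L D Z X Y p - Tor3 M g L D Z Y X p) / 2"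

definition Ifield :: "'m local_data \<Rightarrow> nat \<Rightarrow> 'm vfield \<Rightarrow> 'm vfield" where
  "Ifield L s X = (\<lambda>q. cI L s q (X q))"

definition tau :: "('m::topological_space, 'e::euclidean_space) pqc \<Rightarrow> 'm metric \<Rightarrow> 'm local_data \<Rightarrow> 'm conn \<Rightarrow>
    'm vfield \<Rightarrow> 'm vfield \<Rightarrow> 'm \<Rightarrow> real" where
  "tau M g L D X Y p = - (\<Sum>s\<in>{1,2,3}. eps s * Tor_sym M g L D (xi L s) (Ifield L s X) Y p)"

text \<open>The expression \<open>\<epsilon>\<^sub>s T\<^sup>a(\<xi>\<^sub>s, I\<^sub>s X, Y)\<close> does not depend on \<open>s\<close>; we take \<open>s = 1\<close>.\<close>
definition mu :: "('m::topological_space, 'e::euclidean_space) pqc \<Rightarrow> 'm metric \<Rightarrow> 'm local_data \<Rightarrow> 'm conn \<Rightarrow>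
    'm vfield \<Rightarrow> 'm vfield \<Rightarrow> 'm \<Rightarrow> real" where
  "mu M g L D X Y p = eps 1 * Tor_skew M g L D (xi L 1) (Ifield L 1 X) Y p"

definition R4 :: "('m::topological_space, 'e::euclidean_space) pqc \<Rightarrow> 'm metric \<Rightarrow> 'm local_data \<Rightarrow> 'm conn \<Rightarrow>
    'm vfield \<Rightarrow> 'm vfield \<Rightarrow> 'm vfield \<Rightarrow> 'm vfield \<Rightarrow> 'm \<Rightarrow> real" where
  "R4 M g L D X Y Z W p = gext g L p (curvature (atlas M) D X Y Z p) (W p)"

definition rho :: "('m::topological_space, 'e::euclidean_space) pqc \<Rightarrow> 'm metric \<Rightarrow> 'm local_data \<Rightarrow> 'm conn \<Rightarrow> nat \<Rightarrow> 'm dform" where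
  "rho M g L D s Xs p =
     htrace M g p (\<lambda>X Y. R4 M g L D (Xs ! 0) (Xs ! 1) X (Ifield L s Y) p) / (4 * real (qdim M))"

definition Ric :: "('m::topological_space, 'e::euclidean_space) pqc \<Rightarrow> 'm metric \<Rightarrow> 'm local_data \<Rightarrow> 'm conn \<Rightarrow>
    'm vfield \<Rightarrow> 'm vfield \<Rightarrow> 'm \<Rightarrow> real" where
  "Ric M g L D B C p = htrace M g p (\<lambda>X Y. R4 M g L D X B C Y p)"

definition Scal :: "('m::topological_space, 'e::euclidean_space) pqc \<Rightarrow> 'm metric \<Rightarrow> 'm local_data \<Rightarrow> 'm conn \<Rightarrow> 'm \<Rightarrow> real" where
  "Scal M g L D p = htrace M g p (\<lambda>X Y. Ric M g L D X Y p)"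

definition lam :: "('m::topological_space, 'e::euclidean_space) pqc \<Rightarrow> 'm metric \<Rightarrow> 'm local_data \<Rightarrow> 'm conn \<Rightarrow> 'm \<Rightarrow> real" where
  "lam M g L D p = Scal M g L D p / (8 * real (qdim M) * (real (qdim M) + 2))"

text \<open>The trace-free part of the Ricci 2-form \<open>\<rho>\<^sub>s\<close>: its \<open>\<omega>\<^sub>s\<close>-component is removed. As
  \<open>\<omega>\<^sub>s(e\<^sub>a, I\<^sub>s e\<^sub>a) = - 4n \<epsilon>\<^sub>s\<close>, the resulting 2-form \<open>\<sigma>\<close> satisfies \<open>\<sigma>(e\<^sub>a, I\<^sub>s e\<^sub>a) = 0\<close>.
  It is a 2-form on the whole tangent bundle; its components with arguments in \<open>V\<close> are those of
  \<open>\<rho>\<^sub>s\<close> since \<open>\<omega>\<^sub>s\<close> is horizontal.\<close>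
definition rho0 :: "('m::topological_space, 'e::euclidean_space) pqc \<Rightarrow> 'm metric \<Rightarrow> 'm local_data \<Rightarrow> 'm conn \<Rightarrow> nat \<Rightarrow> 'm dform" where
  "rho0 M g L D s Xs p = rho M g L D s Xs p
     + eps s / (4 * real (qdim M)) * htrace M g p (\<lambda>X Y. rho M g L D s [X, Ifield L s Y] p)
       * omega g L s Xs p"

end

theory Submission
  imports Defs
begin

text \<open>Since \<open>\<xi>\<^sub>s \<mapsto> I\<^sub>s\<close> is parallel, \<open>\<nabla>\<xi>\<^sub>i = \<alpha>\<^sub>j \<xi>\<^sub>k + \<epsilon>\<^sub>k \<alpha>\<^sub>k \<xi>\<^sub>j\<close>, hence
  \<open>d\<eta>\<^sub>i = \<eta>\<^sub>j \<and> \<alpha>\<^sub>k + \<epsilon>\<^sub>j \<eta>\<^sub>k \<and> \<alpha>\<^sub>j + \<eta>\<^sub>i \<circ> T\<close>, and the first equation amounts to the vertical part of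
  the torsion. The vertical part of the first Bianchi identity on three horizontal fields, evaluated
  on \<open>X, I\<^sub>j X, I\<^sub>i X\<close>, shows that \<open>T(\<xi>, X)\<close> is horizontal. On \<open>X, Y, \<xi>\<^sub>t\<close> it expresses the Ricci
  2-forms by \<open>g(T(\<xi>\<^sub>t, X), Y)\<close> and the \<open>\<eta>\<^sub>i(T(\<xi>\<^sub>s, \<xi>\<^sub>t))\<close>; tracing with \<open>I\<^sub>s\<close>, where orthogonality of
  \<open>T\<^sub>\<xi>\<close> to \<open>sp(1,\<real>)\<close> kills the torsion, gives \<open>T(\<xi>\<^sub>i, \<xi>\<^sub>j)\<^bsub>|V\<^esub> = \<epsilon>\<^sub>k \<Lambda> \<xi>\<^sub>k\<close> with a single function
  \<open>\<Lambda>\<close>, and orthogonality to \<open>sp(n,\<real>)\<close> turns what is left into the formula for \<open>\<rho>\<^sup>0\<close>. A double trace of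
  the horizontal part of the Bianchi identity identifies \<open>\<Lambda>\<close> with \<open>\<lambda>\<close>. The second equation is the
  exterior derivative of the first one, and the third is the second one wedged with \<open>\<omega>\<^sub>i\<close> and
  summed.\<close>

section \<open>Smooth functions of a Euclidean variable\<close>

text \<open>Two difficulties shape the argument. Torsion and curvature act on vector fields, whereas
  the algebra of the I_s lives in one fibre of H. A local orthonormal frame mediates: horizontal
  fields are smooth combinations of it, so an expression that is linear over functions depends on
  values at a point only, and a vector extends to a field with constant coefficients. Secondly,
  \<open>htrace\<close>, and with it \<rho>, Scal and \<lambda>, is defined through a chosen frame,
  so traces are computed one point at a time, in exactly the frame that is chosen there. Smoothness
  of \<lambda> is invisible in this form; derivatives are therefore taken of \<Lambda>, a component
  of the torsion, and \<lambda> is inserted afterwards. The signs enter through \<epsilon>_1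
  \<epsilon>_2 \<epsilon>_3 = -1. Each curvature form of V occurs in the curvature of two Reeb
  fields, so the Bianchi identity yields it twice. Comparing the two expressions forces a single
  \<Lambda>, makes \<mu> independent of s, and relates the symmetric torsions of different Reeb
  fields.\<close>

lemma Ck_on_subset: "Ck_on k S f \<Longrightarrow> T \<subseteq> S \<Longrightarrow> Ck_on k T f"
  by (induction k arbitrary: f) (auto intro: continuous_on_subset)

text \<open>On an open set, agreement passes to the derivatives at every point, and so by induction
  to all higher derivatives.\<close>

lemma Ck_on_cong:
  assumes "open S" "\<And>x. x \<in> S \<Longrightarrow> f x = h x" "Ck_on k S f"
  shows "Ck_on k S h"
  using assms(2,3)
proof (induction k arbitrary: f h)
  case 0
  then show ?case by (simp cong: continuous_on_cong)
next
  case (Suc k)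
  have 1: "h differentiable (at x)" if x: "x \<in> S" for x
  proof -
    have "(f has_derivative frechet_derivative f (at x)) (at x)"
      using Suc.prems(2) x by (simp add: frechet_derivative_works[symmetric])
    then have "(h has_derivative frechet_derivative f (at x)) (at x)"
      using has_derivative_transform_within_open[OF _ assms(1) x] Suc.prems(1) by blast
    then show ?thesis by (auto simp: differentiable_def)
  qed
  have 2: "frechet_derivative f (at x) v = frechet_derivative h (at x) v" if "x \<in> S" for x v
    using Suc.prems that frechet_derivative_transform_within_open[of f x S h] assms(1) by auto
  show ?case
    using 1 Suc.prems(2) Suc.IH[OF 2] by auto
qed

lemma Ck_on_SucD: "Ck_on (Suc k) S f \<Longrightarrow> Ck_on k S f"
proof (induction k arbitrary: f)
  case 0
  then show ?case
    by (auto intro!: continuous_at_imp_continuous_on differentiable_imp_continuous_within)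
next
  case (Suc k)
  then show ?case by (metis Ck_on.simps(2))
qed

lemma Ck_on_const: "Ck_on k S (\<lambda>x. c)"
  by (induction k arbitrary: c) auto

lemma Ck_on_add:
  assumes "open S" "Ck_on k S f" "Ck_on k S h"
  shows "Ck_on k S (\<lambda>x. f x + h x)"
  using assms(2,3)
proof (induction k arbitrary: f h)
  case 0
  then show ?case by (auto intro: continuous_on_add)
next
  case (Suc k)
  have eq: "frechet_derivative f (at x) v + frechet_derivative h (at x) v
      = frechet_derivative (\<lambda>x. f x + h x) (at x) v" if "x \<in> S" for x v
  proof -
    have "((\<lambda>x. f x + h x) has_derivative
        (\<lambda>v. frechet_derivative f (at x) v + frechet_derivative h (at x) v)) (at x)"
      using Suc.prems that by (auto intro!: has_derivative_add simp: frechet_derivative_works[symmetric])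
    from frechet_derivative_at[OF this] show ?thesis by metis
  qed
  have "Ck_on k S (\<lambda>x. frechet_derivative (\<lambda>x. f x + h x) (at x) v)" for v
    by (rule Ck_on_cong[OF assms(1) eq]) (use Suc.prems in \<open>auto intro!: Suc.IH\<close>)
  then show ?case using Suc.prems by auto
qed

lemma Ck_on_mult:
  fixes f h :: "'a::real_normed_vector \<Rightarrow> real"
  assumes "open S" "Ck_on k S f" "Ck_on k S h"
  shows "Ck_on k S (\<lambda>x. f x * h x)"
  using assms(2,3)
proof (induction k arbitrary: f h)
  case 0
  then show ?case by (auto intro: continuous_on_mult)
next
  case (Suc k)
  have eq: "f x * frechet_derivative h (at x) v + frechet_derivative f (at x) v * h x
      = frechet_derivative (\<lambda>x. f x * h x) (at x) v" if "x \<in> S" for x v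
  proof -
    have "((\<lambda>x. f x * h x) has_derivative
        (\<lambda>v. f x * frechet_derivative h (at x) v + frechet_derivative f (at x) v * h x)) (at x)"
      using Suc.prems that by (auto intro!: has_derivative_mult simp: frechet_derivative_works[symmetric])
    from frechet_derivative_at[OF this] show ?thesis by metis
  qed
  have "Ck_on k S (\<lambda>x. frechet_derivative (\<lambda>x. f x * h x) (at x) v)" for v
    by (rule Ck_on_cong[OF assms(1) eq])
      (use Suc.prems Suc.prems[THEN Ck_on_SucD] in \<open>auto intro!: Ck_on_add[OF assms(1)] Suc.IH\<close>)
  then show ?case using Suc.prems by auto
qed

text \<open>The exponent is general so that the induction hypothesis covers the factor with exponent
  \<open>r - 1\<close> in the derivative. The case \<open>- 1 / 2\<close> normalises frame vectors
  later.\<close>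

lemma Ck_on_powr:
  fixes f :: "'a::real_normed_vector \<Rightarrow> real"
  assumes "open S" "Ck_on k S f" "\<And>x. x \<in> S \<Longrightarrow> f x > 0"
  shows "Ck_on k S (\<lambda>x. f x powr r)"
  using assms(2)
proof (induction k arbitrary: r)
  case 0
  have "f x \<noteq> 0" if "x \<in> S" for x
    using assms(3)[OF that] by simp
  then show ?case using 0 by (auto intro!: continuous_on_powr continuous_on_const)
next
  case (Suc k)
  have der: "((\<lambda>x. f x powr r) has_derivative
        (\<lambda>v. r * f x powr (r - 1) * frechet_derivative f (at x) v)) (at x)" if "x \<in> S" for x
  proof -
    have "(f has_derivative frechet_derivative f (at x)) (at x)"
      using Suc.prems that by (auto simp: frechet_derivative_works[symmetric])
    from has_derivative_powr[OF this has_derivative_const assms(3)[OF that], of r] show ?thesis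
      using assms(3)[OF that] by (auto simp: powr_diff algebra_simps divide_simps)
  qed
  have eq: "r * f x powr (r - 1) * frechet_derivative f (at x) v
      = frechet_derivative (\<lambda>x. f x powr r) (at x) v" if "x \<in> S" for x v
    using frechet_derivative_at[OF der[OF that]] by metis
  have "Ck_on k S (\<lambda>x. frechet_derivative (\<lambda>x. f x powr r) (at x) v)" for v
    by (rule Ck_on_cong[OF assms(1) eq])
      (use Suc.prems Suc.prems[THEN Ck_on_SucD] in
        \<open>auto intro!: Ck_on_mult[OF assms(1)] Ck_on_const Suc.IH\<close>)
  then show ?case using der by (auto simp: differentiable_def)
qed

section \<open>Smooth functions and vector fields on a manifold\<close>

lemma act_tvec [simp]:
  "act 0 f = 0" "act (v + w) f = act v f + act w f" "act (v - w) f = act v f - act w f"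
  "act (- v) f = - act v f" "act (c *\<^sub>R v) f = c * act v f"
  by (simp_all add: zero_tvec_def plus_tvec_def minus_tvec_def uminus_tvec_def scaleR_tvec_def
      Tvec_inverse)

lemma act_sum [simp]: "act (\<Sum>i\<in>I. v i) f = (\<Sum>i\<in>I. act (v i) f)"
  by (induction I rule: infinite_finite_induct) auto

lemma tvec_eqI: "(\<And>f. act v f = act w f) \<Longrightarrow> v = w"
  by (metis act_inject ext)

locale manifold =
  fixes A :: "('m::t2_space, 'e::euclidean_space) chart set"
  assumes atlas: "smooth_atlas A"
begin

lemma chart_homeomorphism: "(C, \<phi>) \<in> A \<Longrightarrow> homeomorphism C (\<phi> ` C) \<phi> (inv_into C \<phi>)"
  and open_chart: "(C, \<phi>) \<in> A \<Longrightarrow> open C"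
  using atlas by (auto simp: smooth_atlas_def)

lemma chart_open:
  assumes "(C, \<phi>) \<in> A" "open W"
  shows "open (\<phi> ` (C \<inter> W))"
proof -
  have "openin (top_of_set (\<phi> ` C)) (\<phi> ` (C \<inter> W))"
    using assms by (intro homeomorphism_imp_open_map[OF chart_homeomorphism[OF assms(1)]])
      (auto intro: openin_open_Int)
  moreover have "open (\<phi> ` C)" using atlas assms(1) by (auto simp: smooth_atlas_def)
  ultimately show ?thesis using openin_open_trans by blast
qed

lemma chart_inj:
  assumes "(C, \<phi>) \<in> A" shows "inj_on \<phi> C"
proof (rule inj_on_inverseI)
  show "inv_into C \<phi> (\<phi> x) = x" if "x \<in> C" for x
    using chart_homeomorphism[OF assms] that by (simp add: homeomorphism_def)
qed

lemma smooth_fun_open: "smooth_fun A W f \<Longrightarrow> open W"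
  by (simp add: smooth_fun_def)

lemma smooth_fun_subset: "smooth_fun A W f \<Longrightarrow> W' \<subseteq> W \<Longrightarrow> open W' \<Longrightarrow> smooth_fun A W' f"
  unfolding smooth_fun_def Cinf_on_def
  by (fast intro: Ck_on_subset)

lemma smooth_fun_cong:
  assumes "smooth_fun A W f" "\<And>q. q \<in> W \<Longrightarrow> h q = f q"
  shows "smooth_fun A W h"
  unfolding smooth_fun_def
proof (intro conjI ballI)
  show W: "open W" using assms smooth_fun_open by auto
  fix c assume "c \<in> A"
  then obtain C \<phi> where c: "c = (C, \<phi>)" "(C, \<phi>) \<in> A" by (cases c) auto
  have "Ck_on k (\<phi> ` (C \<inter> W)) (f \<circ> inv_into C \<phi>)" for k
    using assms(1) c by (auto simp: smooth_fun_def Cinf_on_def)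
  moreover have "(f \<circ> inv_into C \<phi>) x = (h \<circ> inv_into C \<phi>) x" if "x \<in> \<phi> ` (C \<inter> W)" for x
    using that assms(2) chart_inj[OF c(2)] by auto
  ultimately have "Ck_on k (\<phi> ` (C \<inter> W)) (h \<circ> inv_into C \<phi>)" for k
    using Ck_on_cong[OF chart_open[OF c(2) W]] by blast
  then show "case c of (C, \<phi>) \<Rightarrow> Cinf_on (\<phi> ` (C \<inter> W)) (h \<circ> inv_into C \<phi>)"
    by (simp add: c Cinf_on_def)
qed

lemma smooth_fun_const: "open W \<Longrightarrow> smooth_fun A W (\<lambda>q. c)"
  by (auto simp: smooth_fun_def Cinf_on_def o_def Ck_on_const)

lemma smooth_fun_add:
  "smooth_fun A W f \<Longrightarrow> smooth_fun A W h \<Longrightarrow> smooth_fun A W (\<lambda>q. f q + h q)"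
  unfolding smooth_fun_def Cinf_on_def o_def using Ck_on_add chart_open by fast

lemma smooth_fun_mult:
  "smooth_fun A W f \<Longrightarrow> smooth_fun A W h \<Longrightarrow> smooth_fun A W (\<lambda>q. f q * h q)"
  unfolding smooth_fun_def Cinf_on_def o_def using Ck_on_mult chart_open by fast

lemma smooth_fun_powr:
  assumes "smooth_fun A W f" "\<And>q. q \<in> W \<Longrightarrow> f q > 0"
  shows "smooth_fun A W (\<lambda>q. f q powr r)"
  unfolding smooth_fun_def Cinf_on_def o_def
proof (intro conjI ballI, goal_cases)
  case 1
  then show ?case using assms smooth_fun_open by blast
next
  case (2 c)
  then obtain C \<phi> where c: "c = (C, \<phi>)" "(C, \<phi>) \<in> A" by (cases c) auto
  have "Ck_on k (\<phi> ` (C \<inter> W)) (\<lambda>x. f (inv_into C \<phi> x))" for k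
    using assms(1) c by (auto simp: smooth_fun_def Cinf_on_def o_def)
  moreover have "f (inv_into C \<phi> x) > 0" if "x \<in> \<phi> ` (C \<inter> W)" for x
    using that assms(2) chart_inj[OF c(2)] by auto
  ultimately have "Ck_on k (\<phi> ` (C \<inter> W)) (\<lambda>x. f (inv_into C \<phi> x) powr r)" for k
    by (intro Ck_on_powr chart_open[OF c(2) smooth_fun_open[OF assms(1)]]) auto
  then show ?case by (simp add: c)
qed

lemma smooth_fun_minus: "smooth_fun A W f \<Longrightarrow> smooth_fun A W (\<lambda>q. - f q)"
  using smooth_fun_mult[OF smooth_fun_const[of W "-1"], of f] by (auto dest: smooth_fun_open)

lemma smooth_fun_diff:
  "smooth_fun A W f \<Longrightarrow> smooth_fun A W h \<Longrightarrow> smooth_fun A W (\<lambda>q. f q - h q)"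
  using smooth_fun_add[OF _ smooth_fun_minus, of W f h] by simp

text \<open>Used to shrink domains: positivity of a smooth function is an open condition.\<close>

lemma smooth_fun_continuous:
  assumes "smooth_fun A W f" shows "continuous_on W f"
proof -
  have "isCont f p" if "p \<in> W" for p
  proof -
    have "p \<in> (\<Union>(C, \<phi>)\<in>A. C)" using atlas by (simp add: smooth_atlas_def)
    then obtain C \<phi> where c: "(C, \<phi>) \<in> A" "p \<in> C" by auto
    note C = chart_homeomorphism[OF c(1)] open_chart[OF c(1)] and inj = chart_inj[OF c(1)]
    have "Ck_on 0 (\<phi> ` (C \<inter> W)) (f \<circ> inv_into C \<phi>)"
      using assms c unfolding smooth_fun_def Cinf_on_def by fast
    then have 1: "continuous_on (\<phi> ` (C \<inter> W)) (f \<circ> inv_into C \<phi>)" by simp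
    have "continuous_on (C \<inter> W) ((f \<circ> inv_into C \<phi>) \<circ> \<phi>)"
      using C(1) by (intro continuous_on_compose 1) (auto simp: homeomorphism_def intro: continuous_on_subset)
    then have "continuous_on (C \<inter> W) f"
      by (rule continuous_on_eq) (use inj in auto)
    then show ?thesis
      using that c C(2) smooth_fun_open[OF assms]
      by (auto simp: continuous_on_eq_continuous_at open_Int)
  qed
  then show ?thesis by (simp add: continuous_at_imp_continuous_on)
qed

lemma smooth_atI: "smooth_fun A W f \<Longrightarrow> p \<in> W \<Longrightarrow> smooth_at A p f"
  by (auto simp: smooth_at_def)

lemma smooth_atE:
  assumes "smooth_at A p f" "open W" "p \<in> W"
  obtains W' where "W' \<subseteq> W" "p \<in> W'" "smooth_fun A W' f"
proof -
  obtain V where V: "p \<in> V" "smooth_fun A V f" using assms by (auto simp: smooth_at_def)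
  show thesis
    by (rule that[of "V \<inter> W"]) (use V assms smooth_fun_open in \<open>auto intro: smooth_fun_subset\<close>)
qed

lemma smooth_atE2:
  assumes "smooth_at A p f" "smooth_at A p h" "open W" "p \<in> W"
  obtains W' where "W' \<subseteq> W" "p \<in> W'" "smooth_fun A W' f" "smooth_fun A W' h"
proof -
  obtain V where V: "V \<subseteq> W" "p \<in> V" "smooth_fun A V f" using smooth_atE assms by metis
  obtain V' where V': "V' \<subseteq> V" "p \<in> V'" "smooth_fun A V' h"
    using smooth_atE[OF assms(2) smooth_fun_open[OF V(3)] V(2)] by metis
  show thesis
    by (rule that[of V']) (use V V' smooth_fun_open in \<open>auto intro: smooth_fun_subset\<close>)
qed

lemma tangentI:
  assumes "\<And>f. \<not> smooth_at A p f \<Longrightarrow> act v f = 0"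
    and "\<And>f h a b. smooth_at A p f \<Longrightarrow> smooth_at A p h \<Longrightarrow>
      act v (\<lambda>q. a * f q + b * h q) = a * act v f + b * act v h"
    and "\<And>f h. smooth_at A p f \<Longrightarrow> smooth_at A p h \<Longrightarrow>
      act v (\<lambda>q. f q * h q) = act v f * h p + f p * act v h"
    and "\<And>f h. smooth_at A p f \<Longrightarrow> smooth_at A p h \<Longrightarrow>
      \<forall>\<^sub>F q in nhds p. f q = h q \<Longrightarrow> act v f = act v h"
  shows "v \<in> tangent_space A p"
  unfolding tangent_space_def mem_Collect_eq using assms by blast

lemma tangent_germ:
  "v \<in> tangent_space A p \<Longrightarrow> smooth_at A p f \<Longrightarrow> smooth_at A p h \<Longrightarrow>
     \<forall>\<^sub>F q in nhds p. f q = h q \<Longrightarrow> act v f = act v h"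
  unfolding tangent_space_def mem_Collect_eq by blast

lemma tangent_not_smooth: "v \<in> tangent_space A p \<Longrightarrow> \<not> smooth_at A p f \<Longrightarrow> act v f = 0"
  unfolding tangent_space_def mem_Collect_eq by blast

text \<open>Smoothness of \<open>h\<close> near \<open>p\<close> follows from the agreement with
  \<open>f\<close>, so locality becomes usable for functions known only through their values on
  \<open>W\<close>.\<close>

lemma tangent_cong:
  assumes "v \<in> tangent_space A p" "smooth_at A p f" "open W" "p \<in> W" "\<And>q. q \<in> W \<Longrightarrow> h q = f q"
  shows "act v h = act v f"
proof -
  obtain W' where W': "W' \<subseteq> W" "p \<in> W'" "smooth_fun A W' f" using smooth_atE assms by metis
  then have "smooth_fun A W' h" using assms by (intro smooth_fun_cong[OF W'(3)]) auto
  then have "smooth_at A p h" using W' by (auto simp: smooth_at_def)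
  moreover have "\<forall>\<^sub>F q in nhds p. h q = f q"
    using assms by (auto simp: eventually_nhds)
  ultimately show ?thesis using assms(1,2) by (intro tangent_germ)
qed

lemma tangent_lin:
  "v \<in> tangent_space A p \<Longrightarrow> smooth_at A p f \<Longrightarrow> smooth_at A p h \<Longrightarrow>
     act v (\<lambda>q. a * f q + b * h q) = a * act v f + b * act v h"
  unfolding tangent_space_def mem_Collect_eq by blast

lemma tangent_mult:
  "v \<in> tangent_space A p \<Longrightarrow> smooth_at A p f \<Longrightarrow> smooth_at A p h \<Longrightarrow>
     act v (\<lambda>q. f q * h q) = act v f * h p + f p * act v h"
  unfolding tangent_space_def mem_Collect_eq by blast

lemma tangent_add:
  "v \<in> tangent_space A p \<Longrightarrow> smooth_at A p f \<Longrightarrow> smooth_at A p h \<Longrightarrow>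
     act v (\<lambda>q. f q + h q) = act v f + act v h"
  using tangent_lin[of v p f h 1 1] by simp

lemma tangent_diff:
  "v \<in> tangent_space A p \<Longrightarrow> smooth_at A p f \<Longrightarrow> smooth_at A p h \<Longrightarrow>
     act v (\<lambda>q. f q - h q) = act v f - act v h"
  using tangent_lin[of v p f h 1 "-1"] by simp

lemma tangent_cmult:
  "v \<in> tangent_space A p \<Longrightarrow> smooth_at A p f \<Longrightarrow> act v (\<lambda>q. c * f q) = c * act v f"
  using tangent_lin[of v p f f c 0] by simp

lemma tangent_const:
  assumes "v \<in> tangent_space A p" shows "act v (\<lambda>q. c) = 0"
proof -
  have 1: "smooth_at A p (\<lambda>q. c)" for c
    using smooth_fun_const[of UNIV c] smooth_atI by blast
  \<comment> \<open>The Leibniz rule for 1 = 1 * 1 gives v(1) = 2 v(1).\<close>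
  have "act v (\<lambda>q. 1) = 0" using tangent_mult[OF assms 1[of 1] 1[of 1]] by simp
  then show ?thesis using tangent_cmult[OF assms 1[of 1], of c] by simp
qed

lemma tangent_zero: "0 \<in> tangent_space A p"
  by (rule tangentI) auto

lemma tangent_plus:
  assumes "v \<in> tangent_space A p" "w \<in> tangent_space A p"
  shows "v + w \<in> tangent_space A p"
proof (rule tangentI)
  show "act (v + w) f = act (v + w) h"
    if "smooth_at A p f" "smooth_at A p h" "\<forall>\<^sub>F q in nhds p. f q = h q" for f h
    using tangent_germ[OF assms(1) that] tangent_germ[OF assms(2) that] by simp
qed (use assms in \<open>auto simp: tangent_not_smooth tangent_lin tangent_mult algebra_simps\<close>)

lemma tangent_scaleR:
  assumes "v \<in> tangent_space A p"
  shows "c *\<^sub>R v \<in> tangent_space A p"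
proof (rule tangentI)
  show "act (c *\<^sub>R v) f = act (c *\<^sub>R v) h"
    if "smooth_at A p f" "smooth_at A p h" "\<forall>\<^sub>F q in nhds p. f q = h q" for f h
    using tangent_germ[OF assms that] by simp
qed (use assms in \<open>auto simp: tangent_not_smooth tangent_lin tangent_mult algebra_simps\<close>)

lemma tangent_subspace: "subspace (tangent_space A p)"
  by (simp add: subspace_def tangent_zero tangent_plus tangent_scaleR)

text \<open>Tangent vectors are normalised to 0 on functions that are not smooth at
  \<open>p\<close>, so comparing them on smooth germs decides equality of operators.\<close>

lemma tangent_eqI:
  assumes "v \<in> tangent_space A p" "w \<in> tangent_space A p"
    and "\<And>f. smooth_at A p f \<Longrightarrow> act v f = act w f"
  shows "v = w"
proof (rule tvec_eqI)
  fix f show "act v f = act w f"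
    using assms by (cases "smooth_at A p f") (auto simp: tangent_not_smooth)
qed

lemma smooth_vfield_open: "smooth_vfield A W X \<Longrightarrow> open W"
  by (simp add: smooth_vfield_def)

lemma smooth_vfield_tangent: "smooth_vfield A W X \<Longrightarrow> p \<in> W \<Longrightarrow> X p \<in> tangent_space A p"
  by (simp add: smooth_vfield_def)

lemma smooth_vfield_act:
  "smooth_vfield A W X \<Longrightarrow> smooth_fun A W' f \<Longrightarrow> W' \<subseteq> W \<Longrightarrow> smooth_fun A W' (\<lambda>p. act (X p) f)"
  by (simp add: smooth_vfield_def)

lemma smooth_vfield_subset:
  "smooth_vfield A W X \<Longrightarrow> W' \<subseteq> W \<Longrightarrow> open W' \<Longrightarrow> smooth_vfield A W' X"
  unfolding smooth_vfield_def by auto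

lemma smooth_vfield_add:
  "smooth_vfield A W X \<Longrightarrow> smooth_vfield A W Y \<Longrightarrow> smooth_vfield A W (\<lambda>q. X q + Y q)"
  unfolding smooth_vfield_def by (auto intro: tangent_plus smooth_fun_add)

lemma smooth_vfield_scale:
  assumes "smooth_fun A W f" "smooth_vfield A W X"
  shows "smooth_vfield A W (\<lambda>q. f q *\<^sub>R X q)"
  unfolding smooth_vfield_def
proof (intro conjI allI impI ballI)
  fix W' h assume a: "W' \<subseteq> W \<and> smooth_fun A W' h"
  have "smooth_fun A W' f" using a assms smooth_fun_subset smooth_fun_open by blast
  then show "smooth_fun A W' (\<lambda>p. act (f p *\<^sub>R X p) h)"
    using a assms by (auto intro!: smooth_fun_mult simp: smooth_vfield_def)
qed (use assms in \<open>auto simp: smooth_vfield_def intro: tangent_scaleR\<close>)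

lemma smooth_vfield_zero: "open W \<Longrightarrow> smooth_vfield A W (\<lambda>q. 0)"
  by (auto simp: smooth_vfield_def tangent_zero intro: smooth_fun_const smooth_fun_open)

lemma smooth_vfield_cscale:
  "smooth_vfield A W X \<Longrightarrow> smooth_vfield A W (\<lambda>q. c *\<^sub>R X q)"
  using smooth_vfield_scale[OF smooth_fun_const] smooth_vfield_open by blast

lemma smooth_vfield_minus: "smooth_vfield A W X \<Longrightarrow> smooth_vfield A W (\<lambda>q. - X q)"
  using smooth_vfield_cscale[of W X "-1"] by simp

lemma smooth_vfield_diff:
  "smooth_vfield A W X \<Longrightarrow> smooth_vfield A W Y \<Longrightarrow> smooth_vfield A W (\<lambda>q. X q - Y q)"
  using smooth_vfield_add[OF _ smooth_vfield_minus, of W X Y] by simp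

lemma smooth_vfield_sum:
  "open W \<Longrightarrow> (\<And>i. i \<in> I \<Longrightarrow> smooth_vfield A W (X i)) \<Longrightarrow> smooth_vfield A W (\<lambda>q. \<Sum>i\<in>I. X i q)"
  by (induction I rule: infinite_finite_induct) (auto intro: smooth_vfield_add smooth_vfield_zero)

section \<open>The Lie bracket\<close>

lemma smooth_at_act:
  assumes "smooth_vfield A W X" "p \<in> W" "smooth_at A p f"
  shows "smooth_at A p (\<lambda>q. act (X q) f)"
proof -
  obtain W' where "W' \<subseteq> W" "p \<in> W'" "smooth_fun A W' f"
    using smooth_atE[OF assms(3) smooth_vfield_open[OF assms(1)] assms(2)] by metis
  then show ?thesis using smooth_vfield_act[OF assms(1)] smooth_atI by metis
qed

lemma act_bracket:
  "smooth_at A p f \<Longrightarrow> act (bracket A X Y p) f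
     = act (X p) (\<lambda>q. act (Y q) f) - act (Y p) (\<lambda>q. act (X q) f)"
  by (simp add: bracket_def Tvec_inverse)

lemma act_act_lin:
  assumes X: "smooth_vfield A W X" and Y: "smooth_vfield A W Y" and p: "p \<in> W"
    and f: "smooth_at A p f" and h: "smooth_at A p h"
  shows "act (X p) (\<lambda>q. act (Y q) (\<lambda>q. a * f q + b * h q))
    = a * act (X p) (\<lambda>q. act (Y q) f) + b * act (X p) (\<lambda>q. act (Y q) h)"
proof -
  obtain W' where W': "W' \<subseteq> W" "p \<in> W'" "smooth_fun A W' f" "smooth_fun A W' h"
    using smooth_atE2[OF f h smooth_vfield_open[OF X] p] by metis
  have Xp: "X p \<in> tangent_space A p" using X p smooth_vfield_tangent by blast
  have s: "smooth_at A p (\<lambda>q. act (Y q) f)" "smooth_at A p (\<lambda>q. act (Y q) h)"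
    using smooth_at_act[OF Y p] f h by auto
  have sf: "smooth_at A p (\<lambda>q. a * act (Y q) f + b * act (Y q) h)"
    using W' smooth_vfield_act[OF Y _ W'(1)] smooth_fun_open[OF W'(3)]
    by (auto intro!: smooth_atI smooth_fun_add smooth_fun_mult smooth_fun_const)
  have "act (X p) (\<lambda>q. act (Y q) (\<lambda>q. a * f q + b * h q))
      = act (X p) (\<lambda>q. a * act (Y q) f + b * act (Y q) h)"
    by (rule tangent_cong[OF Xp sf smooth_fun_open[OF W'(3)] W'(2)])
      (use W' Y in \<open>auto intro!: tangent_lin smooth_vfield_tangent[OF Y] smooth_atI\<close>)
  then show ?thesis using tangent_lin[OF Xp s] by simp
qed

text \<open>The two products of first derivatives are symmetric in \<open>X\<close> and
  \<open>Y\<close>; they cancel in the commutator, which makes the bracket a derivation.\<close>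

lemma act_act_mult:
  assumes X: "smooth_vfield A W X" and Y: "smooth_vfield A W Y" and p: "p \<in> W"
    and f: "smooth_at A p f" and h: "smooth_at A p h"
  shows "act (X p) (\<lambda>q. act (Y q) (\<lambda>q. f q * h q))
    = act (X p) (\<lambda>q. act (Y q) f) * h p + act (Y p) f * act (X p) h
      + act (X p) f * act (Y p) h + f p * act (X p) (\<lambda>q. act (Y q) h)"
proof -
  obtain W' where W': "W' \<subseteq> W" "p \<in> W'" "smooth_fun A W' f" "smooth_fun A W' h"
    using smooth_atE2[OF f h smooth_vfield_open[OF X] p] by metis
  have Xp: "X p \<in> tangent_space A p" using X p smooth_vfield_tangent by blast
  have s: "smooth_fun A W' (\<lambda>q. act (Y q) f)" "smooth_fun A W' (\<lambda>q. act (Y q) h)"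
    using smooth_vfield_act[OF Y] W' by auto
  note s' = smooth_atI[OF smooth_fun_mult W'(2)] smooth_atI[OF _ W'(2)]
  have sf: "smooth_at A p (\<lambda>q. act (Y q) f * h q + f q * act (Y q) h)"
    using W' s by (auto intro!: smooth_atI[OF _ W'(2)] smooth_fun_add smooth_fun_mult)
  have "act (X p) (\<lambda>q. act (Y q) (\<lambda>q. f q * h q))
      = act (X p) (\<lambda>q. act (Y q) f * h q + f q * act (Y q) h)"
    by (rule tangent_cong[OF Xp sf smooth_fun_open[OF W'(3)] W'(2)])
      (use W' Y in \<open>auto intro!: tangent_mult smooth_vfield_tangent[OF Y] smooth_atI\<close>)
  then show ?thesis using s W' by (simp add: s' tangent_add[OF Xp] tangent_mult[OF Xp])
qed

lemma smooth_at_lin: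
  assumes "smooth_at A p f" "smooth_at A p h"
  shows "smooth_at A p (\<lambda>q. a * f q + b * h q)"
proof -
  obtain W' where W': "p \<in> W'" "smooth_fun A W' f" "smooth_fun A W' h"
    using smooth_atE2[OF assms open_UNIV] by auto
  then show ?thesis using smooth_fun_open[OF W'(2)]
    by (auto intro!: smooth_atI[OF _ W'(1)] smooth_fun_add smooth_fun_mult smooth_fun_const)
qed

lemma smooth_at_mult:
  assumes "smooth_at A p f" "smooth_at A p h"
  shows "smooth_at A p (\<lambda>q. f q * h q)"
proof -
  obtain W' where W': "p \<in> W'" "smooth_fun A W' f" "smooth_fun A W' h"
    using smooth_atE2[OF assms open_UNIV] by auto
  then show ?thesis
    by (auto intro!: smooth_atI[OF _ W'(1)] smooth_fun_mult)
qed

lemma act_act_cong: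
  assumes X: "smooth_vfield A W X" and Y: "smooth_vfield A W Y" and p: "p \<in> W"
    and f: "smooth_at A p f" and h: "smooth_at A p h" and fh: "\<forall>\<^sub>F q in nhds p. f q = h q"
  shows "act (X p) (\<lambda>q. act (Y q) f) = act (X p) (\<lambda>q. act (Y q) h)"
proof -
  obtain W' where W': "W' \<subseteq> W" "p \<in> W'" "smooth_fun A W' f" "smooth_fun A W' h"
    using smooth_atE2[OF f h smooth_vfield_open[OF X] p] by metis
  obtain V where V: "open V" "p \<in> V" "\<And>q. q \<in> V \<Longrightarrow> f q = h q"
    using fh by (auto simp: eventually_nhds)
  have Xp: "X p \<in> tangent_space A p" using X p smooth_vfield_tangent by blast
  show ?thesis
  proof (rule tangent_cong[OF Xp smooth_at_act[OF Y p h], of "W' \<inter> V"])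
    show "open (W' \<inter> V)" "p \<in> W' \<inter> V" using W' V smooth_fun_open by auto
    fix q assume q: "q \<in> W' \<inter> V"
    show "act (Y q) f = act (Y q) h"
      by (rule tangent_cong[of _ q _ V]) (use q W' V Y in \<open>auto intro: smooth_vfield_tangent smooth_atI\<close>)
  qed
qed

lemma bracket_tangent:
  assumes "smooth_vfield A W X" "smooth_vfield A W Y" "p \<in> W"
  shows "bracket A X Y p \<in> tangent_space A p"
proof (rule tangentI)
  fix f h a b
  show "\<not> smooth_at A p f \<Longrightarrow> act (bracket A X Y p) f = 0"
    by (simp add: bracket_def Tvec_inverse)
  assume fh: "smooth_at A p f" "smooth_at A p h"
  show "act (bracket A X Y p) (\<lambda>q. a * f q + b * h q)
      = a * act (bracket A X Y p) f + b * act (bracket A X Y p) h"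
    using assms fh by (simp add: act_bracket smooth_at_lin act_act_lin[of W] algebra_simps)
  show "act (bracket A X Y p) (\<lambda>q. f q * h q)
      = act (bracket A X Y p) f * h p + f p * act (bracket A X Y p) h"
    using assms fh by (simp add: act_bracket smooth_at_mult act_act_mult[of W] algebra_simps)
  assume "\<forall>\<^sub>F q in nhds p. f q = h q"
  then show "act (bracket A X Y p) f = act (bracket A X Y p) h"
    using assms fh act_act_cong[of W X Y p f h] act_act_cong[of W Y X p f h]
    by (simp add: act_bracket)
qed

lemma smooth_vfield_bracket:
  assumes "smooth_vfield A W X" "smooth_vfield A W Y"
  shows "smooth_vfield A W (bracket A X Y)"
  unfolding smooth_vfield_def
proof (intro conjI allI impI ballI)
  fix W' f assume a: "W' \<subseteq> W \<and> smooth_fun A W' f"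
  show "smooth_fun A W' (\<lambda>p. act (bracket A X Y p) f)"
    by (rule smooth_fun_cong[of _ "\<lambda>p. act (X p) (\<lambda>q. act (Y q) f) - act (Y p) (\<lambda>q. act (X q) f)"])
      (use a assms in \<open>auto intro!: smooth_fun_diff smooth_vfield_act act_bracket smooth_atI\<close>)
qed (use assms bracket_tangent smooth_vfield_open in auto)

lemma act_cong_field:
  assumes "smooth_vfield A W X" "smooth_vfield A W Y" "p \<in> W" "smooth_at A p f"
    "\<And>q. q \<in> W \<Longrightarrow> Y' q = Y q"
  shows "act (X p) (\<lambda>q. act (Y' q) f) = act (X p) (\<lambda>q. act (Y q) f)"
  by (rule tangent_cong[of _ p _ W]) (use assms in
      \<open>auto intro!: smooth_vfield_tangent smooth_at_act[of W Y] dest: smooth_vfield_open\<close>)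

lemma bracket_cong:
  assumes "smooth_vfield A W X" "smooth_vfield A W Y" "p \<in> W"
    "\<And>q. q \<in> W \<Longrightarrow> X' q = X q" "\<And>q. q \<in> W \<Longrightarrow> Y' q = Y q"
  shows "bracket A X' Y' p = bracket A X Y p"
proof (rule tvec_eqI)
  fix f show "act (bracket A X' Y' p) f = act (bracket A X Y p) f"
    using assms act_cong_field[of W X Y p f Y'] act_cong_field[of W Y X p f X']
    by (simp add: bracket_def Tvec_inverse)
qed

lemma bracket_skew: "bracket A Y X p = - bracket A X Y p"
  by (rule tvec_eqI) (simp add: bracket_def Tvec_inverse)

lemma bracket_add_right:
  assumes "smooth_vfield A W X" "smooth_vfield A W Y" "smooth_vfield A W Z" "p \<in> W"
  shows "bracket A X (\<lambda>q. Y q + Z q) p = bracket A X Y p + bracket A X Z p"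
proof (rule tvec_eqI)
  fix f show "act (bracket A X (\<lambda>q. Y q + Z q) p) f = act (bracket A X Y p + bracket A X Z p) f"
    using assms
    by (auto simp: bracket_def Tvec_inverse tangent_add[of _ p] smooth_at_act[of W] smooth_vfield_tangent[of W])
qed

lemma bracket_scale_right:
  assumes "smooth_vfield A W X" "smooth_vfield A W Y" "smooth_fun A W u" "p \<in> W"
  shows "bracket A X (\<lambda>q. u q *\<^sub>R Y q) p = u p *\<^sub>R bracket A X Y p + act (X p) u *\<^sub>R Y p"
proof (rule tangent_eqI[of _ p])
  show "bracket A X (\<lambda>q. u q *\<^sub>R Y q) p \<in> tangent_space A p"
    using assms by (intro bracket_tangent[of W] smooth_vfield_scale)
  show "u p *\<^sub>R bracket A X Y p + act (X p) u *\<^sub>R Y p \<in> tangent_space A p"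
    using assms by (intro tangent_plus tangent_scaleR bracket_tangent[of W]) (auto intro: smooth_vfield_tangent)
  fix f assume f: "smooth_at A p f"
  have u: "smooth_at A p u" using assms smooth_atI by blast
  show "act (bracket A X (\<lambda>q. u q *\<^sub>R Y q) p) f
      = act (u p *\<^sub>R bracket A X Y p + act (X p) u *\<^sub>R Y p) f"
    using assms f u
    by (simp add: act_bracket tangent_mult[of _ p] smooth_at_act[of W] smooth_vfield_tangent[of W] algebra_simps)
qed

lemma jacobi:
  assumes "smooth_vfield A W X" "smooth_vfield A W Y" "smooth_vfield A W Z" "p \<in> W"
  shows "bracket A X (bracket A Y Z) p + bracket A Y (bracket A Z X) p
    + bracket A Z (bracket A X Y) p = 0"
proof -
  \<comment> \<open>The commutator formula for the inner bracket holds only where \<open>f\<close>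
    is smooth, so it is inserted on a neighbourhood of \<open>p\<close> before the outer derivative
    is taken.\<close>
  have *: "act (X p) (\<lambda>q. act (bracket A Y Z q) f)
      = act (X p) (\<lambda>q. act (Y q) (\<lambda>q. act (Z q) f)) - act (X p) (\<lambda>q. act (Z q) (\<lambda>q. act (Y q) f))"
    if XYZ: "smooth_vfield A W X" "smooth_vfield A W Y" "smooth_vfield A W Z" and f: "smooth_at A p f"
    for X Y Z f
  proof -
    have Xp: "X p \<in> tangent_space A p" using XYZ assms smooth_vfield_tangent by blast
    obtain W' where W': "W' \<subseteq> W" "p \<in> W'" "smooth_fun A W' f"
      using smooth_atE[OF f smooth_vfield_open[OF XYZ(1)] assms(4)] by metis
    have s: "smooth_at A p (\<lambda>q. act (Y q) (\<lambda>q. act (Z q) f))"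
      if "smooth_vfield A W Y" "smooth_vfield A W Z" for Y Z
      using smooth_at_act[OF that(1) assms(4) smooth_at_act[OF that(2) assms(4) f]] .
    have "act (X p) (\<lambda>q. act (bracket A Y Z q) f)
      = act (X p) (\<lambda>q. act (Y q) (\<lambda>q. act (Z q) f) - act (Z q) (\<lambda>q. act (Y q) f))"
      using smooth_at_lin[OF s[OF XYZ(2,3)] s[OF XYZ(3,2)], of 1 "-1"]
      by (intro tangent_cong[OF Xp _ smooth_fun_open[OF W'(3)] W'(2)])
        (use W' in \<open>auto intro!: act_bracket smooth_atI\<close>)
    then show ?thesis using s XYZ by (simp add: tangent_diff[OF Xp])
  qed
  show ?thesis
  proof (rule tangent_eqI[of _ p])
    show "bracket A X (bracket A Y Z) p + bracket A Y (bracket A Z X) p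
        + bracket A Z (bracket A X Y) p \<in> tangent_space A p"
      using assms by (intro tangent_plus bracket_tangent[of W] smooth_vfield_bracket)
    show "0 \<in> tangent_space A p" by (rule tangent_zero)
    fix f assume f: "smooth_at A p f"
    then show "act (bracket A X (bracket A Y Z) p + bracket A Y (bracket A Z X) p
        + bracket A Z (bracket A X Y) p) f = act 0 f"
      using assms by (simp add: act_bracket smooth_at_act[of W] *)
  qed
qed

end

section \<open>Wedge products and exterior derivatives on lists of fields\<close>

lemma sum_subsets_card1:
  fixes f :: "nat set \<Rightarrow> real"
  shows "(\<Sum>S | S \<subseteq> {..<n} \<and> card S = 1. f S) = (\<Sum>a<n. f {a})"
proof -
  have "{S. S \<subseteq> {..<n} \<and> card S = 1} = (\<lambda>a. {a}) ` {..<n}"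
    by (auto simp: card_1_singleton_iff)
  then show ?thesis by (simp add: sum.reindex)
qed

lemma sum_subsets_card2:
  fixes f :: "nat set \<Rightarrow> real"
  shows "(\<Sum>S | S \<subseteq> {..<n} \<and> card S = 2. f S) = (\<Sum>b<n. \<Sum>a<b. f {a, b})"
proof -
  let ?I = "SIGMA b:{..<n}. {..<b}"
  have inj: "inj_on (\<lambda>(b, a). {a, b}) ?I"
    by (auto simp: inj_on_def doubleton_eq_iff)
  have "S \<in> (\<lambda>(b, a). {a, b}) ` ?I" if S: "S \<subseteq> {..<n}" "card S = 2" for S
  proof -
    obtain x y where xy: "S = {x, y}" "x \<noteq> y" using S(2) by (auto simp: card_2_iff)
    then consider "x < y" | "y < x" by linarith
    then show ?thesis
    proof cases
      case 1 then show ?thesis using S(1) xy by (intro image_eqI[of _ _ "(y, x)"]) auto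
    next
      case 2 then show ?thesis using S(1) xy by (intro image_eqI[of _ _ "(x, y)"]) auto
    qed
  qed
  then have "{S. S \<subseteq> {..<n} \<and> card S = 2} = (\<lambda>(b, a). {a, b}) ` ?I"
    by (auto simp: card_2_iff)
  then have "(\<Sum>S | S \<subseteq> {..<n} \<and> card S = 2. f S) = (\<Sum>z\<in>?I. f (case z of (b, a) \<Rightarrow> {a, b}))"
    using sum.reindex[OF inj, of f] by (simp only: o_def)
  also have "\<dots> = (\<Sum>b<n. \<Sum>a<b. f {a, b})"
    by (subst sum.Sigma) (auto intro: sum.cong)
  finally show ?thesis .
qed

lemma shuffle_sign1: "card {(i, j). i \<in> {a::nat} \<and> j \<notin> {a} \<and> j < i} = a"
proof -
  have "{(i, j). i \<in> {a} \<and> j \<notin> {a} \<and> j < i} = {a} \<times> {..<a}" by auto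
  then show ?thesis by simp
qed

text \<open>Below \<open>a\<close> lie \<open>a\<close> positions, none of them chosen; below
  \<open>b\<close> lie \<open>b\<close> positions, one of which is the chosen \<open>a\<close>,
  hence \<open>b - 1\<close>.\<close>

lemma shuffle_sign2:
  assumes "a < (b::nat)"
  shows "card {(i, j). i \<in> {a, b} \<and> j \<notin> {a, b} \<and> j < i} = a + (b - 1)"
proof -
  have "{(i, j). i \<in> {a, b} \<and> j \<notin> {a, b} \<and> j < i} = {a} \<times> {..<a} \<union> {b} \<times> ({..<b} - {a})"
    using assms by auto
  moreover have "card ({a} \<times> {..<a} \<union> {b} \<times> ({..<b} - {a})) = a + (b - 1)"
    using assms by (subst card_Un_disjoint) auto
  ultimately show ?thesis by simp
qed

lemma wedge_1:
  "wedge 1 u v Xs p = (\<Sum>a<length Xs. (- 1) ^ a * u (nths Xs {a}) p * v (nths Xs (- {a})) p)"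
  unfolding wedge_def sum_subsets_card1 shuffle_sign1 ..

lemma wedge_2:
  "wedge 2 u v Xs p = (\<Sum>b<length Xs. \<Sum>a<b. (- 1) ^ (a + (b - 1)) * u (nths Xs {a, b}) p * v (nths Xs (- {a, b})) p)"
  unfolding wedge_def sum_subsets_card2 by (intro sum.cong refl) (subst shuffle_sign2, auto)

lemmas list_eval = nths_Cons lessThan_Suc lessThan_0 numeral_nat

text \<open>These expansions turn an identity of forms into a polynomial identity in their values on
  given fields; five arguments are reached by the derivative of the fundamental four-form.\<close>

lemma wedge_1_2: "wedge 1 u v [A, B] p = u [A] p * v [B] p - u [B] p * v [A] p"
  unfolding wedge_1 by (simp add: list_eval)

lemma wedge_1_3: "wedge 1 u v [A, B, C] p = u [A] p * v [B, C] p - u [B] p * v [A, C] p + u [C] p * v [A, B] p"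
  unfolding wedge_1 by (simp add: list_eval)

lemma wedge_2_3: "wedge 2 u v [A, B, C] p = u [A, B] p * v [C] p - u [A, C] p * v [B] p + u [B, C] p * v [A] p"
  unfolding wedge_2 by (simp add: list_eval)

lemma wedge_2_4: "wedge 2 u v [A, B, C, X] p = u [A, B] p * v [C, X] p - u [A, C] p * v [B, X] p
    + u [A, X] p * v [B, C] p + u [B, C] p * v [A, X] p - u [B, X] p * v [A, C] p + u [C, X] p * v [A, B] p"
  unfolding wedge_2 by (simp add: list_eval)

lemma wedge_1_5: "wedge 1 u v [A, B, C, X, Y] p = u [A] p * v [B, C, X, Y] p - u [B] p * v [A, C, X, Y] p
    + u [C] p * v [A, B, X, Y] p - u [X] p * v [A, B, C, Y] p + u [Y] p * v [A, B, C, X] p"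
  unfolding wedge_1 by (simp add: list_eval)

lemma wedge_2_5: "wedge 2 u v [A, B, C, X, Y] p = u [A, B] p * v [C, X, Y] p - u [A, C] p * v [B, X, Y] p
    + u [A, X] p * v [B, C, Y] p - u [A, Y] p * v [B, C, X] p + u [B, C] p * v [A, X, Y] p
    - u [B, X] p * v [A, C, Y] p + u [B, Y] p * v [A, C, X] p + u [C, X] p * v [A, B, Y] p
    - u [C, Y] p * v [A, B, X] p + u [X, Y] p * v [A, B, C] p"
  unfolding wedge_2 by (simp add: list_eval)

lemma ext_d_0: "ext_d At (form0 f) [A] p = act (A p) f"
  by (simp add: ext_d_def form0_def[abs_def] list_eval)

lemma ext_d_3: "ext_d At a [A, B, C] p = act (A p) (a [B, C]) - act (B p) (a [A, C]) + act (C p) (a [A, B])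
    - a [bracket At A B, C] p + a [bracket At A C, B] p - a [bracket At B C, A] p"
  unfolding ext_d_def by (simp add: list_eval)

lemma ext_d_5: "ext_d At a [A, B, C, X, Y] p = act (A p) (a [B, C, X, Y]) - act (B p) (a [A, C, X, Y])
    + act (C p) (a [A, B, X, Y]) - act (X p) (a [A, B, C, Y]) + act (Y p) (a [A, B, C, X])
    - a [bracket At A B, C, X, Y] p + a [bracket At A C, B, X, Y] p - a [bracket At A X, B, C, Y] p
    + a [bracket At A Y, B, C, X] p - a [bracket At B C, A, X, Y] p + a [bracket At B X, A, C, Y] p
    - a [bracket At B Y, A, C, X] p - a [bracket At C X, A, B, Y] p + a [bracket At C Y, A, B, X] p
    - a [bracket At X Y, A, B, C] p"
  unfolding ext_d_def by (simp add: list_eval)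

section \<open>Compatible local data\<close>

lemma eps_simps [simp]: "eps (Suc 0) = 1" "eps 1 = 1" "eps 2 = 1" "eps 3 = -1"
  by (simp_all add: eps_def)

lemma eps_square [simp]: "eps s * eps s = 1" "eps s * (eps s * x) = x"
  by (simp_all add: eps_def)

lemma eps_nonzero [simp]: "eps s \<noteq> 0"
  by (simp add: eps_def)

lemma cyc_cases:
  assumes "(i, j, k) \<in> cyc"
  obtains "i = 1" "j = 2" "k = 3" | "i = 2" "j = 3" "k = 1" | "i = 3" "j = 1" "k = 2"
  using assms by (auto simp: cyc_def)

lemma cyc_rotate: "(i, j, k) \<in> cyc \<Longrightarrow> (j, k, i) \<in> cyc" "(i, j, k) \<in> cyc \<Longrightarrow> (k, i, j) \<in> cyc"
  by (auto simp: cyc_def)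

lemma cyc_in:
  assumes "(i, j, k) \<in> cyc"
  shows "i \<in> {1,2,3}" "j \<in> {1,2,3}" "k \<in> {1,2,3}"
  using assms by (auto simp: cyc_def)

lemma cyc_distinct: "(i, j, k) \<in> cyc \<Longrightarrow> i \<noteq> j \<and> j \<noteq> k \<and> i \<noteq> k"
  by (auto simp: cyc_def)

lemma cyc_eps: "(i, j, k) \<in> cyc \<Longrightarrow> eps i * eps j = - eps k \<and> eps j * eps k = - eps i \<and> eps k * eps i = - eps j"
  by (auto simp: cyc_def)

lemma cyc_exists: "s \<in> {1,2,3} \<Longrightarrow> \<exists>j k. (s, j, k) \<in> cyc"
  by (auto simp: cyc_def)

lemma cyc_UNIV: "(i, j, k) \<in> cyc \<Longrightarrow> {1,2,3} = {i, j, k}"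
  by (auto simp: cyc_def)

lemma cyc_sum:
  fixes f :: "nat \<Rightarrow> 'a::comm_monoid_add"
  shows "(i, j, k) \<in> cyc \<Longrightarrow> (\<Sum>s\<in>{1,2,3}. f s) = f i + f j + f k"
  unfolding cyc_UNIV using cyc_distinct by (fastforce simp: add.assoc)

lemma lin_on_add: "lin_on S f \<Longrightarrow> x \<in> S \<Longrightarrow> y \<in> S \<Longrightarrow> f (x + y) = f x + f y"
  unfolding lin_on_def by (metis scaleR_one)

lemma lin_on_scaleR: "lin_on S f \<Longrightarrow> x \<in> S \<Longrightarrow> f (c *\<^sub>R x) = c *\<^sub>R f x"
  unfolding lin_on_def by (metis add.right_neutral scaleR_zero_left)

lemma lin_on_zero: "lin_on S f \<Longrightarrow> x \<in> S \<Longrightarrow> f 0 = 0"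
  using lin_on_scaleR[of S f x 0] by simp

lemma lin_on_diff:
  "lin_on S f \<Longrightarrow> x \<in> S \<Longrightarrow> y \<in> S \<Longrightarrow> f (x - y) = f x - f y"
  unfolding lin_on_def
  by (metis add_uminus_conv_diff scaleR_minus1_left scaleR_one)

lemma lin_on_sum:
  assumes "lin_on S f" "subspace S" "\<And>i. i \<in> I \<Longrightarrow> x i \<in> S"
  shows "f (\<Sum>i\<in>I. c i *\<^sub>R x i) = (\<Sum>i\<in>I. c i *\<^sub>R f (x i))"
  using assms(3)
proof (induction I rule: infinite_finite_induct)
  case (insert i I)
  then show ?case
    using assms(1,2)
    by (simp add: lin_on_add[OF assms(1)] lin_on_scaleR[OF assms(1)] subspace_scale subspace_sum)
qed (use lin_on_zero[OF assms(1) subspace_0[OF assms(2)]] in auto)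

locale pqc_data =
  fixes M :: "('m::{t2_space, second_countable_topology}, 'e::euclidean_space) pqc"
    and g :: "'m metric"
    and D :: "'m conn"
    and U :: "'m set"
    and L :: "'m local_data"
    and \<alpha> :: "nat \<Rightarrow> 'm \<Rightarrow> 'm tvec \<Rightarrow> real"
  assumes pqc: "pqc_manifold M"
    and g_conf: "g \<in> conf M"
    and canonical: "canonical_connection M g D"
    and compat: "compatible M g U L"
    and reeb: "reeb M U L"
    and conn_forms: "connection_forms M D U L \<alpha>"

sublocale pqc_data \<subseteq> manifold "atlas M"
  using pqc by unfold_locales (simp add: pqc_manifold_def)

context pqc_data
begin

abbreviation "T \<equiv> tangent_space (atlas M)"
abbreviation "vf \<equiv> smooth_vfield (atlas M)"
abbreviation "sf \<equiv> smooth_fun (atlas M)"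
abbreviation "hf \<equiv> hfield M"
abbreviation "br \<equiv> bracket (atlas M)"
abbreviation "\<eta> \<equiv> eta L"
abbreviation "J \<equiv> cI L"
abbreviation "\<xi> \<equiv> xi L"
abbreviation "N \<equiv> 4 * qdim M"

lemma open_U: "open U"
  using compat by (simp add: compatible_def)

lemma qdim_pos: "qdim M \<ge> 1"
  using pqc by (simp add: pqc_manifold_def)

lemma H_subspace: "subspace (H M p)"
  using pqc by (auto simp: pqc_manifold_def distribution_def)

lemma H_tangent: "x \<in> H M p \<Longrightarrow> x \<in> T p"
  using pqc by (auto simp: pqc_manifold_def distribution_def)

lemmas H_closed [simp, intro] =
  subspace_0[OF H_subspace] subspace_add[OF H_subspace] subspace_diff[OF H_subspace]
  subspace_scale[OF H_subspace] subspace_neg[OF H_subspace]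

lemma H_sum [simp, intro]: "(\<And>i. i \<in> I \<Longrightarrow> x i \<in> H M p) \<Longrightarrow> (\<Sum>i\<in>I. x i) \<in> H M p"
  by (rule subspace_sum[OF H_subspace])

lemmas T_closed [simp, intro] =
  subspace_0[OF tangent_subspace] subspace_add[OF tangent_subspace] subspace_diff[OF tangent_subspace]
  subspace_scale[OF tangent_subspace] subspace_neg[OF tangent_subspace]

lemma T_sum [simp, intro]: "(\<And>i. i \<in> I \<Longrightarrow> x i \<in> T p) \<Longrightarrow> (\<Sum>i\<in>I. x i) \<in> T p"
  by (rule subspace_sum[OF tangent_subspace])

lemma hf_vf: "hf W X \<Longrightarrow> vf W X"
  by (simp add: hfield_def)

lemma hf_H: "hf W X \<Longrightarrow> p \<in> W \<Longrightarrow> X p \<in> H M p"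
  by (simp add: hfield_def)

lemma hfI: "vf W X \<Longrightarrow> (\<And>p. p \<in> W \<Longrightarrow> X p \<in> H M p) \<Longrightarrow> hf W X"
  by (simp add: hfield_def)

lemma hf_open: "hf W X \<Longrightarrow> open W"
  using hf_vf smooth_vfield_open by blast

lemma hf_subset: "hf W X \<Longrightarrow> W' \<subseteq> W \<Longrightarrow> open W' \<Longrightarrow> hf W' X"
  by (auto simp: hfield_def intro: smooth_vfield_subset)

lemma hf_add: "hf W X \<Longrightarrow> hf W Y \<Longrightarrow> hf W (\<lambda>q. X q + Y q)"
  by (auto simp: hfield_def intro: smooth_vfield_add)

lemma hf_diff: "hf W X \<Longrightarrow> hf W Y \<Longrightarrow> hf W (\<lambda>q. X q - Y q)"
  by (auto simp: hfield_def intro: smooth_vfield_diff)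

lemma hf_scale: "sf W f \<Longrightarrow> hf W X \<Longrightarrow> hf W (\<lambda>q. f q *\<^sub>R X q)"
  by (auto simp: hfield_def intro: smooth_vfield_scale)

lemma hf_cscale: "hf W X \<Longrightarrow> hf W (\<lambda>q. c *\<^sub>R X q)"
  by (auto simp: hfield_def intro: smooth_vfield_cscale)

lemma hf_sum: "open W \<Longrightarrow> (\<And>i. i \<in> I \<Longrightarrow> hf W (X i)) \<Longrightarrow> hf W (\<lambda>q. \<Sum>i\<in>I. X i q)"
  by (auto simp: hfield_def intro: smooth_vfield_sum)

text \<open>Membership in the conformal class only says that \<open>g\<close> is a positive multiple
  \<open>f\<close> of some neutral metric on H; an orthonormal basis of the latter, divided by sqrt
  f, serves for \<open>g\<close>.\<close>

lemma neutral: "neutral_metric M g"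
proof -
  obtain g0 f where g0: "neutral_metric M g0" and f: "sf UNIV f" "\<And>p. f p > 0"
    and g: "\<And>p x y. x \<in> H M p \<Longrightarrow> y \<in> H M p \<Longrightarrow> g p x y = f p * g0 p x y"
    using pqc g_conf unfolding pqc_manifold_def conformal_class_def by blast
  note n0 = g0[unfolded neutral_metric_def, THEN conjunct1, THEN spec, THEN bspec]
  have lin: "lin_on (H M p) (g0 p x)" if "x \<in> H M p" for p x
    using n0[OF that] ..
  have sym: "g0 p x y = g0 p y x" if "x \<in> H M p" "y \<in> H M p" for p x y
    using n0[OF that(1)] that(2) by blast
  have "\<exists>e. (\<forall>a<N. e a \<in> H M p) \<and> (\<forall>a<N. \<forall>b<N.
      g p (e a) (e b) = (if a \<noteq> b then 0 else if a < 2 * qdim M then 1 else - 1))" for p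
  proof -
    from g0[unfolded neutral_metric_def, THEN conjunct2, THEN conjunct1, THEN spec, of p]
    obtain e where e: "\<forall>a<N. e a \<in> H M p" "\<forall>a<N. \<forall>b<N.
      g0 p (e a) (e b) = (if a \<noteq> b then 0 else if a < 2 * qdim M then 1 else - 1)"
      by (elim exE conjE) (rule that)
    define c where "c = 1 / sqrt (f p)"
    have c: "f p * (c * c) = 1" using f(2)[of p] by (simp add: c_def)
    have "g p (c *\<^sub>R e a) (c *\<^sub>R e b) = g0 p (e a) (e b)" if "a < N" "b < N" for a b
    proof -
      have "g p (c *\<^sub>R e a) (c *\<^sub>R e b) = f p * (c * g0 p (c *\<^sub>R e a) (e b))"
        using that e(1) by (simp add: g lin_on_scaleR[OF lin])
      also have "g0 p (c *\<^sub>R e a) (e b) = c * g0 p (e a) (e b)"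
        using that e(1) by (simp add: sym[of "c *\<^sub>R e a"] sym[of "e a" p "e b"] lin_on_scaleR[OF lin])
      finally show ?thesis using c by (simp add: algebra_simps)
    qed
    then show ?thesis using e by (intro exI[of _ "\<lambda>a. c *\<^sub>R e a"]) auto
  qed
  moreover have "sf W (\<lambda>p. g p (X p) (Y p))" if "hf W X \<and> hf W Y" for W X Y
  proof -
    have W: "open W" using that hf_open by blast
    have "sf W (\<lambda>p. g0 p (X p) (Y p))"
      using g0[unfolded neutral_metric_def, THEN conjunct2, THEN conjunct2] that by blast
    moreover have "sf W f" using f(1) W smooth_fun_subset by blast
    ultimately have "sf W (\<lambda>p. f p * g0 p (X p) (Y p))" by (intro smooth_fun_mult)
    then show ?thesis by (rule smooth_fun_cong) (use that in \<open>auto simp: g hf_H\<close>)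
  qed
  moreover have "lin_on (H M p) (g p x)" if "x \<in> H M p" for p x
    using that lin[OF that] by (auto simp: lin_on_def g algebra_simps)
  moreover have "g p x y = g p y x" if "x \<in> H M p" "y \<in> H M p" for p x y
    using that by (simp add: g sym[of x p y])
  ultimately show ?thesis unfolding neutral_metric_def by (intro conjI allI ballI impI) auto
qed

lemma g_sym: "x \<in> H M p \<Longrightarrow> y \<in> H M p \<Longrightarrow> g p x y = g p y x"
  using neutral[unfolded neutral_metric_def, THEN conjunct1] by blast

lemma g_lin: "x \<in> H M p \<Longrightarrow> lin_on (H M p) (g p x)"
  using neutral[unfolded neutral_metric_def, THEN conjunct1] by blast

lemma g_right [simp]:
  assumes "x \<in> H M p" "y \<in> H M p"
  shows "z \<in> H M p \<Longrightarrow> g p x (y + z) = g p x y + g p x z"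
    "z \<in> H M p \<Longrightarrow> g p x (y - z) = g p x y - g p x z"
    "g p x (c *\<^sub>R y) = c * g p x y" "g p x (- y) = - g p x y" "g p x 0 = 0"
  using lin_on_add[OF g_lin] lin_on_diff[OF g_lin] lin_on_scaleR[OF g_lin] lin_on_zero[OF g_lin] assms
    lin_on_scaleR[OF g_lin, of x p y "-1"]
  by auto

lemma g_left [simp]:
  assumes "x \<in> H M p" "y \<in> H M p"
  shows "z \<in> H M p \<Longrightarrow> g p (y + z) x = g p y x + g p z x"
    "z \<in> H M p \<Longrightarrow> g p (y - z) x = g p y x - g p z x"
    "g p (c *\<^sub>R y) x = c * g p y x" "g p (- y) x = - g p y x" "g p 0 x = 0"
  using assms by (simp_all add: g_sym[of _ p x])

lemma g_sum_right:
  "x \<in> H M p \<Longrightarrow> (\<And>i. i \<in> I \<Longrightarrow> y i \<in> H M p) \<Longrightarrow> g p x (\<Sum>i\<in>I. y i) = (\<Sum>i\<in>I. g p x (y i))"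
  using lin_on_sum[OF g_lin H_subspace, of x p I y "\<lambda>_. 1"] by simp

lemma g_sum_left:
  "x \<in> H M p \<Longrightarrow> (\<And>i. i \<in> I \<Longrightarrow> y i \<in> H M p) \<Longrightarrow> g p (\<Sum>i\<in>I. y i) x = (\<Sum>i\<in>I. g p (y i) x)"
  using g_sum_right[of x p I y] by (simp add: g_sym[of _ p x])

lemma sf_g: "hf W X \<Longrightarrow> hf W Y \<Longrightarrow> sf W (\<lambda>p. g p (X p) (Y p))"
  using neutral[unfolded neutral_metric_def, THEN conjunct2, THEN conjunct2] by blast

lemma H_span:
  obtains W X where "p \<in> W" "open W" "\<And>a. a < N \<Longrightarrow> hf W (X a)"
    "\<And>q. q \<in> W \<Longrightarrow> H M q = span ((\<lambda>a. X a q) ` {..<N})"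
proof -
  obtain W X where W: "p \<in> W" "\<And>a. a < N \<Longrightarrow> vf W (X a)"
    "\<And>q. q \<in> W \<Longrightarrow> H M q = span ((\<lambda>a. X a q) ` {..<N})"
    using pqc unfolding pqc_manifold_def distribution_def by metis
  have "open W" using W(2)[of 0] qdim_pos smooth_vfield_open by simp
  then show thesis using W by (intro that[of W X]) (auto intro!: hfI simp: span_base)
qed

text \<open>Near a point of the manifold, Gram-Schmidt in indefinite signature does not break down when
  it is started with fields that are already orthonormal at the point.\<close>

lemma orthonormal_frame_exists: "\<exists>e. orthonormal_frame M g p e"
proof -
  obtain W0 X where W0: "p \<in> W0" "open W0" "\<And>a. a < N \<Longrightarrow> hf W0 (X a)"
    "\<And>q. q \<in> W0 \<Longrightarrow> H M q = span ((\<lambda>a. X a q) ` {..<N})"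
    using H_span by metis
  from neutral[unfolded neutral_metric_def, THEN conjunct2, THEN conjunct1, THEN spec, of p]
  obtain e where e': "\<forall>a<N. e a \<in> H M p" "\<forall>a<N. \<forall>b<N.
      g p (e a) (e b) = (if a \<noteq> b then 0 else if a < 2 * qdim M then 1 else - 1)"
    by (elim exE conjE) (rule that)
  then have e: "e a \<in> H M p" if "a < N" for a using that by blast
  define \<sigma> where "\<sigma> a = (if a < 2 * qdim M then 1 else - 1 :: real)" for a
  have \<sigma>: "\<sigma> a * \<sigma> a = 1" for a by (simp add: \<sigma>_def)
  have ep: "g p (e a) (e b) = (if a = b then \<sigma> a else 0)" if "a < N" "b < N" for a b
    using e'(2) that by (simp add: \<sigma>_def)
  \<comment> \<open>All \<open>N\<close> fields keep their prescribed values at \<open>p\<close>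
    during the induction, while only the first \<open>m\<close> are orthonormal around it. The
    prescribed values are what makes the next orthogonalised field non-null near
    \<open>p\<close>.\<close>
  have "\<exists>W E. p \<in> W \<and> open W \<and> (\<forall>a<N. hf W (E a) \<and> E a p = e a) \<and>
    (\<forall>q\<in>W. \<forall>a<m. \<forall>b<m. g q (E a q) (E b q) = (if a = b then \<sigma> a else 0))" if "m \<le> N" for m
    using that
  proof (induction m)
    case 0
    have "\<exists>c. e a = (\<Sum>b<N. c b *\<^sub>R X b p)" if "a < N" for a
    proof -
      have "e a \<in> span ((\<lambda>b. X b p) ` {..<N})" using e[OF that] W0 by simp
      then obtain u where u: "e a = (\<Sum>v\<in>(\<lambda>b. X b p) ` {..<N}. u v *\<^sub>R v)"
        by (auto simp: span_finite)
      \<comment> \<open>Some of the spanning fields may coincide at \<open>p\<close>, so an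
        injective set of indices is selected and the other coefficients are set to 0.\<close>
      obtain B where B: "B \<subseteq> {..<N}" "inj_on (\<lambda>b. X b p) B" "(\<lambda>b. X b p) ` {..<N} = (\<lambda>b. X b p) ` B"
        using subset_image_inj[of "(\<lambda>b. X b p) ` {..<N}" "\<lambda>b. X b p" "{..<N}"] by auto
      have "e a = (\<Sum>b\<in>B. u (X b p) *\<^sub>R X b p)"
        using u B by (simp add: sum.reindex)
      also have "\<dots> = (\<Sum>b<N. (if b \<in> B then u (X b p) else 0) *\<^sub>R X b p)"
        using B(1) by (intro sum.mono_neutral_cong_left) auto
      finally show ?thesis by (intro exI[of _ "\<lambda>b. if b \<in> B then u (X b p) else 0"])
    qed
    then obtain c where c: "\<And>a. a < N \<Longrightarrow> e a = (\<Sum>b<N. c a b *\<^sub>R X b p)" by metis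
    show ?case
      by (rule exI[of _ W0], rule exI[of _ "\<lambda>a q. \<Sum>b<N. c a b *\<^sub>R X b q"])
        (use W0 c in \<open>auto intro!: hf_sum hf_cscale\<close>)
  next
    case (Suc m)
    then obtain W E where W: "p \<in> W" "open W" "\<And>a. a < N \<Longrightarrow> hf W (E a)"
      "\<And>a. a < N \<Longrightarrow> E a p = e a"
      "\<And>q a b. q \<in> W \<Longrightarrow> a < m \<Longrightarrow> b < m \<Longrightarrow> g q (E a q) (E b q) = (if a = b then \<sigma> a else 0)"
      by (metis Suc_leD)
    have m: "m < N" using Suc by simp
    define F where "F q = E m q - (\<Sum>b<m. (\<sigma> b * g q (E m q) (E b q)) *\<^sub>R E b q)" for q
    have hF: "hf W F" unfolding F_def
      using W m by (intro hf_diff hf_sum hf_scale smooth_fun_mult smooth_fun_const sf_g) auto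
    have Fp: "F p = e m" using W(4) m by (simp add: F_def ep)
    have FE: "g q (F q) (E a q) = 0" if "q \<in> W" "a < m" for q a
    proof -
      have EH: "E b q \<in> H M q" if "b < N" for b using W(3)[OF that] \<open>q \<in> W\<close> hf_H by blast
      have "g q (\<Sum>b<m. (\<sigma> b * g q (E m q) (E b q)) *\<^sub>R E b q) (E a q)
          = (\<Sum>b<m. (\<sigma> b * g q (E m q) (E b q)) * g q (E b q) (E a q))"
        using EH that m by (subst g_sum_left) auto
      also have "\<dots> = (\<Sum>b<m. if b = a then \<sigma> b * g q (E m q) (E b q) * \<sigma> b else 0)"
        by (rule sum.cong) (use that W(5) in auto)
      also have "\<dots> = g q (E m q) (E a q)"
        using that \<sigma>[of a] by (simp add: algebra_simps)
      finally show ?thesis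
        unfolding F_def using EH that m by (subst g_left) auto
    qed
    define f where "f q = \<sigma> m * g q (F q) (F q)" for q
    have sf: "sf W f" unfolding f_def by (intro smooth_fun_mult smooth_fun_const sf_g hF W)
    \<comment> \<open>At \<open>p\<close> the field \<open>F\<close> equals \<open>e m\<close>, so
      \<open>f\<close> is 1 there; on \<open>V\<close> the sign of \<open>g q (F q) (F q)\<close> is
      \<open>\<sigma> m\<close> and \<open>F\<close> can be normalised.\<close>
    define V where "V = {q \<in> W. f q > 0}"
    have V: "open V" unfolding V_def
      using continuous_open_preimage[OF smooth_fun_continuous[OF sf] W(2), of "{0<..}"]
      by (simp add: vimage_def Int_def)
    have VW: "V \<subseteq> W" by (auto simp: V_def)
    have pV: "p \<in> V" using W(1) Fp ep[OF m m] \<sigma>[of m] by (simp add: V_def f_def)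
    define E' where "E' = E(m := (\<lambda>q. (f q powr (- 1 / 2)) *\<^sub>R F q))"
    have fV: "sf V f" using sf VW V by (rule smooth_fun_subset)
    have hE': "hf V (E' a)" if "a < N" for a
      using that W(3) VW V hF
      by (auto simp: E'_def V_def intro!: hf_scale smooth_fun_powr[OF fV[unfolded V_def]] intro: hf_subset)
    have E'p: "E' a p = e a" if "a < N" for a
      using that W(4) Fp ep[OF m m] \<sigma>[of m] by (simp add: E'_def f_def)
    have "g q (E' a q) (E' b q) = (if a = b then \<sigma> a else 0)"
      if q: "q \<in> V" and ab: "a < Suc m" "b < Suc m" for q a b
    proof -
      have qW: "q \<in> W" using q VW by auto
      have Fq: "F q \<in> H M q" using hF qW hf_H by blast
      have EH: "E b q \<in> H M q" if "b < N" for b using W(3)[OF that] qW hf_H by blast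
      have f0: "f q > 0" using q by (simp add: V_def)
      have "f q powr (- 1 / 2) * f q powr (- 1 / 2) * f q = 1"
        using f0 by (simp add: powr_add[symmetric] powr_minus_divide)
      moreover have "g q (F q) (F q) = \<sigma> m * f q" using \<sigma>[of m] by (simp add: f_def mult.assoc[symmetric])
      ultimately have "f q powr (- 1 / 2) * (f q powr (- 1 / 2) * g q (F q) (F q)) = \<sigma> m"
        by (simp add: algebra_simps)
      then have mm: "g q (E' m q) (E' m q) = \<sigma> m"
        using Fq by (simp add: E'_def)
      have am: "g q (E' a q) (E' m q) = 0" "g q (E' m q) (E' a q) = 0" if "a < m" for a
        using that m Fq EH FE[OF qW that] g_sym[OF Fq, of "E a q"] by (simp_all add: E'_def)
      have "g q (E' a q) (E' b q) = (if a = b then \<sigma> a else 0)" if "a < m" "b < m"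
        using that W(5)[OF qW that] by (simp add: E'_def)
      then show ?thesis using ab mm am by (auto simp: less_Suc_eq)
    qed
    then show ?case using pV V hE' E'p by (intro exI[of _ V] exI[of _ E']) auto
  qed
  then obtain W E where W: "p \<in> W" "open W" "\<And>a. a < N \<Longrightarrow> hf W (E a)"
    "\<And>q a b. q \<in> W \<Longrightarrow> a < N \<Longrightarrow> b < N \<Longrightarrow> g q (E a q) (E b q) = (if a = b then \<sigma> a else 0)"
    by (metis order_refl)
  have "orthonormal_frame M g p E"
    unfolding orthonormal_frame_def
    by (rule exI[of _ W]) (use W in \<open>auto simp: \<sigma>_def\<close>)
  then show ?thesis by (intro exI[of _ E])
qed

end

lemma (in manifold) ext_d_form1:
  "ext_d A (form1 a) [X, Y] p = act (X p) (\<lambda>q. a q (Y q)) - act (Y p) (\<lambda>q. a q (X q))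
     - a p (bracket A X Y p)"
  by (simp add: ext_d_def form1_def[abs_def] nths_Cons numeral_2_eq_2)

context pqc_data
begin

lemma compat_forms:
  assumes "s \<in> {1,2,3}"
  shows "smooth_1form (atlas M) U (\<eta> s)" "smooth_h_endo M U (J s)"
  using bspec[OF compat[unfolded compatible_def, THEN conjunct2, THEN conjunct1] assms] by simp_all

lemma H_iff: "p \<in> U \<Longrightarrow> x \<in> H M p \<longleftrightarrow> x \<in> T p \<and> (\<forall>s\<in>{1,2,3}. \<eta> s p x = 0)"
proof -
  assume p: "p \<in> U"
  have "H M p = {v \<in> tangent_space (atlas M) p. \<forall>s\<in>{1,2,3}. eta L s p v = 0}"
    using compat[unfolded compatible_def, THEN conjunct2, THEN conjunct2, THEN conjunct2,
        THEN conjunct2, THEN conjunct1] p by (rule bspec)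
  then show ?thesis by simp
qed

lemma eta_lin: "p \<in> U \<Longrightarrow> s \<in> {1,2,3} \<Longrightarrow> lin_on (T p) (\<eta> s p)"
  using compat_forms(1) by (auto simp: smooth_1form_def)

lemma eta_simps [simp]:
  assumes "p \<in> U" "s \<in> {1,2,3}" "v \<in> T p"
  shows "w \<in> T p \<Longrightarrow> \<eta> s p (v + w) = \<eta> s p v + \<eta> s p w"
    "w \<in> T p \<Longrightarrow> \<eta> s p (v - w) = \<eta> s p v - \<eta> s p w"
    "\<eta> s p (c *\<^sub>R v) = c * \<eta> s p v" "\<eta> s p 0 = 0" "\<eta> s p (- v) = - \<eta> s p v"
  using lin_on_add[OF eta_lin] lin_on_diff[OF eta_lin] lin_on_scaleR[OF eta_lin] lin_on_zero[OF eta_lin]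
    lin_on_scaleR[OF eta_lin, of p s v "-1"] assms
  by auto

lemma eta_H [simp]: "p \<in> U \<Longrightarrow> s \<in> {1,2,3} \<Longrightarrow> x \<in> H M p \<Longrightarrow> \<eta> s p x = 0"
  using H_iff by blast

lemma sf_eta: "W \<subseteq> U \<Longrightarrow> s \<in> {1,2,3} \<Longrightarrow> vf W X \<Longrightarrow> sf W (\<lambda>p. \<eta> s p (X p))"
  using compat_forms(1) by (auto simp: smooth_1form_def)

lemma vf_xi: "W \<subseteq> U \<Longrightarrow> open W \<Longrightarrow> s \<in> {1,2,3} \<Longrightarrow> vf W (\<xi> s)"
  using reeb[unfolded reeb_def, THEN conjunct1] smooth_vfield_subset by blast

lemma xi_T: "p \<in> U \<Longrightarrow> s \<in> {1,2,3} \<Longrightarrow> \<xi> s p \<in> T p"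
  using vf_xi[OF order_refl open_U] smooth_vfield_tangent by blast

lemma eta_xi: "p \<in> U \<Longrightarrow> s \<in> {1,2,3} \<Longrightarrow> t \<in> {1,2,3} \<Longrightarrow> \<eta> s p (\<xi> t p) = (if s = t then 1 else 0)"
  by (rule reeb[unfolded reeb_def, THEN conjunct2, THEN conjunct1, THEN bspec, THEN bspec, THEN bspec])

lemma reeb_horizontal:
  assumes "W \<subseteq> U" "hf W X" "p \<in> W"
  shows "s \<in> {1,2,3} \<Longrightarrow> ext_d (atlas M) (form1 (\<eta> s)) [\<xi> s, X] p = 0"
    and "(i, j, k) \<in> cyc \<Longrightarrow> ext_d (atlas M) (form1 (\<eta> i)) [\<xi> j, X] p
      = eps k * ext_d (atlas M) (form1 (\<eta> j)) [\<xi> i, X] p"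
proof -
  note r = reeb[unfolded reeb_def, THEN conjunct2, THEN conjunct2, THEN spec, THEN spec, THEN mp,
      THEN bspec, OF conjI, OF assms]
  show "s \<in> {1,2,3} \<Longrightarrow> ext_d (atlas M) (form1 (\<eta> s)) [\<xi> s, X] p = 0"
    using r[THEN conjunct1] by (rule bspec)
  show "(i, j, k) \<in> cyc \<Longrightarrow> ext_d (atlas M) (form1 (\<eta> i)) [\<xi> j, X] p
      = eps k * ext_d (atlas M) (form1 (\<eta> j)) [\<xi> i, X] p"
    using bspec[OF r[THEN conjunct2], of "(i, j, k)"] by simp
qed

lemma J_H [simp, intro]: "p \<in> U \<Longrightarrow> s \<in> {1,2,3} \<Longrightarrow> x \<in> H M p \<Longrightarrow> J s p x \<in> H M p"
  using compat_forms(2) by (auto simp: smooth_h_endo_def h_endo_def)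

lemma J_lin: "p \<in> U \<Longrightarrow> s \<in> {1,2,3} \<Longrightarrow> lin_on (H M p) (J s p)"
  using compat_forms(2) by (auto simp: smooth_h_endo_def h_endo_def)

lemma J_simps [simp]:
  assumes "p \<in> U" "s \<in> {1,2,3}" "x \<in> H M p"
  shows "y \<in> H M p \<Longrightarrow> J s p (x + y) = J s p x + J s p y"
    "y \<in> H M p \<Longrightarrow> J s p (x - y) = J s p x - J s p y"
    "J s p (c *\<^sub>R x) = c *\<^sub>R J s p x" "J s p 0 = 0" "J s p (- x) = - J s p x"
  using lin_on_add[OF J_lin] lin_on_diff[OF J_lin] lin_on_scaleR[OF J_lin] lin_on_zero[OF J_lin]
    lin_on_scaleR[OF J_lin, of p s x "-1"] assms
  by auto

lemma compat_algebra:
  assumes "p \<in> U" "x \<in> H M p" "y \<in> H M p"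
  shows "(\<forall>s\<in>{1,2,3}. J s p (J s p x) = eps s *\<^sub>R x \<and>
           g p (J s p x) (J s p y) = - eps s * g p x y) \<and>
        (\<forall>(i, j, k)\<in>cyc. J i p (J j p x) = - J j p (J i p x) \<and>
           J i p (J j p x) = - (eps k *\<^sub>R J k p x))"
  using compat[unfolded compatible_def, THEN conjunct2, THEN conjunct2, THEN conjunct2, THEN conjunct1,
      THEN bspec, OF assms(1), THEN bspec, OF assms(2), THEN bspec, OF assms(3)] .

lemma J_sq [simp]: "p \<in> U \<Longrightarrow> s \<in> {1,2,3} \<Longrightarrow> x \<in> H M p \<Longrightarrow> J s p (J s p x) = eps s *\<^sub>R x"
  using compat_algebra[of p x x, THEN conjunct1] by blast

lemma g_JJ [simp]: "p \<in> U \<Longrightarrow> s \<in> {1,2,3} \<Longrightarrow> x \<in> H M p \<Longrightarrow> y \<in> H M p \<Longrightarrow>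
    g p (J s p x) (J s p y) = - eps s * g p x y"
  using compat_algebra[of p x y, THEN conjunct1] by blast

lemma J_cyc:
  assumes "p \<in> U" "x \<in> H M p" "(i, j, k) \<in> cyc"
  shows "J i p (J j p x) = - (eps k *\<^sub>R J k p x)" "J j p (J i p x) = eps k *\<^sub>R J k p x"
proof -
  have **: "J i p (J j p x) = - J j p (J i p x) \<and> J i p (J j p x) = - (eps k *\<^sub>R J k p x)"
    using compat_algebra[OF assms(1,2,2), THEN conjunct2, THEN bspec, OF assms(3)]
    unfolding prod.case .
  then show *: "J i p (J j p x) = - (eps k *\<^sub>R J k p x)" by blast
  then show "J j p (J i p x) = eps k *\<^sub>R J k p x"
    using ** unfolding * by (metis neg_equal_iff_equal)
qed

lemma J_table:
  assumes "p \<in> U" "x \<in> H M p"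
  shows "J 1 p (J 2 p x) = J 3 p x" "J 2 p (J 1 p x) = - J 3 p x"
    "J 2 p (J 3 p x) = - J 1 p x" "J 3 p (J 2 p x) = J 1 p x"
    "J 3 p (J 1 p x) = - J 2 p x" "J 1 p (J 3 p x) = J 2 p x"
  using J_cyc[OF assms, of 1 2 3] J_cyc[OF assms, of 2 3 1] J_cyc[OF assms, of 3 1 2]
  by (simp_all add: cyc_def)

lemma g_J:
  assumes "p \<in> U" "s \<in> {1,2,3}" "x \<in> H M p" "y \<in> H M p"
  shows "g p (J s p x) y = - g p x (J s p y)"
proof -
  have "eps s * g p (J s p x) y = g p (J s p x) (J s p (J s p y))"
    using assms by simp
  also have "\<dots> = - eps s * g p x (J s p y)"
    using assms by (subst g_JJ) auto
  finally have "eps s * g p (J s p x) y = eps s * (- g p x (J s p y))" by simp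
  then show ?thesis unfolding mult_cancel_left by simp
qed

lemma g_J_self [simp]:
  assumes "p \<in> U" "s \<in> {1,2,3}" "x \<in> H M p"
  shows "g p (J s p x) x = 0" "g p x (J s p x) = 0"
  using g_J[OF assms(1,2,3,3)] g_sym[of x p "J s p x"] assms by auto

lemma g_J_cross:
  assumes "p \<in> U" "s \<in> {1,2,3}" "t \<in> {1,2,3}" "s \<noteq> t" "x \<in> H M p"
  shows "g p (J s p x) (J t p x) = 0"
  using assms by (auto simp: g_J J_table simp del: One_nat_def)

text \<open>At a non-null \<open>x\<close> the vectors \<open>J s p x\<close> are non-null and
  mutually orthogonal, so pairing with \<open>J t p x\<close> isolates one coefficient.\<close>

lemma J_independent:
  assumes "p \<in> U" "x \<in> H M p" "g p x x \<noteq> 0" "(\<Sum>s\<in>{1,2,3}. a s *\<^sub>R J s p x) = (\<Sum>s\<in>{1,2,3}. b s *\<^sub>R J s p x)"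
    "t \<in> {1,2,3}"
  shows "a t = (b t :: real)"
proof -
  have "g p (J t p x) (\<Sum>s\<in>{1,2,3}. c s *\<^sub>R J s p x) = - eps t * g p x x * c t" for c
    using assms g_J_cross[OF assms(1) assms(5) _ _ assms(2)] by (auto simp: simp del: One_nat_def)
  from this[of a] this[of b] show ?thesis using assms by auto
qed

section \<open>Splitting of the tangent bundle into H and V\<close>

abbreviation "h \<equiv> hproj L"

lemma hproj_H [simp, intro]:
  assumes "p \<in> U" "v \<in> T p"
  shows "h p v \<in> H M p"
proof -
  have "\<eta> t p (\<Sum>s\<in>{1,2,3}. \<eta> s p v *\<^sub>R \<xi> s p) = \<eta> t p v" if "t \<in> {1,2,3}" for t
    using lin_on_sum[OF eta_lin[OF assms(1) that] tangent_subspace, of "{1,2,3}" "\<lambda>s. \<xi> s p" "\<lambda>s. \<eta> s p v"]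
      that xi_T[OF assms(1)] eta_xi[OF assms(1) that] by auto
  moreover have "(\<Sum>s\<in>{1,2,3}. \<eta> s p v *\<^sub>R \<xi> s p) \<in> T p"
    using xi_T[OF assms(1)] by (intro T_sum T_closed(4))
  ultimately show ?thesis
    unfolding H_iff[OF assms(1)] hproj_def using assms by simp
qed

lemma hproj_id [simp]: "p \<in> U \<Longrightarrow> x \<in> H M p \<Longrightarrow> h p x = x"
  by (simp add: hproj_def)

lemma hproj_xi [simp]: "p \<in> U \<Longrightarrow> s \<in> {1,2,3} \<Longrightarrow> h p (\<xi> s p) = 0"
  by (auto simp: hproj_def eta_xi simp del: One_nat_def)

lemma hproj_lin: "p \<in> U \<Longrightarrow> lin_on (T p) (h p)"
  by (simp add: lin_on_def hproj_def algebra_simps sum.distrib scaleR_right.sum del: One_nat_def)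

lemma hproj_simps [simp]:
  assumes "p \<in> U" "v \<in> T p"
  shows "w \<in> T p \<Longrightarrow> h p (v + w) = h p v + h p w" "w \<in> T p \<Longrightarrow> h p (v - w) = h p v - h p w"
    "h p (c *\<^sub>R v) = c *\<^sub>R h p v" "h p 0 = 0" "h p (- v) = - h p v"
  using lin_on_add[OF hproj_lin] lin_on_diff[OF hproj_lin] lin_on_scaleR[OF hproj_lin] lin_on_zero[OF hproj_lin]
    lin_on_scaleR[OF hproj_lin, of p v "-1"] assms
  by auto

lemma split_HV: "v = h p v + (\<Sum>s\<in>{1,2,3}. \<eta> s p v *\<^sub>R \<xi> s p)"
  by (simp add: hproj_def)

lemma gext_H: "p \<in> U \<Longrightarrow> x \<in> H M p \<Longrightarrow> y \<in> H M p \<Longrightarrow> gext g L p x y = g p x y"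
  by (simp add: gext_def)

lemma hf_J: "W \<subseteq> U \<Longrightarrow> s \<in> {1,2,3} \<Longrightarrow> hf W X \<Longrightarrow> hf W (\<lambda>q. J s q (X q))"
  by (rule hfI, rule compat_forms(2)[unfolded smooth_h_endo_def, THEN conjunct2, THEN conjunct2,
        THEN spec, THEN spec, THEN mp]) (blast intro: J_H hf_H)+

lemma hf_hproj: "W \<subseteq> U \<Longrightarrow> vf W X \<Longrightarrow> hf W (\<lambda>q. h q (X q))"
proof (rule hfI)
  assume W: "W \<subseteq> U" "vf W X"
  show "vf W (\<lambda>q. h q (X q))" unfolding hproj_def
    using W by (intro smooth_vfield_diff smooth_vfield_sum smooth_vfield_scale sf_eta vf_xi)
      (auto intro: smooth_vfield_open)
  show "h p (X p) \<in> H M p" if "p \<in> W" for p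
    using that W by (intro hproj_H smooth_vfield_tangent[OF W(2)]) auto
qed

section \<open>The canonical connection\<close>

lemma conn: "linear_connection (atlas M) D"
  using canonical by (simp add: canonical_connection_def)

lemma conn_at:
  assumes "vf W B" "p \<in> W"
  shows "lin_on (T p) (\<lambda>v. D p v B) \<and> (\<forall>v\<in>T p. D p v B \<in> T p \<and>
    (\<forall>f. sf W f \<longrightarrow> D p v (\<lambda>q. f q *\<^sub>R B q) = act v f *\<^sub>R B p + f p *\<^sub>R D p v B) \<and>
    (\<forall>B'. vf W B' \<longrightarrow> D p v (\<lambda>q. B q + B' q) = D p v B + D p v B') \<and>
    (\<forall>B'. (\<forall>q\<in>W. B' q = B q) \<longrightarrow> D p v B' = D p v B))"
  using conn[unfolded linear_connection_def, THEN spec, THEN spec, THEN mp, OF assms(1),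
      THEN conjunct1, THEN bspec, OF assms(2)] .

lemma D_lin: "vf W B \<Longrightarrow> p \<in> W \<Longrightarrow> lin_on (T p) (\<lambda>v. D p v B)"
  by (rule conn_at[THEN conjunct1])

lemma D_T: "vf W B \<Longrightarrow> p \<in> W \<Longrightarrow> v \<in> T p \<Longrightarrow> D p v B \<in> T p"
  by (rule conn_at[THEN conjunct2, THEN bspec, THEN conjunct1])

lemma D_scale: "vf W B \<Longrightarrow> p \<in> W \<Longrightarrow> v \<in> T p \<Longrightarrow> sf W f \<Longrightarrow>
    D p v (\<lambda>q. f q *\<^sub>R B q) = act v f *\<^sub>R B p + f p *\<^sub>R D p v B"
  by (rule conn_at[THEN conjunct2, THEN bspec, THEN conjunct2, THEN conjunct1, THEN spec, THEN mp])

lemma D_add: "vf W B \<Longrightarrow> vf W B' \<Longrightarrow> p \<in> W \<Longrightarrow> v \<in> T p \<Longrightarrow>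
    D p v (\<lambda>q. B q + B' q) = D p v B + D p v B'"
  by (rule conn_at[THEN conjunct2, THEN bspec, THEN conjunct2, THEN conjunct2, THEN conjunct1,
        THEN spec, THEN mp])

lemma D_cong: "vf W B \<Longrightarrow> p \<in> W \<Longrightarrow> v \<in> T p \<Longrightarrow> (\<And>q. q \<in> W \<Longrightarrow> B' q = B q) \<Longrightarrow> D p v B' = D p v B"
  by (rule conn_at[THEN conjunct2, THEN bspec, THEN conjunct2, THEN conjunct2, THEN conjunct2,
        THEN spec, THEN mp]) auto

lemma vf_D: "vf W X \<Longrightarrow> vf W B \<Longrightarrow> vf W (\<lambda>p. D p (X p) B)"
  by (rule conn[unfolded linear_connection_def, THEN spec, THEN spec, THEN mp, THEN conjunct2,
        THEN spec, THEN mp])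

lemma D_cscale: "vf W B \<Longrightarrow> p \<in> W \<Longrightarrow> v \<in> T p \<Longrightarrow> D p v (\<lambda>q. c *\<^sub>R B q) = c *\<^sub>R D p v B"
  using D_scale[of W B p v "\<lambda>_. c"] smooth_fun_const smooth_vfield_open tangent_const by simp

lemma D_diff: "vf W B \<Longrightarrow> vf W B' \<Longrightarrow> p \<in> W \<Longrightarrow> v \<in> T p \<Longrightarrow>
    D p v (\<lambda>q. B q - B' q) = D p v B - D p v B'"
  using D_add[of W B "\<lambda>q. (-1) *\<^sub>R B' q" p v] D_cscale[of W B' p v "-1"] smooth_vfield_cscale[of W B' "-1"]
  by simp

lemma D_split: "preserves_splitting M D U L" and D_metric: "preserves_metric M g D U L"
  and D_torsion: "torsion_conditions M g D U L" and D_phi: "phi_parallel M D U L"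
  using canonical[unfolded canonical_connection_def, THEN conjunct2, THEN conjunct2, THEN spec,
      THEN spec, THEN mp, OF conjI, OF compat reeb] by simp_all

lemma D_H: "W \<subseteq> U \<Longrightarrow> hf W X \<Longrightarrow> p \<in> W \<Longrightarrow> v \<in> T p \<Longrightarrow> D p v X \<in> H M p"
  by (rule D_split[unfolded preserves_splitting_def, THEN spec, THEN mp, THEN bspec, THEN bspec,
      THEN conjunct1, THEN spec, THEN mp])

lemma hf_D: "W \<subseteq> U \<Longrightarrow> vf W A \<Longrightarrow> hf W X \<Longrightarrow> hf W (\<lambda>q. D q (A q) X)"
  by (rule hfI, erule vf_D, erule hf_vf) (rule D_H, assumption+, erule smooth_vfield_tangent)

lemma D_g:
  assumes "W \<subseteq> U" "hf W X" "hf W Y" "p \<in> W" "v \<in> T p"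
  shows "act v (\<lambda>q. g q (X q) (Y q)) = g p (D p v X) (Y p) + g p (X p) (D p v Y)"
proof -
  have p: "p \<in> U" and XY: "X q \<in> H M q" "Y q \<in> H M q" if "q \<in> W" for q
    using assms that hf_H by auto
  have "act v (\<lambda>q. g q (X q) (Y q)) = act v (\<lambda>q. gext g L q (X q) (Y q))"
    by (rule tangent_cong[OF assms(5) _ hf_open[OF assms(2)] assms(4), symmetric])
      (use assms XY gext_H in \<open>auto intro: smooth_atI sf_g\<close>)
  also have "\<dots> = gext g L p (D p v X) (Y p) + gext g L p (X p) (D p v Y)"
    using assms hf_vf by (intro D_metric[unfolded preserves_metric_def, THEN spec, THEN spec,
        THEN spec, THEN mp, THEN bspec, THEN bspec, of W]) auto
  also have "\<dots> = g p (D p v X) (Y p) + g p (X p) (D p v Y)"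
    using XY assms p D_H by (simp add: gext_H)
  finally show ?thesis .
qed

lemma D_J:
  assumes "W \<subseteq> U" "hf W X" "p \<in> W" "v \<in> T p" "(i, j, k) \<in> cyc"
  shows "D p v (\<lambda>q. J i q (X q)) = J i p (D p v X)
     + \<alpha> j p v *\<^sub>R J k p (X p) + (eps k * \<alpha> k p v) *\<^sub>R J j p (X p)"
proof -
  have "D_endo D p v (J i) X = \<alpha> j p v *\<^sub>R J k p (X p) + (eps k * \<alpha> k p v) *\<^sub>R J j p (X p)"
    using conn_forms[unfolded connection_forms_def, THEN spec, THEN spec, THEN mp, THEN bspec,
        THEN bspec, THEN bspec, OF conjI, OF assms] by simp
  then show ?thesis by (simp add: D_endo_def algebra_simps)
qed

lemma vert_sum:
  assumes "p \<in> U" "w \<in> vert L p" shows "w = (\<Sum>s\<in>{1,2,3}. \<eta> s p w *\<^sub>R \<xi> s p)"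
proof -
  obtain a b c where w: "w = a *\<^sub>R \<xi> 1 p + b *\<^sub>R \<xi> 2 p + c *\<^sub>R \<xi> 3 p"
    using assms(2) by (auto simp: vert_def span_insert algebra_simps)
  show ?thesis unfolding w using assms(1) xi_T by (simp add: eta_xi del: One_nat_def)
qed

lemma xi_vert: "s \<in> {1,2,3} \<Longrightarrow> \<xi> s p \<in> vert L p"
  unfolding vert_def by (auto intro: span_base)

lemma frame_at:
  assumes "p \<in> U"
  obtains W e where "W \<subseteq> U" "p \<in> W" "hf W e" "g p (e p) (e p) \<noteq> 0"
proof -
  obtain e where "orthonormal_frame M g p e" using orthonormal_frame_exists[of p] by (elim exE)
  then obtain W where W: "p \<in> W" "\<forall>a<N. hf W (e a)"
    "\<forall>q\<in>W. \<forall>a<N. g q (e a q) (e a q) \<in> {1, - 1} \<and> (\<forall>b<N. a \<noteq> b \<longrightarrow> g q (e a q) (e b q) = 0)"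
    unfolding orthonormal_frame_def by (elim exE conjE) (rule that)
  have N: "0 < N" using qdim_pos by simp
  have "open W" using W(2) N hf_open by blast
  then have "hf (W \<inter> U) (e 0)"
    by (intro hf_subset[OF W(2)[rule_format, OF N]] open_Int open_U Int_lower1)
  moreover have "g p (e 0 p) (e 0 p) \<in> {1, - 1}" using W(1,3) N by blast
  then have "g p (e 0 p) (e 0 p) \<noteq> 0" by auto
  ultimately show thesis
    by (intro that[of "W \<inter> U" "e 0"]) (simp_all add: assms W(1))
qed

text \<open>The derivative of \<xi>_i lies in V, and the parallel map V \<rightarrow> PQ sends it to
  the derivative of I_i, whose coefficients are the connection forms by definition. Evaluation on a
  horizontal field that is non-null at \<open>p\<close> recovers these coefficients.\<close>

lemma D_xi:
  assumes p: "p \<in> U" and v: "v \<in> T p" and c: "(i, j, k) \<in> cyc"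
  shows "D p v (\<xi> i) = \<alpha> j p v *\<^sub>R \<xi> k p + (eps k * \<alpha> k p v) *\<^sub>R \<xi> j p"
proof -
  obtain W e where W: "W \<subseteq> U" "p \<in> W" "hf W e" "g p (e p) (e p) \<noteq> 0"
    using frame_at[OF p] by metis
  have oW: "open W" using W hf_open by blast
  note i = cyc_in[OF c]
  have V: "vfield_in_V M L W (\<xi> i)"
    using vf_xi[OF W(1) oW] i xi_vert by (auto simp: vfield_in_V_def)
  define w where "w = D p v (\<xi> i)"
  have w: "w \<in> vert L p"
    unfolding w_def using V W v by (intro D_split[unfolded preserves_splitting_def, THEN spec, THEN mp,
        THEN bspec, THEN bspec, THEN conjunct2, THEN spec, THEN mp])
  have phi: "phi L q (\<xi> i q) x = J i q x" if "q \<in> U" for q x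
    using that i eta_xi by (auto simp: phi_def simp del: One_nat_def)
  have ep: "e p \<in> H M p" using W hf_H by blast
  have "(\<Sum>s\<in>{1,2,3}. \<eta> s p w *\<^sub>R J s p (e p)) = D_endo D p v (\<lambda>q. phi L q (\<xi> i q)) e"
    unfolding w_def using V W v by (intro D_phi[unfolded phi_parallel_def, THEN spec, THEN spec, THEN spec,
        THEN mp, THEN bspec, THEN bspec, of W "\<xi> i" e p v, symmetric, unfolded phi_def[of L p]]) auto
  also have "\<dots> = D p v (\<lambda>q. J i q (e q)) - J i p (D p v e)"
    unfolding D_endo_def
    using W v p by (subst D_cong[of W "\<lambda>q. J i q (e q)" p]) (auto intro!: hf_vf hf_J i simp: phi)
  also have "\<dots> = \<alpha> j p v *\<^sub>R J k p (e p) + (eps k * \<alpha> k p v) *\<^sub>R J j p (e p)"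
    using D_J[OF W(1,3,2) v c] by simp
  also have "\<dots> = (\<Sum>s\<in>{1,2,3}. ((\<lambda>_. 0)(k := \<alpha> j p v, j := eps k * \<alpha> k p v)) s *\<^sub>R J s p (e p))"
    unfolding cyc_sum[OF c] using cyc_distinct[OF c] by simp
  finally have "\<eta> t p w = ((\<lambda>_. 0)(k := \<alpha> j p v, j := eps k * \<alpha> k p v)) t" if "t \<in> {1,2,3}" for t
    using that by (rule J_independent[OF p ep W(4)])
  then show ?thesis
    using vert_sum[OF p w] i cyc_distinct[OF c]
    unfolding cyc_sum[OF c] by (simp add: w_def[symmetric] add.commute)
qed

end

context pqc_data
begin

section \<open>Torsion and curvature as tensors\<close>

abbreviation "tor \<equiv> torsion (atlas M) D"
abbreviation "cu \<equiv> curvature (atlas M) D"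

lemma vf_T: "vf W X \<Longrightarrow> p \<in> W \<Longrightarrow> X p \<in> T p"
  by (rule smooth_vfield_tangent)

lemma D_plus: "vf W B \<Longrightarrow> p \<in> W \<Longrightarrow> v \<in> T p \<Longrightarrow> w \<in> T p \<Longrightarrow> D p (v + w) B = D p v B + D p w B"
  by (rule lin_on_add[OF D_lin])

lemma D_minus: "vf W B \<Longrightarrow> p \<in> W \<Longrightarrow> v \<in> T p \<Longrightarrow> w \<in> T p \<Longrightarrow> D p (v - w) B = D p v B - D p w B"
  by (rule lin_on_diff[OF D_lin])

lemma D_times: "vf W B \<Longrightarrow> p \<in> W \<Longrightarrow> v \<in> T p \<Longrightarrow> D p (c *\<^sub>R v) B = c *\<^sub>R D p v B"
  by (rule lin_on_scaleR[OF D_lin])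

lemma vf_tor:
  assumes "vf W X" "vf W Y" shows "vf W (tor X Y)"
  unfolding torsion_def[abs_def]
  by (intro smooth_vfield_diff vf_D smooth_vfield_bracket assms)

lemma tor_skew: "tor Y X p = - tor X Y p"
  by (simp add: torsion_def bracket_skew[of Y X])

lemma tor_add:
  assumes "vf W X" "vf W Y" "vf W Z" "p \<in> W"
  shows "tor X (\<lambda>q. Y q + Z q) p = tor X Y p + tor X Z p"
  using assms by (simp add: torsion_def D_add[of W] D_plus[of W] vf_T[of W] bracket_add_right[of W])

lemma tor_scale:
  assumes "vf W X" "vf W Y" "sf W f" "p \<in> W"
  shows "tor X (\<lambda>q. f q *\<^sub>R Y q) p = f p *\<^sub>R tor X Y p"
  using assms by (simp add: torsion_def D_scale[of W] D_times[of W] vf_T[of W] bracket_scale_right[of W] algebra_simps)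

lemma tor_cong:
  assumes "vf W X" "vf W Y" "p \<in> W" "\<And>q. q \<in> W \<Longrightarrow> Y' q = Y q"
  shows "tor X Y' p = tor X Y p"
  using bracket_cong[OF assms(1,2,3) refl assms(4)] D_cong[OF assms(2,3) vf_T[OF assms(1,3)] assms(4)]
    assms(4)[OF assms(3)]
  by (simp add: torsion_def)

lemma tor_minus:
  assumes "vf W X" "vf W Y" "vf W Z" "p \<in> W"
  shows "tor X (\<lambda>q. Y q - Z q) p = tor X Y p - tor X Z p"
  using tor_add[OF assms(1,2) smooth_vfield_cscale[OF assms(3), of "-1"] assms(4)]
    tor_scale[OF assms(1,3) smooth_fun_const[OF smooth_vfield_open[OF assms(1)], of "-1"] assms(4)]
  by simp

lemma vf_cu:
  assumes "vf W A" "vf W B" "vf W C" shows "vf W (cu A B C)"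
  unfolding curvature_def[abs_def]
  by (intro smooth_vfield_diff vf_D smooth_vfield_bracket assms)

lemma cu_H:
  assumes "W \<subseteq> U" "vf W A" "vf W B" "hf W X" "p \<in> W"
  shows "cu A B X p \<in> H M p"
  unfolding curvature_def
  by (intro H_closed(3) D_H[OF assms(1)] hf_D[OF assms(1)] vf_T bracket_tangent[OF assms(2,3,5)] assms
      vf_T[OF assms(2,5)] vf_T[OF assms(3,5)])

lemma cu_skew:
  assumes "vf W A" "vf W B" "vf W C" "p \<in> W"
  shows "cu B A C p = - cu A B C p"
proof -
  have "D p (- br A B p) C = - D p (br A B p) C"
    using D_times[OF assms(3,4) bracket_tangent[OF assms(1,2,4)], of "-1"] by simp
  then show ?thesis by (simp add: curvature_def bracket_skew[of B A])
qed

lemma cu_add: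
  assumes "vf W A" "vf W B" "vf W C" "vf W C'" "p \<in> W"
  shows "cu A B (\<lambda>q. C q + C' q) p = cu A B C p + cu A B C' p"
proof -
  have "D p (A p) (\<lambda>q. D q (B q) (\<lambda>q. C q + C' q)) = D p (A p) (\<lambda>q. D q (B q) C) + D p (A p) (\<lambda>q. D q (B q) C')"
    if "vf W A" "vf W B" for A B
  proof -
    have "D p (A p) (\<lambda>q. D q (B q) (\<lambda>q. C q + C' q)) = D p (A p) (\<lambda>q. D q (B q) C + D q (B q) C')"
      by (rule D_cong[OF _ assms(5) vf_T[OF that(1) assms(5)]])
        (intro smooth_vfield_add vf_D that assms, rule D_add[OF assms(3,4) _ vf_T[OF that(2)]])
    also have "\<dots> = D p (A p) (\<lambda>q. D q (B q) C) + D p (A p) (\<lambda>q. D q (B q) C')"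
      by (intro D_add[of W] vf_D that assms vf_T[OF that(1)])
    finally show ?thesis .
  qed
  then show ?thesis
    using assms D_add[OF assms(3,4,5) bracket_tangent[OF assms(1,2,5)]]
    by (simp add: curvature_def)
qed

text \<open>The first-order cross terms of the iterated derivatives are symmetric in
  \<open>A\<close> and \<open>B\<close> and cancel; the difference of the second derivatives of
  \<open>f\<close> is its derivative along the bracket, which the last term of the curvature
  removes.\<close>

lemma cu_scale:
  assumes "vf W A" "vf W B" "vf W C" "sf W f" "p \<in> W"
  shows "cu A B (\<lambda>q. f q *\<^sub>R C q) p = f p *\<^sub>R cu A B C p"
proof -
  have *: "D p (A p) (\<lambda>q. D q (B q) (\<lambda>q. f q *\<^sub>R C q)) = act (A p) (\<lambda>q. act (B q) f) *\<^sub>R C p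
      + act (B p) f *\<^sub>R D p (A p) C + act (A p) f *\<^sub>R D p (B p) C + f p *\<^sub>R D p (A p) (\<lambda>q. D q (B q) C)"
    if "vf W A" "vf W B" for A B
  proof -
    have s: "sf W (\<lambda>q. act (B q) f)" by (rule smooth_vfield_act[OF that(2) assms(4)]) simp
    have Ap: "A p \<in> T p" by (rule vf_T[OF that(1) assms(5)])
    have "D p (A p) (\<lambda>q. D q (B q) (\<lambda>q. f q *\<^sub>R C q))
        = D p (A p) (\<lambda>q. act (B q) f *\<^sub>R C q + f q *\<^sub>R D q (B q) C)"
      by (rule D_cong[OF _ assms(5) Ap])
        (intro smooth_vfield_add smooth_vfield_scale s vf_D that assms,
         rule D_scale[OF assms(3) _ vf_T[OF that(2)] assms(4)])
    also have "\<dots> = D p (A p) (\<lambda>q. act (B q) f *\<^sub>R C q) + D p (A p) (\<lambda>q. f q *\<^sub>R D q (B q) C)"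
      by (intro D_add[of W] smooth_vfield_scale s vf_D that assms Ap)
    also have "D p (A p) (\<lambda>q. act (B q) f *\<^sub>R C q) = act (A p) (\<lambda>q. act (B q) f) *\<^sub>R C p
        + act (B p) f *\<^sub>R D p (A p) C"
      by (intro D_scale[of W] s assms Ap)
    also have "D p (A p) (\<lambda>q. f q *\<^sub>R D q (B q) C) = act (A p) f *\<^sub>R D p (B p) C
        + f p *\<^sub>R D p (A p) (\<lambda>q. D q (B q) C)"
      by (intro D_scale[of W] vf_D that assms Ap)
    finally show ?thesis by (simp add: algebra_simps)
  qed
  have "act (A p) (\<lambda>q. act (B q) f) = act (B p) (\<lambda>q. act (A q) f) + act (br A B p) f"
    using act_bracket[OF smooth_atI[OF assms(4,5)], of A B] by simp
  then show ?thesis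
    using *[OF assms(1,2)] *[OF assms(2,1)]
      D_scale[OF assms(3,5) bracket_tangent[OF assms(1,2,5)] assms(4)]
    by (simp add: curvature_def algebra_simps)
qed

lemma cu_cong:
  assumes "vf W A" "vf W B" "vf W C" "p \<in> W" "\<And>q. q \<in> W \<Longrightarrow> C' q = C q"
  shows "cu A B C' p = cu A B C p"
proof -
  have *: "D p (A p) (\<lambda>q. D q (B q) C') = D p (A p) (\<lambda>q. D q (B q) C)" if "vf W A" "vf W B" for A B
    by (rule D_cong[OF vf_D[OF that(2) assms(3)] assms(4) vf_T[OF that(1) assms(4)]])
      (rule D_cong[OF assms(3) _ vf_T[OF that(2)] assms(5)])
  show ?thesis
    using *[OF assms(1,2)] *[OF assms(2,1)] D_cong[OF assms(3,4) bracket_tangent[OF assms(1,2,4)] assms(5)]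
    by (simp add: curvature_def)
qed

lemma cu_add_left:
  assumes "vf W A" "vf W A'" "vf W B" "vf W C" "p \<in> W"
  shows "cu (\<lambda>q. A q + A' q) B C p = cu A B C p + cu A' B C p"
proof -
  note AB = vf_T[OF assms(1)] vf_T[OF assms(2)] vf_T[OF assms(3)]
  have "D p (B p) (\<lambda>q. D q (A q + A' q) C) = D p (B p) (\<lambda>q. D q (A q) C + D q (A' q) C)"
    by (rule D_cong[OF _ assms(5) AB(3)[OF assms(5)]])
      (intro smooth_vfield_add vf_D assms, rule D_plus[OF assms(4) _ AB(1,2)])
  also have "\<dots> = D p (B p) (\<lambda>q. D q (A q) C) + D p (B p) (\<lambda>q. D q (A' q) C)"
    by (intro D_add[of W] vf_D assms AB)
  finally have 1: "D p (B p) (\<lambda>q. D q (A q + A' q) C)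
    = D p (B p) (\<lambda>q. D q (A q) C) + D p (B p) (\<lambda>q. D q (A' q) C)" .
  have 2: "br (\<lambda>q. A q + A' q) B p = br A B p + br A' B p"
    using bracket_add_right[OF assms(3,1,2,5)] bracket_skew[of B]
    by (metis bracket_skew minus_add_distrib add.commute)
  show ?thesis
    using 1 2 D_plus[OF assms(4,5) AB(1)[OF assms(5)] AB(2)[OF assms(5)]]
      D_plus[OF vf_D[OF assms(3,4)] assms(5) AB(1)[OF assms(5)] AB(2)[OF assms(5)]]
      D_plus[OF assms(4,5) bracket_tangent[OF assms(1,3,5)] bracket_tangent[OF assms(2,3,5)]]
    by (simp add: curvature_def)
qed

lemma cu_scale_left:
  assumes "vf W A" "vf W B" "vf W C" "sf W f" "p \<in> W"
  shows "cu (\<lambda>q. f q *\<^sub>R A q) B C p = f p *\<^sub>R cu A B C p"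
proof -
  note AB = vf_T[OF assms(1)] vf_T[OF assms(2)]
  have "D p (B p) (\<lambda>q. D q (f q *\<^sub>R A q) C) = D p (B p) (\<lambda>q. f q *\<^sub>R D q (A q) C)"
    by (rule D_cong[OF _ assms(5) AB(2)[OF assms(5)]])
      (intro smooth_vfield_scale vf_D assms, rule D_times[OF assms(3) _ AB(1)])
  also have "\<dots> = act (B p) f *\<^sub>R D p (A p) C + f p *\<^sub>R D p (B p) (\<lambda>q. D q (A q) C)"
    by (intro D_scale[of W] vf_D assms AB)
  finally have 1: "D p (B p) (\<lambda>q. D q (f q *\<^sub>R A q) C)
    = act (B p) f *\<^sub>R D p (A p) C + f p *\<^sub>R D p (B p) (\<lambda>q. D q (A q) C)" .
  have 2: "br (\<lambda>q. f q *\<^sub>R A q) B p = f p *\<^sub>R br A B p - act (B p) f *\<^sub>R A p"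
    using bracket_scale_right[OF assms(2,1,4,5)] bracket_skew[of B "\<lambda>q. f q *\<^sub>R A q" p]
      bracket_skew[of B A p]
    by (metis minus_diff_eq minus_minus uminus_add_conv_diff scaleR_minus_right)
  have 3: "D p (br (\<lambda>q. f q *\<^sub>R A q) B p) C = f p *\<^sub>R D p (br A B p) C - act (B p) f *\<^sub>R D p (A p) C"
    unfolding 2
    using D_minus[OF assms(3,5) T_closed(4)[OF bracket_tangent[OF assms(1,2,5)]] T_closed(4)[OF AB(1)[OF assms(5)]]]
      D_times[OF assms(3,5) bracket_tangent[OF assms(1,2,5)]] D_times[OF assms(3,5) AB(1)[OF assms(5)]]
    by simp
  show ?thesis
    using 1 3 D_times[OF vf_D[OF assms(2,3)] assms(5) AB(1)[OF assms(5)], of "f p"]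
    by (simp add: curvature_def algebra_simps)
qed

lemma cu_cong_left:
  assumes "vf W A" "vf W B" "vf W C" "p \<in> W" "\<And>q. q \<in> W \<Longrightarrow> A' q = A q"
  shows "cu A' B C p = cu A B C p"
proof -
  have "D p (B p) (\<lambda>q. D q (A' q) C) = D p (B p) (\<lambda>q. D q (A q) C)"
    by (rule D_cong[OF vf_D[OF assms(1,3)] assms(4) vf_T[OF assms(2,4)]]) (simp add: assms(5))
  then show ?thesis
    using bracket_cong[OF assms(1,2,4,5) refl] assms(5)[OF assms(4)] by (simp add: curvature_def)
qed

text \<open>The covariant derivative of the torsion: \<nabla>_A T evaluated on B and C.\<close>

definition DT :: "'m vfield \<Rightarrow> 'm vfield \<Rightarrow> 'm vfield \<Rightarrow> 'm vfield" where
  "DT A B C p = D p (A p) (tor B C) - tor (\<lambda>q. D q (A q) B) C p - tor B (\<lambda>q. D q (A q) C) p"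

lemma D_tor:
  assumes "vf W A" "vf W B" "vf W C" "p \<in> W"
  shows "D p (A p) (tor B C) = D p (A p) (\<lambda>q. D q (B q) C) - D p (A p) (\<lambda>q. D q (C q) B) - D p (A p) (br B C)"
  unfolding torsion_def[abs_def]
  by (subst D_diff[of W], (intro smooth_vfield_diff vf_D smooth_vfield_bracket assms vf_T[OF assms(1)])+)
    (subst D_diff[of W], (intro smooth_vfield_diff vf_D smooth_vfield_bracket assms vf_T[OF assms(1)])+, simp)

lemma tor_tor:
  assumes "vf W A" "vf W B" "vf W C" "p \<in> W"
  shows "tor (tor A B) C p = tor (\<lambda>q. D q (A q) B) C p - tor (\<lambda>q. D q (B q) A) C p - tor (br A B) C p"
proof -
  have DA: "vf W (\<lambda>q. D q (A q) B)" "vf W (\<lambda>q. D q (B q) A)" and b: "vf W (br A B)"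
    by (intro vf_D smooth_vfield_bracket assms)+
  have "tor C (tor A B) p = tor C (\<lambda>q. D q (A q) B) p - tor C (\<lambda>q. D q (B q) A) p - tor C (br A B) p"
    unfolding torsion_def[of "atlas M" D A B, abs_def]
    using tor_minus[OF assms(3) smooth_vfield_diff[OF DA] b assms(4)] tor_minus[OF assms(3) DA assms(4)]
    by simp
  then show ?thesis by (simp add: tor_skew[of _ C])
qed

text \<open>The first Bianchi identity of a connection with torsion. Written out in \<open>D\<close>
  and brackets, the iterated derivatives agree on both sides, and the remaining double brackets
  vanish by \<open>jacobi\<close>.\<close>

lemma bianchi:
  assumes "vf W A" "vf W B" "vf W C" "p \<in> W"
  shows "cu A B C p + cu B C A p + cu C A B p
    = DT A B C p + DT B C A p + DT C A B p + tor (tor A B) C p + tor (tor B C) A p + tor (tor C A) B p"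
proof -
  have t: "tor (br A B) C p = D p (br A B p) C - D p (C p) (br A B) + br C (br A B) p" for A B C
    by (simp add: torsion_def bracket_skew[of "br A B" C])
  have j: "br A (br B C) p = - br B (br C A) p - br C (br A B) p"
    using jacobi[OF assms] by (simp add: eq_neg_iff_add_eq_0 algebra_simps)
  show ?thesis
    unfolding curvature_def DT_def
      D_tor[OF assms] D_tor[OF assms(2,3,1,4)] D_tor[OF assms(3,1,2,4)]
      tor_tor[OF assms] tor_tor[OF assms(2,3,1,4)] tor_tor[OF assms(3,1,2,4)] t j
      tor_skew[of "\<lambda>q. D q (B q) C" A p] tor_skew[of "\<lambda>q. D q (C q) A" B p] tor_skew[of "\<lambda>q. D q (A q) B" C p]
    by (simp add: algebra_simps tor_skew[of "\<lambda>q. D q (A q) C" B p] tor_skew[of "\<lambda>q. D q (B q) A" C p]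
        tor_skew[of "\<lambda>q. D q (C q) B" A p])
qed

end

text \<open>The cyclic successor, which lets the curvature forms of V carry a single index.\<close>

definition suc3 :: "nat \<Rightarrow> nat" where
  "suc3 s = (if s = 3 then 1 else Suc s)"

lemma suc3_cyc: "(i, j, k) \<in> cyc \<Longrightarrow> suc3 i = j \<and> suc3 j = k \<and> suc3 k = i"
  by (auto simp: cyc_def suc3_def)

context pqc_data
begin

text \<open>The curvature 2-forms \<open>d\<alpha>\<^sub>i + \<epsilon>\<^sub>i \<alpha>\<^sub>j \<and> \<alpha>\<^sub>k\<close> of the connection on \<open>V\<close>.\<close>

definition P :: "nat \<Rightarrow> 'm vfield \<Rightarrow> 'm vfield \<Rightarrow> 'm \<Rightarrow> real" where
  "P s A B p = act (A p) (\<lambda>q. \<alpha> s q (B q)) - act (B p) (\<lambda>q. \<alpha> s q (A q)) - \<alpha> s p (br A B p)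
     + eps s * (\<alpha> (suc3 s) p (A p) * \<alpha> (suc3 (suc3 s)) p (B p)
       - \<alpha> (suc3 s) p (B p) * \<alpha> (suc3 (suc3 s)) p (A p))"

definition \<Theta> :: "nat \<Rightarrow> nat \<Rightarrow> nat \<Rightarrow> 'm \<Rightarrow> real" where
  "\<Theta> i s t p = \<eta> i p (tor (\<xi> s) (\<xi> t) p)"

text \<open>The candidate for \<lambda>. Since g(\<xi>_3, \<xi>_3) = 1, the relations of
  \<open>Theta_Lambda\<close> make it equal to -g(T(\<xi>_1, \<xi>_2), \<xi>_3).\<close>

definition \<Lambda> :: "'m \<Rightarrow> real" where
  "\<Lambda> q = \<Theta> 1 2 3 q"

end

section \<open>Working with an orthonormal frame\<close>

lemma cyc_middle: "s \<in> {1,2,3} \<Longrightarrow> \<exists>i k. (i, s, k) \<in> cyc"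
  by (auto simp: cyc_def)

lemma (in pqc_data) g_zero [simp]: "x \<in> H M p \<Longrightarrow> g p 0 x = 0" "x \<in> H M p \<Longrightarrow> g p x 0 = 0"
  using g_left(5)[of x p x] g_right(5)[of x p x] by auto

locale pqc_frame = pqc_data +
  fixes W :: "'a set" and e :: "nat \<Rightarrow> 'a vfield"
  assumes W: "W \<subseteq> U" "open W"
    and e: "\<And>a. a < N \<Longrightarrow> hf W (e a)"
    and e_unit: "\<And>q a. q \<in> W \<Longrightarrow> a < N \<Longrightarrow> g q (e a q) (e a q) \<in> {1, - 1}"
    and e_orth: "\<And>q a b. q \<in> W \<Longrightarrow> a < N \<Longrightarrow> b < N \<Longrightarrow> a \<noteq> b \<Longrightarrow> g q (e a q) (e b q) = 0"
begin

abbreviation "\<sigma> a q \<equiv> g q (e a q) (e a q)"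

lemma WU: "p \<in> W \<Longrightarrow> p \<in> U"
  using W by blast

lemma e_H [simp]: "q \<in> W \<Longrightarrow> a < N \<Longrightarrow> e a q \<in> H M q"
  by (rule hf_H[OF e])

lemma \<sigma>_sq: "q \<in> W \<Longrightarrow> a < N \<Longrightarrow> \<sigma> a q * \<sigma> a q = 1"
  using e_unit[of q a] by auto

lemma \<sigma>_nz: "q \<in> W \<Longrightarrow> a < N \<Longrightarrow> \<sigma> a q \<noteq> 0"
  using e_unit[of q a] by auto

lemma N_pos: "0 < N"
  using qdim_pos by simp

lemma g_frame_sum:
  assumes "q \<in> W" "b < N"
  shows "g q (\<Sum>a<N. c a *\<^sub>R e a q) (e b q) = c b * \<sigma> b q"
proof -
  have "g q (\<Sum>a<N. c a *\<^sub>R e a q) (e b q) = (\<Sum>a<N. c a * g q (e a q) (e b q))"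
    using assms by (subst g_sum_left) auto
  also have "\<dots> = (\<Sum>a<N. if a = b then c b * \<sigma> b q else 0)"
    by (rule sum.cong) (use assms e_orth in auto)
  finally show ?thesis using assms by simp
qed

text \<open>Orthogonality of non-null vectors gives independence. Spanning is a dimension count: H
  is spanned by \<open>N\<close> vectors, and a vector outside the span of the frame would yield
  \<open>N + 1\<close> independent ones.\<close>

lemma frame_expand:
  assumes q: "q \<in> W" and x: "x \<in> H M q"
  shows "x = (\<Sum>a<N. (\<sigma> a q * g q x (e a q)) *\<^sub>R e a q)"
proof -
  let ?B = "(\<lambda>a. e a q) ` {..<N}"
  have inj: "inj_on (\<lambda>a. e a q) {..<N}"
  proof (rule inj_onI)
    fix a b assume ab: "a \<in> {..<N}" "b \<in> {..<N}" "e a q = e b q"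
    show "a = b"
      using e_orth[OF q, of a b] \<sigma>_nz[OF q, of a] ab by auto
  qed
  have indep: "independent ?B"
  proof
    assume "dependent ?B"
    then obtain u v where u: "v \<in> ?B" "u v \<noteq> 0" "(\<Sum>v\<in>?B. u v *\<^sub>R v) = 0"
      by (auto simp: dependent_finite)
    then obtain b where b: "b < N" "v = e b q" by auto
    have "(\<Sum>a<N. u (e a q) *\<^sub>R e a q) = 0" using u(3) inj by (simp add: sum.reindex)
    then have "u (e b q) * \<sigma> b q = 0"
      using g_frame_sum[OF q b(1), of "\<lambda>a. u (e a q)"] q b by simp
    then show False using u(2) b \<sigma>_nz[OF q b(1)] by simp
  qed
  have "x \<in> span ?B"
  proof (rule ccontr)
    assume n: "x \<notin> span ?B"
    then have ind: "independent (insert x ?B)" using indep by (simp add: independent_insert)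
    obtain W0 X where W0: "q \<in> W0" "\<And>p. p \<in> W0 \<Longrightarrow> H M p = span ((\<lambda>a. X a p) ` {..<N})"
      using H_span[of q] by metis
    have "card (insert x ?B) \<le> card ((\<lambda>a. X a q) ` {..<N})"
    proof (rule independent_span_bound[OF _ ind, THEN conjunct2])
      show "insert x ?B \<subseteq> span ((\<lambda>a. X a q) ` {..<N})"
        using x q by (auto simp: W0(2)[OF W0(1), symmetric])
    qed simp
    also have "\<dots> \<le> N" using card_image_le[of "{..<N}" "\<lambda>a. X a q"] by simp
    finally show False
      using n span_base[of x ?B] card_image[OF inj] by (subst (asm) card_insert_disjoint) auto
  qed
  then obtain u where "x = (\<Sum>v\<in>?B. u v *\<^sub>R v)" by (auto simp: span_finite)
  then have u: "x = (\<Sum>a<N. u (e a q) *\<^sub>R e a q)" using inj by (simp add: sum.reindex)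
  have "\<sigma> a q * g q x (e a q) = u (e a q)" if "a < N" for a
    using g_frame_sum[OF q that, of "\<lambda>a. u (e a q)"] \<sigma>_sq[OF q that] u by (simp add: mult.left_commute)
  then show ?thesis using u by (metis (no_types, lifting) lessThan_iff sum.cong)
qed

lemma frame_sum:
  assumes q: "q \<in> W" and x: "x \<in> H M q"
  shows "(\<Sum>a<N. (\<sigma> a q * g q x (e a q)) *\<^sub>R e a q) = x"
  using frame_expand[OF assms] by simp

text \<open>Linearity over functions, seen at \<open>p\<close>. The last clause reflects that fields
  are total functions: the frame expansion of a field holds on \<open>W\<close> only, so values
  elsewhere must not influence \<open>F\<close>.\<close>

definition tensorial :: "'a \<Rightarrow> ('a vfield \<Rightarrow> 'c::real_vector) \<Rightarrow> bool" where
  "tensorial p F \<longleftrightarrow> (\<forall>X Y. hf W X \<longrightarrow> hf W Y \<longrightarrow> F (\<lambda>q. X q + Y q) = F X + F Y) \<and>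
     (\<forall>f X. sf W f \<longrightarrow> hf W X \<longrightarrow> F (\<lambda>q. f q *\<^sub>R X q) = f p *\<^sub>R F X) \<and>
     (\<forall>X Y. hf W X \<longrightarrow> (\<forall>q\<in>W. Y q = X q) \<longrightarrow> F Y = F X)"

lemma tensorialI:
  assumes "\<And>X Y. hf W X \<Longrightarrow> hf W Y \<Longrightarrow> F (\<lambda>q. X q + Y q) = F X + F Y"
    and "\<And>f X. sf W f \<Longrightarrow> hf W X \<Longrightarrow> F (\<lambda>q. f q *\<^sub>R X q) = f p *\<^sub>R F X"
    and "\<And>X Y. hf W X \<Longrightarrow> (\<And>q. q \<in> W \<Longrightarrow> Y q = X q) \<Longrightarrow> F Y = F X"
  shows "tensorial p F"
  unfolding tensorial_def
proof (intro conjI allI impI)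
  fix X Y assume "hf W X" "\<forall>q\<in>W. Y q = X q"
  then show "F Y = F X" by (intro assms(3)) simp_all
qed (fact assms(1,2))+

lemma tensorial_sum:
  assumes F: "tensorial p F" and p: "p \<in> W" and c: "\<And>a. a \<in> I \<Longrightarrow> sf W (c a)"
    and X: "\<And>a. a \<in> I \<Longrightarrow> hf W (X a)"
  shows "F (\<lambda>q. \<Sum>a\<in>I. c a q *\<^sub>R X a q) = (\<Sum>a\<in>I. c a p *\<^sub>R F (X a))"
proof -
  note F1 = F[unfolded tensorial_def, THEN conjunct1, rule_format]
    and F2 = F[unfolded tensorial_def, THEN conjunct2, THEN conjunct1, rule_format]
  have 0: "F (\<lambda>q. 0) = 0"
    using F2[OF smooth_fun_const[OF W(2)] e[OF N_pos], of 0] by simp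
  show ?thesis
    using c X
  proof (induction I rule: infinite_finite_induct)
    case (insert a I)
    have 1: "hf W (\<lambda>q. c a q *\<^sub>R X a q)" by (intro hf_scale insert) simp_all
    have 2: "hf W (\<lambda>q. \<Sum>a\<in>I. c a q *\<^sub>R X a q)"
      by (intro hf_sum hf_scale insert W(2)) simp_all
    show ?case
      using insert F1[OF 1 2] F2[of "c a" "X a"] by simp
  qed (simp_all add: 0)
qed

lemma sf_coeff: "a < N \<Longrightarrow> hf W X \<Longrightarrow> sf W (\<lambda>q. \<sigma> a q * g q (X q) (e a q))"
  by (intro smooth_fun_mult sf_g e)

lemma tensorial_expand:
  assumes F: "tensorial p F" and p: "p \<in> W" and X: "hf W X"
  shows "F X = (\<Sum>a<N. (\<sigma> a p * g p (X p) (e a p)) *\<^sub>R F (e a))"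
proof -
  have "F X = F (\<lambda>q. \<Sum>a<N. (\<sigma> a q * g q (X q) (e a q)) *\<^sub>R e a q)"
    by (rule F[unfolded tensorial_def, THEN conjunct2, THEN conjunct2, rule_format, OF X, symmetric])
      (rule frame_sum[OF _ hf_H[OF X]])
  also have "\<dots> = (\<Sum>a<N. (\<sigma> a p * g p (X p) (e a p)) *\<^sub>R F (e a))"
    by (rule tensorial_sum[OF F p]) (simp_all add: sf_coeff X e)
  finally show ?thesis .
qed

text \<open>After expansion in the frame, a tensorial map sees its argument only through the
  coefficients at \<open>p\<close>.\<close>

lemma tensorial_eq:
  "tensorial p F \<Longrightarrow> p \<in> W \<Longrightarrow> hf W X \<Longrightarrow> hf W Y \<Longrightarrow> X p = Y p \<Longrightarrow> F X = F Y"
  by (simp add: tensorial_expand[of p F X] tensorial_expand[of p F Y])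

text \<open>Extends a vector at \<open>p\<close> to a horizontal field on \<open>W\<close> with
  constant frame coefficients, which turns tensors on fields into multilinear maps on the
  fibre.\<close>

definition fld :: "'a \<Rightarrow> 'a tvec \<Rightarrow> 'a vfield" where
  "fld p x q = (\<Sum>a<N. (\<sigma> a p * g p x (e a p)) *\<^sub>R e a q)"

lemma hf_fld: "hf W (fld p x)"
  unfolding fld_def[abs_def] by (intro hf_sum hf_cscale e W) simp

lemma fld_at [simp]: "p \<in> W \<Longrightarrow> x \<in> H M p \<Longrightarrow> fld p x p = x"
  by (simp add: fld_def frame_sum)

lemmas vf_fld = hf_vf[OF hf_fld]
lemmas vf_e = hf_vf[OF e]

lemma vf_xiW: "s \<in> {1,2,3} \<Longrightarrow> vf W (\<xi> s)"
  by (rule vf_xi[OF W])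

section \<open>The connection 1-forms\<close>

text \<open>The connection forms are given only by their defining relation. Pairing it with
  \<open>J k p (e 0 p)\<close>, whose square is \<open>- eps k * \<sigma> 0 p\<close>, solves for
  \<open>\<alpha> j\<close>; linearity and smoothness of the connection forms are read off from this
  formula.\<close>

lemma alpha_eq:
  assumes p: "p \<in> W" and v: "v \<in> T p" and c: "(i, j, k) \<in> cyc"
  shows "\<alpha> j p v = - eps k * \<sigma> 0 p *
    g p (D p v (\<lambda>q. J i q (e 0 q)) - J i p (D p v (e 0))) (J k p (e 0 p))"
proof -
  note i = cyc_in[OF c]
  have x: "e 0 p \<in> H M p" using p N_pos by simp
  have "D p v (\<lambda>q. J i q (e 0 q)) - J i p (D p v (e 0))
      = \<alpha> j p v *\<^sub>R J k p (e 0 p) + (eps k * \<alpha> k p v) *\<^sub>R J j p (e 0 p)"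
    using D_J[OF W(1) e[OF N_pos] p v c] by simp
  moreover have "g p (J j p (e 0 p)) (J k p (e 0 p)) = 0"
    using g_J_cross[OF WU[OF p] i(2,3) _ x] cyc_distinct[OF c] by simp
  ultimately show ?thesis
    using x i WU[OF p] \<sigma>_sq[OF p N_pos] by (simp add: mult.left_commute)
qed

lemma alpha_lin:
  assumes p: "p \<in> W" and s: "s \<in> {1,2,3}"
  shows "lin_on (T p) (\<alpha> s p)"
proof -
  obtain i k where c: "(i, s, k) \<in> cyc" using cyc_middle[OF s] by (elim exE)
  have i: "i \<in> {1,2,3}" "k \<in> {1,2,3}" using cyc_in[OF c] by auto
  have x: "e 0 p \<in> H M p" using p N_pos by simp
  have h1: "hf W (\<lambda>q. J i q (e 0 q))" by (rule hf_J[OF W(1) i(1) e[OF N_pos]])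
  note l = D_lin[OF hf_vf[OF h1] p] D_lin[OF vf_e[OF N_pos] p]
  show ?thesis
    unfolding lin_on_def
  proof (intro ballI allI)
    fix v w a b assume vw: "v \<in> T p" "w \<in> T p"
    have 1: "D p u (\<lambda>q. J i q (e 0 q)) \<in> H M p" "D p u (e 0) \<in> H M p" if "u \<in> T p" for u
      using D_H[OF W(1) h1 p that] D_H[OF W(1) e[OF N_pos] p that] by auto
    show "\<alpha> s p (a *\<^sub>R v + b *\<^sub>R w) = a *\<^sub>R \<alpha> s p v + b *\<^sub>R \<alpha> s p w"
      using vw i x WU[OF p] 1 l[unfolded lin_on_def, rule_format, OF vw]
      by (simp add: alpha_eq[OF p _ c] algebra_simps)
  qed
qed

lemma sf_alpha:
  assumes s: "s \<in> {1,2,3}" and A: "vf W A"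
  shows "sf W (\<lambda>q. \<alpha> s q (A q))"
proof -
  obtain i k where c: "(i, s, k) \<in> cyc" using cyc_middle[OF s] by (elim exE)
  have i: "i \<in> {1,2,3}" "k \<in> {1,2,3}" using cyc_in[OF c] by auto
  have "sf W (\<lambda>q. - eps k * \<sigma> 0 q *
    g q (D q (A q) (\<lambda>q. J i q (e 0 q)) - J i q (D q (A q) (e 0))) (J k q (e 0 q)))"
    by (intro smooth_fun_mult smooth_fun_const W sf_g hf_diff hf_D A hf_J i e N_pos)
  then show ?thesis
    by (rule smooth_fun_cong) (rule alpha_eq[OF _ vf_T[OF A] c])
qed

lemma D_comb:
  assumes p: "p \<in> W" and v: "v \<in> T p" and f: "sf W f" "sf W f'" and Z: "vf W Z" "vf W Z'"
  shows "D p v (\<lambda>q. f q *\<^sub>R Z q + f' q *\<^sub>R Z' q)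
    = act v f *\<^sub>R Z p + f p *\<^sub>R D p v Z + act v f' *\<^sub>R Z' p + f' p *\<^sub>R D p v Z'"
  using D_add[OF smooth_vfield_scale[OF f(1) Z(1)] smooth_vfield_scale[OF f(2) Z(2)] p v]
    D_scale[OF Z(1) p v f(1)] D_scale[OF Z(2) p v f(2)]
  by simp

lemma act_cmult:
  assumes "p \<in> W" "v \<in> T p" "sf W f" shows "act v (\<lambda>q. c * f q) = c * act v f"
  by (rule tangent_cmult[OF assms(2) smooth_atI[OF assms(3,1)]])

text \<open>The terms along \<open>\<xi> i\<close> are symmetric in \<open>A\<close> and
  \<open>B\<close> and drop out; \<open>eps k * eps i = - eps j\<close> brings the quadratic terms
  along \<open>\<xi> k\<close> into the form used in \<open>P\<close>.\<close>

lemma cu_xi: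
  assumes A: "vf W A" and B: "vf W B" and p: "p \<in> W" and c: "(i, j, k) \<in> cyc"
  shows "cu A B (\<xi> i) p = P j A B p *\<^sub>R \<xi> k p + (eps k * P k A B p) *\<^sub>R \<xi> j p"
proof -
  note i = cyc_in[OF c]
  note x = vf_xiW[OF i(1)] vf_xiW[OF i(2)] vf_xiW[OF i(3)]
  have *: "D p (A p) (\<lambda>q. D q (B q) (\<xi> i)) =
      act (A p) (\<lambda>q. \<alpha> j q (B q)) *\<^sub>R \<xi> k p + \<alpha> j p (B p) *\<^sub>R (\<alpha> i p (A p) *\<^sub>R \<xi> j p + (eps j * \<alpha> j p (A p)) *\<^sub>R \<xi> i p)
      + (eps k * act (A p) (\<lambda>q. \<alpha> k q (B q))) *\<^sub>R \<xi> j p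
      + (eps k * \<alpha> k p (B p)) *\<^sub>R (\<alpha> k p (A p) *\<^sub>R \<xi> i p + (eps i * \<alpha> i p (A p)) *\<^sub>R \<xi> k p)"
    if A: "vf W A" and B: "vf W B" for A B
  proof -
    note Ap = vf_T[OF A p]
    note sa = sf_alpha[OF i(2) B] sf_alpha[OF i(3) B]
    have "D p (A p) (\<lambda>q. D q (B q) (\<xi> i))
        = D p (A p) (\<lambda>q. \<alpha> j q (B q) *\<^sub>R \<xi> k q + (eps k * \<alpha> k q (B q)) *\<^sub>R \<xi> j q)"
      by (rule D_cong[OF _ p Ap], intro smooth_vfield_add smooth_vfield_scale smooth_fun_mult
          smooth_fun_const W sa x) (rule D_xi[OF WU vf_T[OF B] c])
    also have "\<dots> = act (A p) (\<lambda>q. \<alpha> j q (B q)) *\<^sub>R \<xi> k p + \<alpha> j p (B p) *\<^sub>R D p (A p) (\<xi> k)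
      + act (A p) (\<lambda>q. eps k * \<alpha> k q (B q)) *\<^sub>R \<xi> j p + (eps k * \<alpha> k p (B p)) *\<^sub>R D p (A p) (\<xi> j)"
      by (intro D_comb p Ap sa smooth_fun_mult smooth_fun_const W x)
    finally show ?thesis
      by (simp add: act_cmult[OF p Ap sa(2)] D_xi[OF WU[OF p] Ap cyc_rotate(1)[OF c]]
          D_xi[OF WU[OF p] Ap cyc_rotate(2)[OF c]])
  qed
  have s: "suc3 j = k" "suc3 k = i" "suc3 i = j" using suc3_cyc[OF c] by auto
  have ee: "eps k * eps i = - eps j" using cyc_eps[OF c] by simp
  have b: "D p (br A B p) (\<xi> i) = \<alpha> j p (br A B p) *\<^sub>R \<xi> k p + (eps k * \<alpha> k p (br A B p)) *\<^sub>R \<xi> j p"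
    by (rule D_xi[OF WU[OF p] bracket_tangent[OF A B p] c])
  have "cu A B (\<xi> i) p =
      (act (A p) (\<lambda>q. \<alpha> j q (B q)) - act (B p) (\<lambda>q. \<alpha> j q (A q)) - \<alpha> j p (br A B p)
        + (eps k * eps i) * (\<alpha> k p (B p) * \<alpha> i p (A p) - \<alpha> k p (A p) * \<alpha> i p (B p))) *\<^sub>R \<xi> k p
      + (eps k * (act (A p) (\<lambda>q. \<alpha> k q (B q)) - act (B p) (\<lambda>q. \<alpha> k q (A q)) - \<alpha> k p (br A B p)
        + eps k * (\<alpha> i p (A p) * \<alpha> j p (B p) - \<alpha> i p (B p) * \<alpha> j p (A p)))) *\<^sub>R \<xi> j p"
    unfolding curvature_def b *[OF A B] *[OF B A] by (simp add: algebra_simps)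
  then show ?thesis unfolding ee P_def s by (simp add: algebra_simps)
qed

text \<open>The commutator of R(A, B) with I_i has the same coefficients as R(A, B)\<xi>_i, because
  both bundles carry the same connection forms. This is the bridge from \<open>P\<close> to the
  Ricci 2-forms.\<close>

lemma cu_J:
  assumes A: "vf W A" and B: "vf W B" and X: "hf W X" and p: "p \<in> W" and c: "(i, j, k) \<in> cyc"
  shows "cu A B (\<lambda>q. J i q (X q)) p = J i p (cu A B X p)
    + P j A B p *\<^sub>R J k p (X p) + (eps k * P k A B p) *\<^sub>R J j p (X p)"
proof -
  note i = cyc_in[OF c]
  note x = hf_J[OF W(1) i(1) X] hf_J[OF W(1) i(2) X] hf_J[OF W(1) i(3) X]
  have *: "D p (A p) (\<lambda>q. D q (B q) (\<lambda>q. J i q (X q))) =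
      J i p (D p (A p) (\<lambda>q. D q (B q) X))
      + \<alpha> j p (A p) *\<^sub>R J k p (D p (B p) X) + (eps k * \<alpha> k p (A p)) *\<^sub>R J j p (D p (B p) X)
      + (act (A p) (\<lambda>q. \<alpha> j q (B q)) *\<^sub>R J k p (X p)
      + \<alpha> j p (B p) *\<^sub>R (J k p (D p (A p) X) + \<alpha> i p (A p) *\<^sub>R J j p (X p) + (eps j * \<alpha> j p (A p)) *\<^sub>R J i p (X p))
      + (eps k * act (A p) (\<lambda>q. \<alpha> k q (B q))) *\<^sub>R J j p (X p)
      + (eps k * \<alpha> k p (B p)) *\<^sub>R (J j p (D p (A p) X) + \<alpha> k p (A p) *\<^sub>R J i p (X p) + (eps i * \<alpha> i p (A p)) *\<^sub>R J k p (X p)))"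
    if A: "vf W A" and B: "vf W B" for A B
  proof -
    note Ap = vf_T[OF A p]
    note sa = sf_alpha[OF i(2) B] sf_alpha[OF i(3) B]
    have hD: "hf W (\<lambda>q. D q (B q) X)" by (rule hf_D[OF W(1) B X])
    note v1 = hf_vf[OF hf_J[OF W(1) i(1) hD]]
    have v2: "vf W (\<lambda>q. \<alpha> j q (B q) *\<^sub>R J k q (X q) + (eps k * \<alpha> k q (B q)) *\<^sub>R J j q (X q))"
      by (intro smooth_vfield_add smooth_vfield_scale smooth_fun_mult smooth_fun_const W sa hf_vf x)
    have "D p (A p) (\<lambda>q. D q (B q) (\<lambda>q. J i q (X q)))
        = D p (A p) (\<lambda>q. J i q (D q (B q) X) + (\<alpha> j q (B q) *\<^sub>R J k q (X q) + (eps k * \<alpha> k q (B q)) *\<^sub>R J j q (X q)))"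
      by (rule D_cong[OF smooth_vfield_add[OF v1 v2] p Ap])
        (simp add: D_J[OF W(1) X _ vf_T[OF B] c] add.assoc)
    also have "\<dots> = D p (A p) (\<lambda>q. J i q (D q (B q) X))
        + D p (A p) (\<lambda>q. \<alpha> j q (B q) *\<^sub>R J k q (X q) + (eps k * \<alpha> k q (B q)) *\<^sub>R J j q (X q))"
      by (rule D_add[OF v1 v2 p Ap])
    also have "D p (A p) (\<lambda>q. J i q (D q (B q) X)) = J i p (D p (A p) (\<lambda>q. D q (B q) X))
      + \<alpha> j p (A p) *\<^sub>R J k p (D p (B p) X) + (eps k * \<alpha> k p (A p)) *\<^sub>R J j p (D p (B p) X)"
      by (rule D_J[OF W(1) hD p Ap c])
    also have "D p (A p) (\<lambda>q. \<alpha> j q (B q) *\<^sub>R J k q (X q) + (eps k * \<alpha> k q (B q)) *\<^sub>R J j q (X q))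
      = act (A p) (\<lambda>q. \<alpha> j q (B q)) *\<^sub>R J k p (X p) + \<alpha> j p (B p) *\<^sub>R D p (A p) (\<lambda>q. J k q (X q))
      + act (A p) (\<lambda>q. eps k * \<alpha> k q (B q)) *\<^sub>R J j p (X p) + (eps k * \<alpha> k p (B p)) *\<^sub>R D p (A p) (\<lambda>q. J j q (X q))"
      by (intro D_comb p Ap sa smooth_fun_mult smooth_fun_const W hf_vf x)
    finally show ?thesis
      by (simp add: act_cmult[OF p Ap sa(2)] D_J[OF W(1) X p Ap cyc_rotate(1)[OF c]]
          D_J[OF W(1) X p Ap cyc_rotate(2)[OF c]])
  qed
  have s: "suc3 j = k" "suc3 k = i" "suc3 i = j" using suc3_cyc[OF c] by auto
  have ee: "eps k * eps i = - eps j" using cyc_eps[OF c] by simp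
  have b: "D p (br A B p) (\<lambda>q. J i q (X q)) = J i p (D p (br A B p) X)
     + \<alpha> j p (br A B p) *\<^sub>R J k p (X p) + (eps k * \<alpha> k p (br A B p)) *\<^sub>R J j p (X p)"
    by (rule D_J[OF W(1) X p bracket_tangent[OF A B p] c])
  have H: "D p (A p) (\<lambda>q. D q (B q) X) \<in> H M p" "D p (B p) (\<lambda>q. D q (A q) X) \<in> H M p" "D p (br A B p) X \<in> H M p"
    by (intro D_H[OF W(1)] hf_D[OF W(1)] A B X p vf_T[OF A p] vf_T[OF B p] bracket_tangent[OF A B p])+
  have "cu A B (\<lambda>q. J i q (X q)) p = J i p (cu A B X p) +
      (act (A p) (\<lambda>q. \<alpha> j q (B q)) - act (B p) (\<lambda>q. \<alpha> j q (A q)) - \<alpha> j p (br A B p)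
        + (eps k * eps i) * (\<alpha> k p (B p) * \<alpha> i p (A p) - \<alpha> k p (A p) * \<alpha> i p (B p))) *\<^sub>R J k p (X p)
      + (eps k * (act (A p) (\<lambda>q. \<alpha> k q (B q)) - act (B p) (\<lambda>q. \<alpha> k q (A q)) - \<alpha> k p (br A B p)
        + eps k * (\<alpha> i p (A p) * \<alpha> j p (B p) - \<alpha> i p (B p) * \<alpha> j p (A p)))) *\<^sub>R J j p (X p)"
    unfolding curvature_def b *[OF A B] *[OF B A] using H i WU[OF p] by (simp add: algebra_simps)
  then show ?thesis unfolding ee P_def s by (simp add: algebra_simps)
qed

end

context pqc_frame
begin

section \<open>The vertical part of the torsion\<close>

lemma eta_combination:
  assumes "p \<in> W" "(i, j, k) \<in> cyc"
  shows "\<eta> i p (a *\<^sub>R \<xi> i p + b *\<^sub>R \<xi> j p + c *\<^sub>R \<xi> k p) = a"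
proof -
  have i: "i \<in> {1,2,3}" "j \<in> {1,2,3}" "k \<in> {1,2,3}" using cyc_in[OF assms(2)] by auto
  show ?thesis
    using WU[OF assms(1)] i xi_T[OF WU[OF assms(1)]] cyc_distinct[OF assms(2)] by (simp add: eta_xi)
qed

lemma split_cyc: "(i, j, k) \<in> cyc \<Longrightarrow>
    v = h p v + (\<eta> i p v *\<^sub>R \<xi> i p + \<eta> j p v *\<^sub>R \<xi> j p + \<eta> k p v *\<^sub>R \<xi> k p)"
  using split_HV[of v p] by (simp only: cyc_sum)

lemma D_split_field:
  assumes B: "vf W B" and p: "p \<in> W" and v: "v \<in> T p" and c: "(i, j, k) \<in> cyc"
  shows "D p v B = D p v (\<lambda>q. h q (B q))
    + (act v (\<lambda>q. \<eta> i q (B q)) + \<eta> j p (B p) * \<alpha> k p v + eps j * \<eta> k p (B p) * \<alpha> j p v) *\<^sub>R \<xi> i p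
    + (act v (\<lambda>q. \<eta> j q (B q)) + \<eta> k p (B p) * \<alpha> i p v + eps k * \<eta> i p (B p) * \<alpha> k p v) *\<^sub>R \<xi> j p
    + (act v (\<lambda>q. \<eta> k q (B q)) + \<eta> i p (B p) * \<alpha> j p v + eps i * \<eta> j p (B p) * \<alpha> i p v) *\<^sub>R \<xi> k p"
proof -
  note i = cyc_in[OF c]
  note x = vf_xiW[OF i(1)] vf_xiW[OF i(2)] vf_xiW[OF i(3)]
  note s = sf_eta[OF W(1) i(1) B] sf_eta[OF W(1) i(2) B] sf_eta[OF W(1) i(3) B]
  note hB = hf_vf[OF hf_hproj[OF W(1) B]]
  have 1: "vf W (\<lambda>q. \<eta> i q (B q) *\<^sub>R \<xi> i q)" "vf W (\<lambda>q. \<eta> j q (B q) *\<^sub>R \<xi> j q + \<eta> k q (B q) *\<^sub>R \<xi> k q)"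
    by (intro smooth_vfield_add smooth_vfield_scale s x)+
  have "D p v B = D p v (\<lambda>q. h q (B q) + (\<eta> i q (B q) *\<^sub>R \<xi> i q + (\<eta> j q (B q) *\<^sub>R \<xi> j q + \<eta> k q (B q) *\<^sub>R \<xi> k q)))"
    by (rule arg_cong[of B _ "D p v"], rule ext, rule trans[OF split_cyc[OF c]]) (simp only: add.assoc)
  also have "\<dots> = D p v (\<lambda>q. h q (B q)) + (D p v (\<lambda>q. \<eta> i q (B q) *\<^sub>R \<xi> i q)
      + D p v (\<lambda>q. \<eta> j q (B q) *\<^sub>R \<xi> j q + \<eta> k q (B q) *\<^sub>R \<xi> k q))"
    by (simp only: D_add[OF hB smooth_vfield_add[OF 1] p v] D_add[OF 1 p v])
  finally show ?thesis
    unfolding D_comb[OF p v s(2,3) x(2,3)] D_scale[OF x(1) p v s(1)]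
      D_xi[OF WU[OF p] v c] D_xi[OF WU[OF p] v cyc_rotate(1)[OF c]] D_xi[OF WU[OF p] v cyc_rotate(2)[OF c]]
    by (simp add: algebra_simps)
qed

text \<open>Both summands of the splitting are parallel, so differentiating the vertical part of
  \<open>B\<close> produces vertical vectors only.\<close>

lemma hproj_D:
  assumes B: "vf W B" and p: "p \<in> W" and v: "v \<in> T p"
  shows "h p (D p v B) = D p v (\<lambda>q. h q (B q))"
proof -
  have H: "D p v (\<lambda>q. h q (B q)) \<in> H M p" by (rule D_H[OF W(1) hf_hproj[OF W(1) B] p v])
  have c: "(1, 2, 3) \<in> cyc" by (simp add: cyc_def)
  note xi = xi_T[OF WU[OF p], of 1] xi_T[OF WU[OF p], of 2] xi_T[OF WU[OF p], of 3]
  show ?thesis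
    unfolding D_split_field[OF B p v c]
    using H_tangent[OF H] H WU[OF p] xi hproj_xi[OF WU[OF p], of 1] hproj_xi[OF WU[OF p], of 2]
      hproj_xi[OF WU[OF p], of 3]
    by (simp del: One_nat_def)
qed

lemma eta_D:
  assumes B: "vf W B" and p: "p \<in> W" and v: "v \<in> T p" and c: "(i, j, k) \<in> cyc"
  shows "\<eta> i p (D p v B) = act v (\<lambda>q. \<eta> i q (B q)) + \<eta> j p (B p) * \<alpha> k p v + eps j * \<eta> k p (B p) * \<alpha> j p v"
proof -
  note i = cyc_in[OF c]
  have H: "D p v (\<lambda>q. h q (B q)) \<in> H M p" by (rule D_H[OF W(1) hf_hproj[OF W(1) B] p v])
  show ?thesis
    unfolding D_split_field[OF B p v c]
    using H_tangent[OF H] H WU[OF p] i xi_T[OF WU[OF p]] cyc_distinct[OF c] by (simp add: eta_xi)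
qed

lemma d_eta:
  assumes A: "vf W A" and B: "vf W B" and p: "p \<in> W" and c: "(i, j, k) \<in> cyc"
  shows "act (A p) (\<lambda>q. \<eta> i q (B q)) - act (B p) (\<lambda>q. \<eta> i q (A q)) - \<eta> i p (br A B p)
    = \<eta> j p (A p) * \<alpha> k p (B p) - \<eta> j p (B p) * \<alpha> k p (A p)
      + eps j * (\<eta> k p (A p) * \<alpha> j p (B p) - \<eta> k p (B p) * \<alpha> j p (A p)) + \<eta> i p (tor A B p)"
proof -
  have i: "i \<in> {1,2,3}" using cyc_in[OF c] by auto
  have "\<eta> i p (tor A B p) = \<eta> i p (D p (A p) B) - \<eta> i p (D p (B p) A) - \<eta> i p (br A B p)"
    unfolding torsion_def
    using WU[OF p] i D_T[OF B p vf_T[OF A p]] D_T[OF A p vf_T[OF B p]] bracket_tangent[OF A B p] by simp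
  then show ?thesis
    unfolding eta_D[OF B p vf_T[OF A p] c] eta_D[OF A p vf_T[OF B p] c]
    by (simp add: algebra_simps)
qed

lemma act_zero:
  assumes "v \<in> T p" "p \<in> W" "\<And>q. q \<in> W \<Longrightarrow> f q = c"
  shows "act v f = 0"
  using tangent_cong[OF assms(1) smooth_atI[OF smooth_fun_const[OF W(2)] assms(2)] W(2) assms(2), of f c]
    tangent_const[OF assms(1)] assms(3) by simp

lemma eta_bracket:
  assumes X: "hf W X" and Y: "hf W Y" and p: "p \<in> W" and s: "s \<in> {1,2,3}"
  shows "\<eta> s p (br X Y p) = 2 * eps s * g p (J s p (X p)) (Y p)"
proof -
  have z: "act v (\<lambda>q. \<eta> s q (Z q)) = 0" if "hf W Z" "v \<in> T p" for Z v
    by (rule act_zero[OF that(2) p]) (rule eta_H[OF WU s hf_H[OF that(1)]])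
  have "ext_d (atlas M) (form1 (eta L s)) [X, Y] p = - 2 * eps s * g p (cI L s p (X p)) (Y p)"
    by (rule compat[unfolded compatible_def, THEN conjunct2, THEN conjunct2, THEN conjunct2,
          THEN conjunct2, THEN conjunct2, rule_format, of W]) (use W X Y p s in simp_all)
  then show ?thesis
    unfolding ext_d_form1 using z[OF Y vf_T[OF hf_vf[OF X] p]] z[OF X vf_T[OF hf_vf[OF Y] p]] by simp
qed

lemma tor_HH:
  assumes X: "hf W X" and Y: "hf W Y" and p: "p \<in> W" and c: "(i, j, k) \<in> cyc"
  shows "tor X Y p = (- 2 * eps i * g p (J i p (X p)) (Y p)) *\<^sub>R \<xi> i p
    + (- 2 * eps j * g p (J j p (X p)) (Y p)) *\<^sub>R \<xi> j p + (- 2 * eps k * g p (J k p (X p)) (Y p)) *\<^sub>R \<xi> k p"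
proof -
  note i = cyc_in[OF c]
  have "tor X Y p = - (\<Sum>s\<in>{1,2,3}. eta L s p (br X Y p) *\<^sub>R xi L s p)"
    by (rule D_torsion[unfolded torsion_conditions_def, THEN conjunct1, rule_format, of W])
      (use W X Y p in simp_all)
  then show ?thesis
    unfolding cyc_sum[OF c] eta_bracket[OF X Y p i(1)] eta_bracket[OF X Y p i(2)] eta_bracket[OF X Y p i(3)]
    by simp
qed

lemma eta_tor_HH:
  assumes X: "hf W X" and Y: "hf W Y" and p: "p \<in> W" and s: "s \<in> {1,2,3}"
  shows "\<eta> s p (tor X Y p) = - 2 * eps s * g p (J s p (X p)) (Y p)"
proof -
  obtain j k where c: "(s, j, k) \<in> cyc" using cyc_exists[OF s] by (elim exE)
  show ?thesis unfolding tor_HH[OF X Y p c] by (rule eta_combination[OF p c])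
qed

lemma hproj_tor_HH:
  assumes X: "hf W X" and Y: "hf W Y" and p: "p \<in> W"
  shows "h p (tor X Y p) = 0"
proof -
  have c: "(1, 2, 3) \<in> cyc" by (simp add: cyc_def)
  note xi = xi_T[OF WU[OF p], of 1] xi_T[OF WU[OF p], of 2] xi_T[OF WU[OF p], of 3]
  show ?thesis
    unfolding tor_HH[OF X Y p c]
    using WU[OF p] xi hproj_xi[OF WU[OF p], of 1] hproj_xi[OF WU[OF p], of 2]
      hproj_xi[OF WU[OF p], of 3]
    by (simp del: One_nat_def)
qed

lemma vanish_T:
  assumes "p \<in> W" "v \<in> T p" "h p v = 0" "\<And>s. s \<in> {1,2,3} \<Longrightarrow> \<eta> s p v = 0"
  shows "v = 0"
  using split_HV[of v p] assms(3,4) by simp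

text \<open>The restriction of the torsion to \<open>H\<close> is parallel: it is built from \<open>g\<close> and the parallel map
  \<open>\<xi>\<^sub>s \<mapsto> I\<^sub>s\<close>.\<close>

lemma DT_HH:
  assumes A: "vf W A" and X: "hf W X" and Y: "hf W Y" and p: "p \<in> W"
  shows "DT A X Y p = 0"
proof (rule vanish_T[OF p])
  note Ap = vf_T[OF A p]
  note DX = hf_D[OF W(1) A X] and DY = hf_D[OF W(1) A Y]
  have v: "vf W (tor X Y)" by (rule vf_tor[OF hf_vf[OF X] hf_vf[OF Y]])
  have t: "D p (A p) (tor X Y) \<in> T p" "tor (\<lambda>q. D q (A q) X) Y p \<in> T p" "tor X (\<lambda>q. D q (A q) Y) p \<in> T p"
    by (rule D_T[OF v p Ap], rule vf_T[OF vf_tor[OF hf_vf[OF DX] hf_vf[OF Y]] p],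
        rule vf_T[OF vf_tor[OF hf_vf[OF X] hf_vf[OF DY]] p])
  show "DT A X Y p \<in> T p" unfolding DT_def using t by simp
  have "h p (D p (A p) (tor X Y)) = D p (A p) (\<lambda>q. h q (tor X Y q))"
    by (rule hproj_D[OF v p Ap])
  also have "\<dots> = D p (A p) (\<lambda>q. 0 *\<^sub>R X q)"
    by (rule D_cong[OF smooth_vfield_cscale[OF hf_vf[OF X]] p Ap]) (simp add: hproj_tor_HH[OF X Y])
  also have "\<dots> = 0" using D_cscale[OF hf_vf[OF X] p Ap, of 0] by simp
  finally show "h p (DT A X Y p) = 0"
    unfolding DT_def using t WU[OF p] hproj_tor_HH[OF DX Y p] hproj_tor_HH[OF X DY p] by simp
  fix s :: nat assume s: "s \<in> {1,2,3}"
  obtain j k where c: "(s, j, k) \<in> cyc" using cyc_exists[OF s] by (elim exE)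
  note i = cyc_in[OF c]
  have sg: "sf W (\<lambda>q. g q (J s q (X q)) (Y q))" by (intro sf_g hf_J[OF W(1) s] X Y)
  have "act (A p) (\<lambda>q. \<eta> s q (tor X Y q)) = act (A p) (\<lambda>q. (- 2 * eps s) * g q (J s q (X q)) (Y q))"
    by (rule tangent_cong[OF Ap smooth_atI[OF smooth_fun_mult[OF smooth_fun_const[OF W(2)] sg] p] W(2) p])
      (rule eta_tor_HH[OF X Y _ s])
  also have "\<dots> = - 2 * eps s * (g p (J s p (D p (A p) X)
     + \<alpha> j p (A p) *\<^sub>R J k p (X p) + (eps k * \<alpha> k p (A p)) *\<^sub>R J j p (X p)) (Y p) + g p (J s p (X p)) (D p (A p) Y))"
    unfolding act_cmult[OF p Ap sg] D_g[OF W(1) hf_J[OF W(1) s X] Y p Ap] D_J[OF W(1) X p Ap c] ..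
  finally have 1: "act (A p) (\<lambda>q. \<eta> s q (tor X Y q)) = - 2 * eps s * (g p (J s p (D p (A p) X)) (Y p)
     + \<alpha> j p (A p) * g p (J k p (X p)) (Y p) + eps k * \<alpha> k p (A p) * g p (J j p (X p)) (Y p)
     + g p (J s p (X p)) (D p (A p) Y))"
    using WU[OF p] i hf_H[OF X p] hf_H[OF Y p] hf_H[OF DX p] by simp
  have "\<eta> s p (DT A X Y p) = \<eta> s p (D p (A p) (tor X Y)) - \<eta> s p (tor (\<lambda>q. D q (A q) X) Y p)
      - \<eta> s p (tor X (\<lambda>q. D q (A q) Y) p)"
    unfolding DT_def using t WU[OF p] s by simp
  \<comment> \<open>The connection forms produced by differentiating \<open>J s\<close> cancel
    against those that \<open>eta_D\<close> contributes through the other two vertical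
    components.\<close>
  also have "\<dots> = 0"
    unfolding eta_D[OF v p Ap c] eta_tor_HH[OF DX Y p s] eta_tor_HH[OF X DY p s] 1
      eta_tor_HH[OF X Y p i(2)] eta_tor_HH[OF X Y p i(3)]
    by (rule cyc_cases[OF c]) (simp_all add: algebra_simps)
  finally show "\<eta> s p (DT A X Y p) = 0" .
qed

lemma tensorial_tor:
  assumes "vf W Z" "p \<in> W"
  shows "tensorial p (\<lambda>X. tor Z X p)"
  by (rule tensorialI)
    (simp_all add: tor_add[OF assms(1) _ _ assms(2)] tor_scale[OF assms(1) _ _ assms(2)]
      tor_cong[OF assms(1) _ assms(2)] hf_vf)

lemma tor_comb_left:
  assumes Z: "vf W Z" "vf W Z1" "vf W Z2" "vf W Z3" and p: "p \<in> W" and f: "sf W f1" "sf W f2" "sf W f3"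
    and eq: "\<And>q. q \<in> W \<Longrightarrow> A q = f1 q *\<^sub>R Z1 q + f2 q *\<^sub>R Z2 q + f3 q *\<^sub>R Z3 q"
  shows "tor A Z p = f1 p *\<^sub>R tor Z1 Z p + f2 p *\<^sub>R tor Z2 Z p + f3 p *\<^sub>R tor Z3 Z p"
proof -
  note s = smooth_vfield_scale[OF f(1) Z(2)] smooth_vfield_scale[OF f(2) Z(3)] smooth_vfield_scale[OF f(3) Z(4)]
  have "tor Z A p = tor Z (\<lambda>q. f1 q *\<^sub>R Z1 q + f2 q *\<^sub>R Z2 q + f3 q *\<^sub>R Z3 q) p"
    by (rule tor_cong[OF Z(1) _ p eq]) (intro smooth_vfield_add s)
  also have "\<dots> = f1 p *\<^sub>R tor Z Z1 p + f2 p *\<^sub>R tor Z Z2 p + f3 p *\<^sub>R tor Z Z3 p"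
    by (simp only: tor_add[OF Z(1) smooth_vfield_add[OF s(1,2)] s(3) p] tor_add[OF Z(1) s(1,2) p]
        tor_scale[OF Z(1) _ f(1) p] tor_scale[OF Z(1) _ f(2) p] tor_scale[OF Z(1) _ f(3) p] Z)
  finally show ?thesis by (simp add: tor_skew[of _ Z] algebra_simps)
qed

lemma tor_tor_HH:
  assumes X: "hf W X" and Y: "hf W Y" and Z: "vf W Z" and p: "p \<in> W" and c: "(i, j, k) \<in> cyc"
  shows "tor (tor X Y) Z p = (- 2 * eps i * g p (J i p (X p)) (Y p)) *\<^sub>R tor (\<xi> i) Z p
    + (- 2 * eps j * g p (J j p (X p)) (Y p)) *\<^sub>R tor (\<xi> j) Z p + (- 2 * eps k * g p (J k p (X p)) (Y p)) *\<^sub>R tor (\<xi> k) Z p"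
proof -
  note i = cyc_in[OF c]
  note x = vf_xiW[OF i(1)] vf_xiW[OF i(2)] vf_xiW[OF i(3)]
  show ?thesis
    by (rule tor_comb_left[OF Z x p _ _ _ tor_HH[OF X Y _ c]])
      (intro smooth_fun_mult smooth_fun_const W sf_g hf_J[OF W(1)] i X Y)+
qed

lemma bianchi_H:
  assumes X: "hf W X" and Y: "hf W Y" and Z: "hf W Z" and p: "p \<in> W"
  shows "cu X Y Z p + cu Y Z X p + cu Z X Y p = tor (tor X Y) Z p + tor (tor Y Z) X p + tor (tor Z X) Y p"
  using bianchi[OF hf_vf[OF X] hf_vf[OF Y] hf_vf[OF Z] p] DT_HH[OF hf_vf[OF X] Y Z p]
    DT_HH[OF hf_vf[OF Y] Z X p] DT_HH[OF hf_vf[OF Z] X Y p] by simp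

section \<open>The mixed torsion is horizontal\<close>

definition \<kappa> :: "nat \<Rightarrow> nat \<Rightarrow> 'a vfield \<Rightarrow> 'a \<Rightarrow> real" where
  "\<kappa> i s Z p = \<eta> i p (tor (\<xi> s) Z p)"

text \<open>The Reeb conditions rewritten by \<open>d_eta\<close>. In the second one the connection
  form \<open>\<alpha> k\<close> occurs on both sides with the same coefficient, as
  \<open>eps k * eps k = 1\<close>, so a pure symmetry of the torsion remains.\<close>

lemma kappa_reeb:
  assumes Z: "hf W Z" and p: "p \<in> W" and c: "(i, j, k) \<in> cyc"
  shows "\<kappa> i i Z p = 0" "\<kappa> i j Z p = eps k * \<kappa> j i Z p"
proof -
  note i = cyc_in[OF c]
  note h = eta_H[OF WU[OF p] _ hf_H[OF Z p]]
  have 1: "ext_d (atlas M) (form1 (\<eta> i)) [\<xi> i, Z] p = \<kappa> i i Z p"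
    unfolding ext_d_form1 d_eta[OF vf_xiW[OF i(1)] hf_vf[OF Z] p c] \<kappa>_def
    using h i cyc_distinct[OF c] by (simp add: eta_xi[OF WU[OF p]])
  have 2: "ext_d (atlas M) (form1 (\<eta> i)) [\<xi> j, Z] p = \<alpha> k p (Z p) + \<kappa> i j Z p"
    unfolding ext_d_form1 d_eta[OF vf_xiW[OF i(2)] hf_vf[OF Z] p c] \<kappa>_def
    using h i cyc_distinct[OF c] by (simp add: eta_xi[OF WU[OF p]])
  have 3: "ext_d (atlas M) (form1 (\<eta> j)) [\<xi> i, Z] p = eps k * \<alpha> k p (Z p) + \<kappa> j i Z p"
    unfolding ext_d_form1 d_eta[OF vf_xiW[OF i(1)] hf_vf[OF Z] p cyc_rotate(1)[OF c]] \<kappa>_def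
    using h i cyc_distinct[OF c] by (simp add: eta_xi[OF WU[OF p]])
  show "\<kappa> i i Z p = 0" using reeb_horizontal(1)[OF W(1) Z p i(1)] 1 by simp
  show "\<kappa> i j Z p = eps k * \<kappa> j i Z p"
    using reeb_horizontal(2)[OF W(1) Z p c] 2 3 by (simp add: algebra_simps)
qed

lemma tensorial_kappa:
  assumes p: "p \<in> W" and i: "i \<in> {1,2,3}" and s: "s \<in> {1,2,3}"
  shows "tensorial p (\<lambda>Z. \<kappa> i s Z p)"
proof -
  have t: "tor (\<xi> s) Z p \<in> T p" if "hf W Z" for Z
    by (rule vf_T[OF vf_tor[OF vf_xiW[OF s] hf_vf[OF that]] p])
  show ?thesis
    unfolding \<kappa>_def
  proof (rule tensorialI)
    show "\<eta> i p (tor (\<xi> s) Y p) = \<eta> i p (tor (\<xi> s) X p)" if "hf W X" "\<And>q. q \<in> W \<Longrightarrow> Y q = X q" for X Y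
      by (simp only: tor_cong[OF vf_xiW[OF s] hf_vf[OF that(1)] p that(2)])
  qed (use WU[OF p] i t in \<open>simp_all add: tor_add[OF vf_xiW[OF s] _ _ p]
        tor_scale[OF vf_xiW[OF s] _ _ p] hf_vf\<close>)
qed

text \<open>On three horizontal fields the curvature side of the Bianchi identity is horizontal, so
  \<open>\<eta> i\<close> annihilates the torsion side too; the terms with
  \<open>\<kappa> i i\<close> are absent by the Reeb condition.\<close>

lemma kappa_bianchi:
  assumes X: "hf W X" and Y: "hf W Y" and Z: "hf W Z" and p: "p \<in> W" and c: "(i, j, k) \<in> cyc"
  shows "eps j * (g p (J j p (X p)) (Y p) * \<kappa> i j Z p + g p (J j p (Y p)) (Z p) * \<kappa> i j X p
      + g p (J j p (Z p)) (X p) * \<kappa> i j Y p)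
    + eps k * (g p (J k p (X p)) (Y p) * \<kappa> i k Z p + g p (J k p (Y p)) (Z p) * \<kappa> i k X p
      + g p (J k p (Z p)) (X p) * \<kappa> i k Y p) = 0"
proof -
  note i = cyc_in[OF c]
  have t: "\<eta> i p (tor (tor X Y) Z p) = - 2 * eps j * g p (J j p (X p)) (Y p) * \<kappa> i j Z p
      - 2 * eps k * g p (J k p (X p)) (Y p) * \<kappa> i k Z p"
    if X: "hf W X" and Y: "hf W Y" and Z: "hf W Z" for X Y Z
  proof -
    have t: "tor (\<xi> s) Z p \<in> T p" if "s \<in> {1,2,3}" for s
      by (rule vf_T[OF vf_tor[OF vf_xiW[OF that] hf_vf[OF Z]] p])
    show ?thesis
      unfolding tor_tor_HH[OF X Y hf_vf[OF Z] p c]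
      using t[OF i(1)] t[OF i(2)] t[OF i(3)] WU[OF p] i kappa_reeb(1)[OF Z p c] by (simp add: \<kappa>_def)
  qed
  have "cu A B C p \<in> H M p" if "hf W A" "hf W B" "hf W C" for A B C
    by (rule cu_H[OF W(1) hf_vf[OF that(1)] hf_vf[OF that(2)] that(3) p])
  then have H: "cu X Y Z p + cu Y Z X p + cu Z X Y p \<in> H M p"
    using X Y Z by (intro H_closed(2))
  have tT: "tor (tor X Y) Z p \<in> T p" if "hf W X" "hf W Y" "hf W Z" for X Y Z
    by (intro vf_T[OF _ p] vf_tor hf_vf that)
  have "0 = \<eta> i p (cu X Y Z p + cu Y Z X p + cu Z X Y p)"
    using eta_H[OF WU[OF p] i(1) H] by simp
  also have "\<dots> = \<eta> i p (tor (tor X Y) Z p) + \<eta> i p (tor (tor Y Z) X p) + \<eta> i p (tor (tor Z X) Y p)"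
    unfolding bianchi_H[OF X Y Z p] using tT X Y Z WU[OF p] i(1) by simp
  finally show ?thesis
    unfolding t[OF X Y Z] t[OF Y Z X] t[OF Z X Y] by (simp add: algebra_simps)
qed

text \<open>On \<open>y\<close>, \<open>J j p y\<close>, \<open>J i p y\<close> only two of the six
  terms of \<open>kappa_bianchi\<close> survive, and the Reeb symmetry turns the result into
  \<open>K k i y = eps i * K i j (J i p y)\<close>. Each use of this relation rotates the indices,
  so three uses return to the starting component at the starting vector, up to a sign.\<close>

lemma kappa_zero_nonnull:
  assumes p: "p \<in> W" and x: "x \<in> H M p" and n: "g p x x \<noteq> 0" and c: "(i, j, k) \<in> cyc" and Z: "hf W Z" "Z p = x"
  shows "\<kappa> i j Z p = 0"
proof -
  define K where "K i s y = \<kappa> i s (fld p y) p" for i s y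
  have K: "\<kappa> i s Z p = K i s (Z p)" if "hf W Z" "i \<in> {1,2,3}" "s \<in> {1,2,3}" for Z i s
    unfolding K_def
    by (rule tensorial_eq[OF tensorial_kappa[OF p that(2,3)] p that(1) hf_fld])
      (simp add: p hf_H[OF that(1) p])
  have Kc: "K i s (a *\<^sub>R y) = a * K i s y" if "i \<in> {1,2,3}" "s \<in> {1,2,3}" "y \<in> H M p" for a y i s
  proof -
    have "\<kappa> i s (\<lambda>q. a *\<^sub>R fld p y q) p = a * K i s y"
      using tensorial_kappa[OF p that(1,2), unfolded tensorial_def, THEN conjunct2, THEN conjunct1, rule_format,
          OF smooth_fun_const[OF W(2)] hf_fld, of a p y] by (simp add: K_def)
    then show ?thesis using K[OF hf_cscale[OF hf_fld] that(1,2), of a p y] p that by simp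
  qed
  have reeb: "K i j y = eps k * K j i y" if "(i, j, k) \<in> cyc" "y \<in> H M p" for i j k y
    using kappa_reeb(2)[OF hf_fld p that(1)] unfolding K_def .
  have step: "K k i y = eps i * K i j (J i p y)"
    if c: "(i, j, k) \<in> cyc" and y: "y \<in> H M p" and n: "g p y y \<noteq> 0" for i j k y
  proof -
    note i = cyc_in[OF c]
    have u: "p \<in> U" using p by (rule WU)
    have y': "J i p y \<in> H M p" "J j p y \<in> H M p" using y i u by auto
    note kb = kappa_bianchi[OF hf_fld[of p y] hf_fld[of p "J j p y"] hf_fld[of p "J i p y"] p c,
        folded K_def]
    have g1: "g p (J j p y) (J j p y) = - eps j * g p y y" by (rule g_JJ[OF u i(2) y y])
    have g2: "g p (J j p (J j p y)) (J i p y) = 0" using g_J_self[OF u i(1) y] y u i y' by simp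
    have g3: "g p (J j p (J i p y)) y = 0"
      using J_cyc[OF u y c] g_J_self[OF u i(3) y] i u y by simp
    have g4: "g p (J k p y) (J j p y) = 0"
      using g_J_cross[OF u i(3,2) _ y] cyc_distinct[OF c] by simp
    have g5: "g p (J k p (J j p y)) (J i p y) = - g p y y"
      using J_cyc(2)[OF u y cyc_rotate(1)[OF c]] g_JJ[OF u i(1) y y] i u y by simp
    have g6: "g p (J k p (J i p y)) y = 0"
      using J_cyc(1)[OF u y cyc_rotate(2)[OF c]] g_J_self[OF u i(2) y] i u y by simp
    have "eps j * (- eps j * g p y y * K i j (J i p y)) + eps k * (- g p y y * K i k y) = 0"
      using kb unfolding fld_at[OF p y] fld_at[OF p y'(1)] fld_at[OF p y'(2)] g1 g2 g3 g4 g5 g6 by simp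
    then have "g p y y * (K i j (J i p y) + eps k * K i k y) = 0"
      by (simp add: algebra_simps)
    then have 1: "K i j (J i p y) = - eps k * K i k y" using n by simp
    have "K k i y = eps j * K i k y" by (rule reeb[OF cyc_rotate(2)[OF c] y])
    then show ?thesis unfolding 1 using cyc_eps[OF c] by (simp add: mult.assoc[symmetric] mult.commute)
  qed
  have u: "p \<in> U" using p by (rule WU)
  have "K k i x = 0" if c: "(i, j, k) \<in> cyc" for i j k
  proof -
    note i = cyc_in[OF c]
    have s1: "K k i x = eps i * K i j (J i p x)" by (rule step[OF c x n])
    have s2: "K i j (J i p x) = eps j * K j k (J j p (J i p x))"
      by (rule step[OF cyc_rotate(1)[OF c]]) (use x u i n in simp_all)
    have "K j k (J k p x) = eps k * K k i (J k p (J k p x))"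
      by (rule step[OF cyc_rotate(2)[OF c]]) (use x u i n in simp_all)
    then have s3: "K j k (J k p x) = K k i x" using x u i by (simp add: Kc)
    have "K j k (J j p (J i p x)) = eps k * K j k (J k p x)"
      unfolding J_cyc(2)[OF u x c] by (rule Kc[OF i(2,3) J_H[OF u i(3) x]])
    \<comment> \<open>Since \<open>eps i * eps j * eps k\<close> is -1, one full turn gives
      \<open>K k i x = - K k i x\<close>.\<close>
    then have "K k i x = (eps i * eps j) * eps k * K k i x"
      using s1 s2 s3 by (simp add: mult.assoc)
    then show ?thesis using cyc_eps[OF c] by simp
  qed
  from this[OF cyc_rotate(1)[OF c]] show ?thesis
    using K[OF Z(1), of i j] cyc_in[OF c] Z(2) by simp
qed

text \<open>Neutral signature has null vectors, to which \<open>kappa_zero_nonnull\<close> does not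
  apply; the frame vectors are non-null, and tensoriality carries the vanishing over to all fields.
  The remaining component is tied to a vanishing one by the Reeb symmetry.\<close>

lemma tor_xi_H:
  assumes Z: "hf W Z" and p: "p \<in> W" and s: "s \<in> {1,2,3}"
  shows "tor (\<xi> s) Z p \<in> H M p"
proof -
  have *: "\<kappa> i j Z p = 0" if c: "(i, j, k) \<in> cyc" for i j k
  proof -
    have "\<kappa> i j (e a) p = 0" if a: "a < N" for a
      by (rule kappa_zero_nonnull[OF p e_H[OF p a] \<sigma>_nz[OF p a] c e[OF a] refl])
    then show ?thesis
      using tensorial_expand[OF tensorial_kappa[OF p] p Z, of i j] cyc_in[OF c] by simp
  qed
  have "\<eta> t p (tor (\<xi> s) Z p) = 0" if t: "t \<in> {1,2,3}" for t
  proof -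
    obtain j k where c: "(t, j, k) \<in> cyc" using cyc_exists[OF t] by (elim exE)
    have "\<kappa> t k Z p = 0"
      using kappa_reeb(2)[OF Z p cyc_rotate(2)[OF c]] *[OF cyc_rotate(2)[OF c]] by simp
    then have "\<kappa> t t Z p = 0" "\<kappa> t j Z p = 0" "\<kappa> t k Z p = 0"
      using kappa_reeb(1)[OF Z p c] *[OF c] by simp_all
    then show ?thesis using s unfolding cyc_UNIV[OF c] \<kappa>_def by auto
  qed
  then show ?thesis
    unfolding H_iff[OF WU[OF p]] using vf_T[OF vf_tor[OF vf_xiW[OF s] hf_vf[OF Z]] p] by simp
qed

lemma hf_tor_xi: "hf W Z \<Longrightarrow> s \<in> {1,2,3} \<Longrightarrow> hf W (tor (\<xi> s) Z)"
  by (rule hfI[OF vf_tor[OF vf_xiW hf_vf]]) (simp_all only: tor_xi_H)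

lemma DT_skew:
  assumes A: "vf W A" and B: "vf W B" and C: "vf W C" and p: "p \<in> W"
  shows "DT A B C p = - DT A C B p"
proof -
  have "D p (A p) (tor B C) = D p (A p) (\<lambda>q. (-1) *\<^sub>R tor C B q)"
    by (rule arg_cong[of _ _ "D p (A p)"], rule ext) (simp add: tor_skew[of B C])
  also have "\<dots> = - D p (A p) (tor C B)"
    using D_cscale[OF vf_tor[OF C B] p vf_T[OF A p], of "-1"] by simp
  finally show ?thesis
    unfolding DT_def by (simp add: tor_skew[of B "\<lambda>q. D q (A q) C"] tor_skew[of "\<lambda>q. D q (A q) B" C])
qed

text \<open>By \<open>D_xi\<close> the derivative of a Reeb field is again a combination of Reeb
  fields, so \<open>tor_xi_H\<close> makes every term of \<open>DT\<close> horizontal.\<close>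

lemma DT_mixed_H:
  assumes A: "vf W A" and X: "hf W X" and p: "p \<in> W" and t: "t \<in> {1,2,3}"
  shows "DT A (\<xi> t) X p \<in> H M p"
proof -
  obtain j k where c: "(t, j, k) \<in> cyc" using cyc_exists[OF t] by (elim exE)
  note i = cyc_in[OF c]
  note x = vf_xiW[OF i(1)] vf_xiW[OF i(2)] vf_xiW[OF i(3)]
  note hx = tor_xi_H[OF X p i(1)] tor_xi_H[OF X p i(2)] tor_xi_H[OF X p i(3)]
  have "tor (\<lambda>q. D q (A q) (\<xi> t)) X p = 0 *\<^sub>R tor (\<xi> t) X p + (eps k * \<alpha> k p (A p)) *\<^sub>R tor (\<xi> j) X p
      + \<alpha> j p (A p) *\<^sub>R tor (\<xi> k) X p"
    by (rule tor_comb_left[OF hf_vf[OF X] x p])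
      (intro smooth_fun_const smooth_fun_mult W sf_alpha i A, intro smooth_fun_const smooth_fun_mult W sf_alpha i A,
       intro sf_alpha i A, simp add: D_xi[OF WU vf_T[OF A] c])
  then have "tor (\<lambda>q. D q (A q) (\<xi> t)) X p \<in> H M p" using hx by simp
  moreover have "D p (A p) (tor (\<xi> t) X) \<in> H M p"
    by (rule D_H[OF W(1) hf_tor_xi[OF X t] p vf_T[OF A p]])
  moreover have "tor (\<xi> t) (\<lambda>q. D q (A q) X) p \<in> H M p"
    by (rule tor_xi_H[OF hf_D[OF W(1) A X] p t])
  ultimately show ?thesis unfolding DT_def by simp
qed

lemma Theta_skew: "p \<in> W \<Longrightarrow> i \<in> {1,2,3} \<Longrightarrow> s \<in> {1,2,3} \<Longrightarrow> t \<in> {1,2,3} \<Longrightarrow> \<Theta> i s t p = - \<Theta> i t s p"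
  unfolding \<Theta>_def tor_skew[of "\<xi> s" "\<xi> t"]
  by (rule eta_simps(5)[OF WU _ vf_T[OF vf_tor[OF vf_xiW vf_xiW]]])

lemma Theta_diag: "p \<in> W \<Longrightarrow> i \<in> {1,2,3} \<Longrightarrow> s \<in> {1,2,3} \<Longrightarrow> \<Theta> i s s p = 0"
  using Theta_skew[of p i s s] by simp

definition \<T> :: "nat \<Rightarrow> 'a vfield \<Rightarrow> 'a vfield \<Rightarrow> 'a \<Rightarrow> real" where
  "\<T> s X Y p = g p (tor (\<xi> s) X p) (Y p)"

text \<open>Now that the mixed torsion is horizontal, the vertical part of the Bianchi identity for
  \<open>X\<close>, \<open>Y\<close>, \<open>\<xi> t\<close> contains no derivative of the torsion
  and only one curvature term: R(X, Y)\<xi>_t becomes algebraic in the torsion.\<close>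

lemma eta_cu_xi:
  assumes X: "hf W X" and Y: "hf W Y" and p: "p \<in> W" and c: "(i, j, k) \<in> cyc" and t: "t \<in> {1,2,3}"
  shows "\<eta> i p (cu X Y (\<xi> t) p) =
    - 2 * (eps i * g p (J i p (X p)) (Y p) * \<Theta> i i t p + eps j * g p (J j p (X p)) (Y p) * \<Theta> i j t p
      + eps k * g p (J k p (X p)) (Y p) * \<Theta> i k t p)
    + 2 * eps i * (\<T> t X (\<lambda>q. J i q (Y q)) p - \<T> t Y (\<lambda>q. J i q (X q)) p)"
proof -
  note i = cyc_in[OF c]
  have u: "p \<in> U" by (rule WU[OF p])
  note x = vf_xiW[OF i(1)] vf_xiW[OF i(2)] vf_xiW[OF i(3)] and xt = vf_xiW[OF t]
  note vX = hf_vf[OF X] and vY = hf_vf[OF Y]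
  have H0: "\<eta> i p z = 0" if "z \<in> H M p" for z by (rule eta_H[OF u i(1) that])
  have tt: "tor A B p \<in> T p" if "vf W A" "vf W B" for A B by (rule vf_T[OF vf_tor[OF that] p])
  have H1: "\<eta> i p (cu Y (\<xi> t) X p) = 0" "\<eta> i p (cu (\<xi> t) X Y p) = 0"
    by (intro H0 cu_H[OF W(1) vY xt X p] cu_H[OF W(1) xt vX Y p])+
  have H2: "DT (\<xi> t) X Y p = 0" by (rule DT_HH[OF xt X Y p])
  have H3: "\<eta> i p (DT Y (\<xi> t) X p) = 0" by (intro H0 DT_mixed_H[OF vY X p t])
  have "DT X Y (\<xi> t) p = - DT X (\<xi> t) Y p" by (rule DT_skew[OF vX vY xt p])
  then have "DT X Y (\<xi> t) p \<in> H M p" using DT_mixed_H[OF vX Y p t] by simp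
  note H4 = this
  have hT: "hf W (tor (\<xi> t) X)" "hf W (tor (\<xi> t) Y)" using hf_tor_xi X Y t by simp_all
  \<comment> \<open>Two dummy terms with coefficient 0 make \<open>tor_comb_left\<close> applicable;
    it moves the sign out of the inner torsion.\<close>
  have "tor (tor Y (\<xi> t)) X p = (-1) *\<^sub>R tor (tor (\<xi> t) Y) X p + 0 *\<^sub>R tor X X p + 0 *\<^sub>R tor X X p"
    by (rule tor_comb_left[OF vX hf_vf[OF hT(2)] vX vX p smooth_fun_const[OF W(2)] smooth_fun_const[OF W(2)]
        smooth_fun_const[OF W(2)]]) (simp add: tor_skew[of Y "\<xi> t"])
  then have 1: "tor (tor Y (\<xi> t)) X p = - tor (tor (\<xi> t) Y) X p" by simp
  have T: "cu X Y (\<xi> t) p \<in> T p" "cu Y (\<xi> t) X p \<in> T p" "cu (\<xi> t) X Y p \<in> T p"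
    by (intro vf_T[OF vf_cu[OF vX vY xt] p] vf_T[OF vf_cu[OF vY xt vX] p] vf_T[OF vf_cu[OF xt vX vY] p])+
  have T2: "DT X Y (\<xi> t) p \<in> T p" "DT Y (\<xi> t) X p \<in> T p"
    using H4 DT_mixed_H[OF vY X p t] H_tangent by auto
  have T3: "tor (tor X Y) (\<xi> t) p \<in> T p" "tor (tor (\<xi> t) Y) X p \<in> T p" "tor (tor (\<xi> t) X) Y p \<in> T p"
    by (intro tt vf_tor vX vY xt)+
  have "\<eta> i p (cu X Y (\<xi> t) p) = \<eta> i p (cu X Y (\<xi> t) p + cu Y (\<xi> t) X p + cu (\<xi> t) X Y p)"
    using H1 T u i(1) by simp
  also have "\<dots> = \<eta> i p (tor (tor X Y) (\<xi> t) p) - \<eta> i p (tor (tor (\<xi> t) Y) X p) + \<eta> i p (tor (tor (\<xi> t) X) Y p)"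
    unfolding bianchi[OF vX vY xt p] H2 1 using T2 T3 u i(1) H3 H0[OF H4] by simp
  also have "\<eta> i p (tor (tor X Y) (\<xi> t) p) = - 2 * eps i * g p (J i p (X p)) (Y p) * \<Theta> i i t p
      + - 2 * eps j * g p (J j p (X p)) (Y p) * \<Theta> i j t p + - 2 * eps k * g p (J k p (X p)) (Y p) * \<Theta> i k t p"
    unfolding tor_tor_HH[OF X Y xt p c] \<Theta>_def using tt[OF x(1) xt] tt[OF x(2) xt] tt[OF x(3) xt] u i(1)
    by simp
  finally show ?thesis
    unfolding eta_tor_HH[OF hT(2) X p i(1)] eta_tor_HH[OF hT(1) Y p i(1)] \<T>_def
      g_J[OF u i(1) hf_H[OF hT(2) p] hf_H[OF X p]] g_J[OF u i(1) hf_H[OF hT(1) p] hf_H[OF Y p]]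
    by (simp add: algebra_simps)
qed

text \<open>Compares \<open>eta_cu_xi\<close> with \<open>cu_xi\<close>. For \<open>\<xi> i\<close>
  the curvature has no component along \<open>\<xi> i\<close>, which leaves a condition on the
  torsion alone; the other two Reeb fields give \<open>P k\<close> and \<open>P j\<close>.\<close>

lemma structure_equations:
  assumes X: "hf W X" and Y: "hf W Y" and p: "p \<in> W" and c: "(i, j, k) \<in> cyc"
  shows "eps i * (\<T> i X (\<lambda>q. J i q (Y q)) p - \<T> i Y (\<lambda>q. J i q (X q)) p)
      = eps j * g p (J j p (X p)) (Y p) * \<Theta> i j i p + eps k * g p (J k p (X p)) (Y p) * \<Theta> i k i p"
    and "P k X Y p = - 2 * (eps i * g p (J i p (X p)) (Y p) * \<Theta> i i j p + eps k * g p (J k p (X p)) (Y p) * \<Theta> i k j p)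
      + 2 * eps i * (\<T> j X (\<lambda>q. J i q (Y q)) p - \<T> j Y (\<lambda>q. J i q (X q)) p)"
    and "eps j * P j X Y p = - 2 * (eps i * g p (J i p (X p)) (Y p) * \<Theta> i i k p + eps j * g p (J j p (X p)) (Y p) * \<Theta> i j k p)
      + 2 * eps i * (\<T> k X (\<lambda>q. J i q (Y q)) p - \<T> k Y (\<lambda>q. J i q (X q)) p)"
proof -
  note i = cyc_in[OF c]
  have u: "p \<in> U" by (rule WU[OF p])
  note vX = hf_vf[OF X] and vY = hf_vf[OF Y]
  note Td = Theta_diag[OF p i(1)]
  have 1: "\<eta> i p (cu X Y (\<xi> i) p) = 0" "\<eta> i p (cu X Y (\<xi> j) p) = P k X Y p"
    "\<eta> i p (cu X Y (\<xi> k) p) = eps j * P j X Y p"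
    unfolding cu_xi[OF vX vY p c] cu_xi[OF vX vY p cyc_rotate(1)[OF c]] cu_xi[OF vX vY p cyc_rotate(2)[OF c]]
    using u i xi_T[OF u] cyc_distinct[OF c] by (simp_all add: eta_xi)
  show "eps i * (\<T> i X (\<lambda>q. J i q (Y q)) p - \<T> i Y (\<lambda>q. J i q (X q)) p)
      = eps j * g p (J j p (X p)) (Y p) * \<Theta> i j i p + eps k * g p (J k p (X p)) (Y p) * \<Theta> i k i p"
    using eta_cu_xi[OF X Y p c i(1)] unfolding 1 Td[OF i(1)] by simp
  show "P k X Y p = - 2 * (eps i * g p (J i p (X p)) (Y p) * \<Theta> i i j p + eps k * g p (J k p (X p)) (Y p) * \<Theta> i k j p)
      + 2 * eps i * (\<T> j X (\<lambda>q. J i q (Y q)) p - \<T> j Y (\<lambda>q. J i q (X q)) p)"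
    using eta_cu_xi[OF X Y p c i(2)] unfolding 1 Td[OF i(2)] by simp
  show "eps j * P j X Y p = - 2 * (eps i * g p (J i p (X p)) (Y p) * \<Theta> i i k p + eps j * g p (J j p (X p)) (Y p) * \<Theta> i j k p)
      + 2 * eps i * (\<T> k X (\<lambda>q. J i q (Y q)) p - \<T> k Y (\<lambda>q. J i q (X q)) p)"
    using eta_cu_xi[OF X Y p c i(3)] unfolding 1 Td[OF i(3)] by simp
qed

end

section \<open>Traces at a point\<close>

text \<open>Tying \<open>e\<close> to the very frame that \<open>SOME\<close> selects at
  \<open>p\<close> makes every \<open>htrace\<close> at \<open>p\<close> a sum over this
  frame.\<close>

locale pqc_point = pqc_frame +
  fixes p :: 'a
  assumes p: "p \<in> W" and e_some: "e = (SOME e. orthonormal_frame M g p e)"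
begin

abbreviation "S a \<equiv> \<sigma> a p"
abbreviation "E a \<equiv> e a p"

lemma pU: "p \<in> U"
  by (rule WU[OF p])

lemmas EH = e_H[OF p]

lemmas JH = J_H[OF pU]

lemma htrace_eq: "htrace M g p F = (\<Sum>a<N. S a * F (e a) (e a))"
  unfolding htrace_def Let_def e_some[symmetric] ..

definition bil :: "('a tvec \<Rightarrow> 'a tvec \<Rightarrow> real) \<Rightarrow> bool" where
  "bil B \<longleftrightarrow> (\<forall>x\<in>H M p. lin_on (H M p) (B x)) \<and> (\<forall>y\<in>H M p. lin_on (H M p) (\<lambda>x. B x y))"

definition tr :: "('a tvec \<Rightarrow> 'a tvec \<Rightarrow> real) \<Rightarrow> real" where
  "tr B = (\<Sum>a<N. S a * B (E a) (E a))"

lemma bilI: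
  assumes "\<And>x y z a b. x \<in> H M p \<Longrightarrow> y \<in> H M p \<Longrightarrow> z \<in> H M p \<Longrightarrow>
      B x (a *\<^sub>R y + b *\<^sub>R z) = a * B x y + b * B x z"
    and "\<And>x y z a b. x \<in> H M p \<Longrightarrow> y \<in> H M p \<Longrightarrow> z \<in> H M p \<Longrightarrow>
      B (a *\<^sub>R y + b *\<^sub>R z) x = a * B y x + b * B z x"
  shows "bil B"
  unfolding bil_def lin_on_def using assms by simp

lemma bil_right:
  assumes "bil B" "x \<in> H M p" "y \<in> H M p"
  shows "z \<in> H M p \<Longrightarrow> B x (y + z) = B x y + B x z" "B x (c *\<^sub>R y) = c * B x y" "B x (- y) = - B x y"
  using lin_on_add[of "H M p" "B x"] lin_on_scaleR[of "H M p" "B x"] lin_on_scaleR[of "H M p" "B x" y "-1"] assms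
  by (simp_all add: bil_def)

lemma bil_left:
  assumes "bil B" "x \<in> H M p" "y \<in> H M p"
  shows "z \<in> H M p \<Longrightarrow> B (y + z) x = B y x + B z x" "B (c *\<^sub>R y) x = c * B y x" "B (- y) x = - B y x"
  using lin_on_add[of "H M p" "\<lambda>y. B y x"] lin_on_scaleR[of "H M p" "\<lambda>y. B y x"]
    lin_on_scaleR[of "H M p" "\<lambda>y. B y x" y "-1"] assms
  by (simp_all add: bil_def)

lemma bil_JJ: "bil B \<Longrightarrow> s \<in> {1,2,3} \<Longrightarrow> bil (\<lambda>x y. B (J s p x) y)" "bil B \<Longrightarrow> s \<in> {1,2,3} \<Longrightarrow> bil (\<lambda>x y. B x (J s p y))"
  by (rule bilI; simp add: pU bil_left bil_right)+

lemma lin_expand: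
  assumes f: "lin_on (H M p) f" and x: "x \<in> H M p"
  shows "(\<Sum>a<N. S a * (g p x (E a) * f (E a))) = (f x :: real)"
proof -
  have "f x = f (\<Sum>a<N. (S a * g p x (E a)) *\<^sub>R E a)" by (simp only: frame_sum[OF p x])
  also have "\<dots> = (\<Sum>a<N. (S a * g p x (E a)) *\<^sub>R f (E a))"
    by (rule lin_on_sum[OF f H_subspace]) (simp add: EH)
  finally show ?thesis by (simp add: mult.assoc)
qed

text \<open>Trace version of the skewness of \<open>J s\<close>: expand \<open>J s p (E a)\<close>
  in the frame, exchange the two sums, and apply \<open>g_J\<close> to the coefficients.\<close>

lemma tr_adj:
  assumes B: "bil B" and s: "s \<in> {1,2,3}"
  shows "tr (\<lambda>x y. B (J s p x) y) = - tr (\<lambda>x y. B x (J s p y))"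
proof -
  have l: "lin_on (H M p) (\<lambda>x. B x y)" "lin_on (H M p) (B y)" if "y \<in> H M p" for y
    using B that by (simp_all add: bil_def)
  have "tr (\<lambda>x y. B (J s p x) y) = (\<Sum>a<N. S a * (\<Sum>b<N. S b * (g p (J s p (E a)) (E b) * B (E b) (E a))))"
    unfolding tr_def
    by (intro sum.cong refl arg_cong2[of _ _ _ _ "(*)"] lin_expand[OF l(1), symmetric]) (simp_all add: EH JH[OF s])
  also have "\<dots> = (\<Sum>b<N. \<Sum>a<N. S a * (S b * (g p (J s p (E a)) (E b) * B (E b) (E a))))"
    unfolding sum_distrib_left by (rule sum.swap)
  also have "\<dots> = (\<Sum>b<N. \<Sum>a<N. - (S b * (S a * (g p (J s p (E b)) (E a) * B (E b) (E a)))))"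
  proof (intro sum.cong refl)
    fix a b assume "b \<in> {..<N}" "a \<in> {..<N}"
    then have ab: "E a \<in> H M p" "E b \<in> H M p" using EH by simp_all
    have "g p (J s p (E a)) (E b) = - g p (J s p (E b)) (E a)"
      using g_J[OF pU s ab] g_sym[OF ab(1) JH[OF s ab(2)]] by simp
    then show "S a * (S b * (g p (J s p (E a)) (E b) * B (E b) (E a)))
        = - (S b * (S a * (g p (J s p (E b)) (E a) * B (E b) (E a))))" by simp
  qed
  also have "\<dots> = - (\<Sum>b<N. S b * (\<Sum>a<N. S a * (g p (J s p (E b)) (E a) * B (E b) (E a))))"
    by (simp add: sum_negf sum_distrib_left)
  also have "(\<Sum>b<N. S b * (\<Sum>a<N. S a * (g p (J s p (E b)) (E a) * B (E b) (E a))))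
      = tr (\<lambda>x y. B x (J s p y))"
    unfolding tr_def
    by (intro sum.cong refl arg_cong2[of _ _ _ _ "(*)"] lin_expand[OF l(2)]) (simp_all add: EH JH[OF s])
  finally show ?thesis .
qed

lemma tr_cong: "(\<And>x. x \<in> H M p \<Longrightarrow> B x x = B' x x) \<Longrightarrow> tr B = tr B'"
  unfolding tr_def by (rule sum.cong[OF refl]) (simp add: EH)

lemma tr_cmult: "tr (\<lambda>x y. c * B x y) = c * tr B"
  by (simp add: tr_def sum_distrib_left mult.left_commute)

lemma tr_add: "tr (\<lambda>x y. B x y + B' x y) = tr B + tr B'"
  by (simp add: tr_def sum.distrib algebra_simps)

lemma tr_diff: "tr (\<lambda>x y. B x y - B' x y) = tr B - tr B'"
  by (simp add: tr_def sum_subtractf algebra_simps)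

lemma tr_minus: "tr (\<lambda>x y. - B x y) = - tr B"
  by (simp add: tr_def sum_negf)

lemma tr_gJJ:
  assumes "s \<in> {1,2,3}" "t \<in> {1,2,3}"
  shows "tr (\<lambda>x y. g p (J s p x) (J t p y)) = (if s = t then - eps s * N else 0)"
proof (cases "s = t")
  case True
  have "S a * g p (J s p (E a)) (J s p (E a)) = - eps s" if "a < N" for a
    using \<sigma>_sq[OF p that] g_JJ[OF pU assms(1) EH[OF that] EH[OF that]] by (simp add: mult.left_commute)
  then show ?thesis using True by (simp add: tr_def)
next
  case False
  then show ?thesis
    using g_J_cross[OF pU assms False EH] by (simp add: tr_def)
qed

section \<open>The torsion endomorphisms\<close>

definition t :: "nat \<Rightarrow> 'a tvec \<Rightarrow> 'a tvec \<Rightarrow> real" where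
  "t s x y = g p (tor (\<xi> s) (fld p x) p) y"

lemma tensorial_point:
  "tensorial p F \<Longrightarrow> hf W X \<Longrightarrow> F X = F (fld p (X p))"
  by (rule tensorial_eq[OF _ p _ hf_fld]) (simp_all add: p hf_H)

lemma T_t:
  assumes "hf W X" "s \<in> {1,2,3}"
  shows "\<T> s X Y p = t s (X p) (Y p)"
  unfolding \<T>_def t_def
  using tensorial_point[OF tensorial_tor[OF vf_xiW[OF assms(2)] p] assms(1)] by simp

lemma tensorial_lin:
  assumes F: "tensorial p F"
  shows "lin_on (H M p) (\<lambda>x. F (fld p x))"
  unfolding lin_on_def
proof (intro ballI allI)
  note F' = F[unfolded tensorial_def]
  note F1 = F'[THEN conjunct1, rule_format] and F2 = F'[THEN conjunct2, THEN conjunct1, rule_format]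
  fix x y and a b :: real assume xy: "x \<in> H M p" "y \<in> H M p"
  have h: "hf W (\<lambda>q. a *\<^sub>R fld p x q)" "hf W (\<lambda>q. b *\<^sub>R fld p y q)"
    by (intro hf_cscale hf_fld)+
  have "F (fld p (a *\<^sub>R x + b *\<^sub>R y)) = F (\<lambda>q. a *\<^sub>R fld p x q + b *\<^sub>R fld p y q)"
    by (rule tensorial_eq[OF F p hf_fld hf_add[OF h]]) (simp add: p xy)
  also have "\<dots> = a *\<^sub>R F (fld p x) + b *\<^sub>R F (fld p y)"
    unfolding F1[OF h] by (simp only: F2[OF smooth_fun_const[OF W(2)] hf_fld])
  finally show "F (fld p (a *\<^sub>R x + b *\<^sub>R y)) = a *\<^sub>R F (fld p x) + b *\<^sub>R F (fld p y)" .
qed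

lemma bil_t: "s \<in> {1,2,3} \<Longrightarrow> bil (t s)"
  unfolding t_def
  by (rule bilI)
    (simp_all add: tor_xi_H[OF hf_fld p] lin_on_def[THEN iffD1, rule_format, OF tensorial_lin[OF tensorial_tor[OF vf_xiW p]]])

lemmas t_right = bil_right[OF bil_t]
lemmas t_left = bil_left[OF bil_t]

lemma torsion_perp:
  assumes s: "s \<in> {1,2,3}" and EF: "F \<in> sp_n M g L p" "F' \<in> sp_1 M L p"
    and H: "\<And>x. x \<in> H M p \<Longrightarrow> F x \<in> H M p" "\<And>x. x \<in> H M p \<Longrightarrow> F' x \<in> H M p"
  shows "tr (\<lambda>x y. t s x (F y + F' y)) = 0"
proof -
  have V: "vfield_in_V M L W (\<xi> s)"
    unfolding vfield_in_V_def using vf_xiW[OF s] xi_vert[OF s] by simp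
  have "htrace M g p (\<lambda>X Y. g p (hproj L p (torsion (atlas M) D (\<xi> s) X p)) (F (Y p) + F' (Y p))) = 0"
    by (rule D_torsion[unfolded torsion_conditions_def, THEN conjunct2, THEN spec, THEN spec, THEN mp,
          THEN bspec, THEN bspec, THEN bspec, of W]) (simp_all add: W V p EF)
  moreover have "h p (tor (\<xi> s) (e a) p) = tor (\<xi> s) (e a) p"
    and "g p (tor (\<xi> s) (e a) p) y = t s (E a) y" if "a < N" for a y
    using T_t[OF e[OF that] s, of "\<lambda>_. y"] tor_xi_H[OF e[OF that] p s] pU by (simp_all add: \<T>_def)
  ultimately show ?thesis by (simp add: htrace_eq tr_def)
qed

lemma zero_sp_n: "(\<lambda>x. 0) \<in> sp_n M g L p"
  unfolding sp_n_def by (auto simp: h_endo_def lin_on_def pU simp del: One_nat_def)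

lemma zero_sp_1: "(\<lambda>x. 0) \<in> sp_1 M L p"
  unfolding sp_1_def by (auto intro!: exI[of _ "\<lambda>_. 0"])

lemma J_sp_1: "s \<in> {1,2,3} \<Longrightarrow> J s p \<in> sp_1 M L p"
  unfolding sp_1_def by (auto intro!: exI[of _ "\<lambda>r. if r = s then 1 else 0"])

lemma tr_t_J [simp]:
  assumes "s \<in> {1,2,3}" "r \<in> {1,2,3}"
  shows "tr (\<lambda>x y. t s x (J r p y)) = 0"
  using torsion_perp[OF assms(1) zero_sp_n J_sp_1[OF assms(2)]] assms(2) JH by simp

text \<open>The rank-two endomorphism \<open>x \<wedge> y\<close>, averaged over conjugation by \<open>id, I\<^sub>1, I\<^sub>2, I\<^sub>3\<close>.\<close>

definition avg :: "'a tvec \<Rightarrow> 'a tvec \<Rightarrow> 'a tvec \<Rightarrow> 'a tvec" where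
  "avg x y z = g p x z *\<^sub>R y - g p y z *\<^sub>R x
    - (g p (J 1 p x) z *\<^sub>R J 1 p y - g p (J 1 p y) z *\<^sub>R J 1 p x)
    - (g p (J 2 p x) z *\<^sub>R J 2 p y - g p (J 2 p y) z *\<^sub>R J 2 p x)
    + (g p (J 3 p x) z *\<^sub>R J 3 p y - g p (J 3 p y) z *\<^sub>R J 3 p x)"

text \<open>Conjugating the rank-two map by \<open>J s\<close> gives \<open>- eps s\<close> times
  the same expression in \<open>J s p x\<close> and \<open>J s p y\<close>, whence the signs in
  \<open>avg\<close>. Conjugation by one more \<open>J s\<close> only permutes the four summands, so
  the sum commutes with it; each summand is skew.\<close>

lemma avg_sp_n:
  assumes x: "x \<in> H M p" and y: "y \<in> H M p"
  shows "avg x y \<in> sp_n M g L p" "z \<in> H M p \<Longrightarrow> avg x y z \<in> H M p"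
proof -
  have H: "avg x y z \<in> H M p" if "z \<in> H M p" for z
    unfolding avg_def using x y pU by (simp del: One_nat_def)
  then show "z \<in> H M p \<Longrightarrow> avg x y z \<in> H M p" .
  have J3: "J 1 p x \<in> H M p" "J 2 p x \<in> H M p" "J 3 p x \<in> H M p"
    "J 1 p y \<in> H M p" "J 2 p y \<in> H M p" "J 3 p y \<in> H M p"
    using x y pU by simp_all
  have lin: "lin_on (H M p) (avg x y)"
    unfolding lin_on_def avg_def using x y J3 by (simp add: algebra_simps del: One_nat_def)
  have skew: "g p (avg x y z) w = - g p z (avg x y w)" if zw: "z \<in> H M p" "w \<in> H M p" for z w
    unfolding avg_def using x y J3 zw
    by (simp add: g_sym[OF zw(1) x] g_sym[OF zw(1) y] g_sym[OF zw(1) J3(1)] g_sym[OF zw(1) J3(2)]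
        g_sym[OF zw(1) J3(3)] g_sym[OF zw(1) J3(4)] g_sym[OF zw(1) J3(5)] g_sym[OF zw(1) J3(6)]
        algebra_simps del: One_nat_def)
  have comm: "avg x y (J s p z) = J s p (avg x y z)" if "z \<in> H M p" "s \<in> {1,2,3}" for z s
  proof -
    have gJ: "g p u (J r p z) = - g p (J r p u) z" if "u \<in> H M p" "r \<in> {1,2,3}" for u r
      using g_J[OF pU that(2,1) \<open>z \<in> H M p\<close>] by simp
    have "s = 1 \<or> s = 2 \<or> s = 3" using that(2) by simp
    then show ?thesis
      unfolding avg_def using x y J3 that(1) pU
      by (elim disjE) (simp_all add: gJ J_table[OF pU] algebra_simps del: One_nat_def)
  qed
  show "avg x y \<in> sp_n M g L p"
    unfolding sp_n_def h_endo_def using lin H skew comm by blast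
qed

lemma tr_t_rank_one:
  assumes "s \<in> {1,2,3}" "u \<in> H M p" "v \<in> H M p"
  shows "tr (\<lambda>x y. g p u y * t s x v) = t s u v"
proof -
  have "lin_on (H M p) (\<lambda>x. t s x v)" using bil_t[OF assms(1)] assms by (simp add: bil_def)
  from lin_expand[OF this assms(2)] show ?thesis by (simp add: tr_def)
qed

text \<open>The trace against a rank-two endomorphism evaluates \<open>t s\<close> at its two
  vectors, so orthogonality to sp(n, R) becomes a pointwise identity: the conjugation average of the
  skew part vanishes.\<close>

lemma t_perp_sp_n:
  assumes s: "s \<in> {1,2,3}" and x: "x \<in> H M p" and y: "y \<in> H M p"
  shows "t s x y - t s y x - (t s (J 1 p x) (J 1 p y) - t s (J 1 p y) (J 1 p x))
    - (t s (J 2 p x) (J 2 p y) - t s (J 2 p y) (J 2 p x))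
    + (t s (J 3 p x) (J 3 p y) - t s (J 3 p y) (J 3 p x)) = 0"
proof -
  have J3: "J 1 p x \<in> H M p" "J 2 p x \<in> H M p" "J 3 p x \<in> H M p"
    "J 1 p y \<in> H M p" "J 2 p y \<in> H M p" "J 3 p y \<in> H M p"
    using x y pU by simp_all
  have bd: "t s z (v - w) = t s z v - t s z w" if "z \<in> H M p" "v \<in> H M p" "w \<in> H M p" for z v w
    using t_right(1)[OF s that(1,2), of "- w"] t_right(3)[OF s that(1,3)] that by simp
  have "0 = tr (\<lambda>z w. t s z (avg x y w + 0))"
    by (rule torsion_perp[OF s avg_sp_n(1)[OF x y] zero_sp_1 avg_sp_n(2)[OF x y], symmetric]) simp_all
  also have "\<dots> = tr (\<lambda>z w. g p x w * t s z y - g p y w * t s z x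
    - (g p (J 1 p x) w * t s z (J 1 p y) - g p (J 1 p y) w * t s z (J 1 p x))
    - (g p (J 2 p x) w * t s z (J 2 p y) - g p (J 2 p y) w * t s z (J 2 p x))
    + (g p (J 3 p x) w * t s z (J 3 p y) - g p (J 3 p y) w * t s z (J 3 p x)))"
    by (rule tr_cong) (use x y J3 in \<open>simp add: avg_def bd t_right[OF s] del: One_nat_def\<close>)
  finally show ?thesis
    by (simp only: tr_add tr_diff tr_t_rank_one[OF s] x y J3)
qed

section \<open>The function \<open>\<lambda>\<close>\<close>

definition PP :: "nat \<Rightarrow> 'a tvec \<Rightarrow> 'a tvec \<Rightarrow> real" where
  "PP s x y = P s (fld p x) (fld p y) p"

lemma T_fld:
  assumes "s \<in> {1,2,3}" "i \<in> {1,2,3}" "x \<in> H M p" "y \<in> H M p"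
  shows "\<T> s (fld p x) (\<lambda>q. J i q (fld p y q)) p = t s x (J i p y)"
  using T_t[OF hf_fld assms(1)] assms p by simp

lemma structure_point:
  assumes c: "(i, j, k) \<in> cyc" and x: "x \<in> H M p" and y: "y \<in> H M p"
  shows "eps i * (t i x (J i p y) - t i y (J i p x))
      = eps j * g p (J j p x) y * \<Theta> i j i p + eps k * g p (J k p x) y * \<Theta> i k i p"
    and "PP k x y = - 2 * (eps i * g p (J i p x) y * \<Theta> i i j p + eps k * g p (J k p x) y * \<Theta> i k j p)
      + 2 * eps i * (t j x (J i p y) - t j y (J i p x))"
    and "eps j * PP j x y = - 2 * (eps i * g p (J i p x) y * \<Theta> i i k p + eps j * g p (J j p x) y * \<Theta> i j k p)
      + 2 * eps i * (t k x (J i p y) - t k y (J i p x))"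
proof -
  note i = cyc_in[OF c]
  note s = structure_equations[OF hf_fld[of p x] hf_fld[of p y] p c, unfolded T_fld[OF i(1) i(1) x y]
      T_fld[OF i(1) i(1) y x] T_fld[OF i(2) i(1) x y] T_fld[OF i(2) i(1) y x]
      T_fld[OF i(3) i(1) x y] T_fld[OF i(3) i(1) y x] fld_at[OF p x] fld_at[OF p y], folded PP_def]
  show "eps i * (t i x (J i p y) - t i y (J i p x))
      = eps j * g p (J j p x) y * \<Theta> i j i p + eps k * g p (J k p x) y * \<Theta> i k i p"
    by (rule s(1))
  show "PP k x y = - 2 * (eps i * g p (J i p x) y * \<Theta> i i j p + eps k * g p (J k p x) y * \<Theta> i k j p)
      + 2 * eps i * (t j x (J i p y) - t j y (J i p x))"
    by (rule s(2))
  show "eps j * PP j x y = - 2 * (eps i * g p (J i p x) y * \<Theta> i i k p + eps j * g p (J j p x) y * \<Theta> i j k p)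
      + 2 * eps i * (t k x (J i p y) - t k y (J i p x))"
    by (rule s(3))
qed

text \<open>A product of two different I_s is a multiple of the third, so orthogonality to sp(1, R)
  still applies; \<open>tr_adj\<close> carries one factor to the other slot.\<close>

lemma tr_t_JJ:
  assumes c: "(i, j, k) \<in> cyc" and s: "s \<in> {1,2,3}"
  shows "tr (\<lambda>x y. t s x (J i p (J j p y))) = 0" "tr (\<lambda>x y. t s x (J j p (J i p y))) = 0"
    "tr (\<lambda>x y. t s (J j p x) (J i p y)) = 0" "tr (\<lambda>x y. t s (J i p x) (J j p y)) = 0"
proof -
  note i = cyc_in[OF c]
  note JHi = JH[OF i(1)] JH[OF i(2)] JH[OF i(3)]
  have "tr (\<lambda>x y. t s x (J i p (J j p y))) = tr (\<lambda>x y. (- eps k) * t s x (J k p y))"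
    by (rule tr_cong) (simp add: J_cyc[OF pU _ c] t_right[OF s] JHi)
  then show 1: "tr (\<lambda>x y. t s x (J i p (J j p y))) = 0" unfolding tr_cmult using s i by simp
  have "tr (\<lambda>x y. t s x (J j p (J i p y))) = tr (\<lambda>x y. eps k * t s x (J k p y))"
    by (rule tr_cong) (simp add: J_cyc[OF pU _ c] t_right[OF s] JHi)
  then show 2: "tr (\<lambda>x y. t s x (J j p (J i p y))) = 0" unfolding tr_cmult using s i by simp
  show "tr (\<lambda>x y. t s (J j p x) (J i p y)) = 0"
    unfolding tr_adj[OF bil_JJ(2)[OF bil_t[OF s] i(1)] i(2)] 1 by simp
  show "tr (\<lambda>x y. t s (J i p x) (J j p y)) = 0"
    unfolding tr_adj[OF bil_JJ(2)[OF bil_t[OF s] i(2)] i(1)] 2 by simp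
qed

lemma tr_swap: "tr (\<lambda>x y. B y x) = tr B"
  by (simp add: tr_def)

lemma N_nz: "real N \<noteq> 0"
  using N_pos by simp

text \<open>With the second argument rotated by \<open>J j\<close> or \<open>J k\<close> and a trace
  taken, the torsion drops out of the first structure equation, and orthogonality of the I_s leaves
  exactly one of the two unknown components.\<close>

lemma Theta_zero:
  assumes c: "(i, j, k) \<in> cyc"
  shows "\<Theta> i j i p = 0" "\<Theta> i k i p = 0"
proof -
  note i = cyc_in[OF c]
  note ne = cyc_distinct[OF c]
  have *: "tr (\<lambda>x y. eps i * (t i x (J i p (J r p y)) - t i (J r p y) (J i p x)))
    = eps j * \<Theta> i j i p * tr (\<lambda>x y. g p (J j p x) (J r p y)) + eps k * \<Theta> i k i p * tr (\<lambda>x y. g p (J k p x) (J r p y))"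
    if r: "r \<in> {1,2,3}" for r
    unfolding tr_cmult[symmetric] tr_add[symmetric]
    by (rule tr_cong, subst structure_point(1)[OF c]) (simp_all add: JH[OF r])
  have "tr (\<lambda>x y. t i (J j p y) (J i p x)) = 0" "tr (\<lambda>x y. t i (J k p y) (J i p x)) = 0"
    using tr_swap[of "\<lambda>x y. t i (J j p x) (J i p y)"] tr_swap[of "\<lambda>x y. t i (J k p x) (J i p y)"]
      tr_t_JJ(3)[OF c i(1)] tr_t_JJ(4)[OF cyc_rotate(2)[OF c] i(1)] by simp_all
  then have 0: "tr (\<lambda>x y. eps i * (t i x (J i p (J j p y)) - t i (J j p y) (J i p x))) = 0"
    "tr (\<lambda>x y. eps i * (t i x (J i p (J k p y)) - t i (J k p y) (J i p x))) = 0"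
    unfolding tr_cmult tr_diff using tr_t_JJ(1)[OF c i(1)] tr_t_JJ(2)[OF cyc_rotate(2)[OF c] i(1)] by simp_all
  show "\<Theta> i j i p = 0" using *[OF i(2)] unfolding 0 tr_gJJ[OF i(2,2)] tr_gJJ[OF i(3,2)] using ne N_nz by simp
  show "\<Theta> i k i p = 0" using *[OF i(3)] unfolding 0 tr_gJJ[OF i(2,3)] tr_gJJ[OF i(3,3)] using ne N_nz by simp
qed

lemma Theta_zero':
  assumes c: "(i, j, k) \<in> cyc"
  shows "\<Theta> i i j p = 0" "\<Theta> i i k p = 0"
  using Theta_zero[OF c] Theta_skew[OF p, of i i j] Theta_skew[OF p, of i i k] cyc_in[OF c] by simp_all

text \<open>The last index of one cyclic triple is the middle index of the next, so every
  \<open>PP s\<close> gets two expressions here. Their agreement is exploited in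
  \<open>Theta_Lambda\<close> and in \<open>Q_skew\<close>.\<close>

lemma PP_eq:
  assumes c: "(i, j, k) \<in> cyc" and x: "x \<in> H M p" and y: "y \<in> H M p"
  shows "PP k x y = 2 * eps k * \<Theta> i j k p * g p (J k p x) y + 2 * eps i * (t j x (J i p y) - t j y (J i p x))"
    and "PP j x y = - 2 * \<Theta> i j k p * g p (J j p x) y - 2 * eps k * (t k x (J i p y) - t k y (J i p x))"
proof -
  note i = cyc_in[OF c]
  show "PP k x y = 2 * eps k * \<Theta> i j k p * g p (J k p x) y + 2 * eps i * (t j x (J i p y) - t j y (J i p x))"
    unfolding structure_point(2)[OF c x y] Theta_zero'[OF c] Theta_skew[OF p i(1,3,2)] by simp
  have "eps j * (eps j * PP j x y) = eps j * (- 2 * (eps j * g p (J j p x) y * \<Theta> i j k p)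
      + 2 * eps i * (t k x (J i p y) - t k y (J i p x)))"
    unfolding structure_point(3)[OF c x y] Theta_zero'[OF c] by simp
  also have "\<dots> = - 2 * (eps j * eps j) * \<Theta> i j k p * g p (J j p x) y
      + 2 * (eps i * eps j) * (t k x (J i p y) - t k y (J i p x))"
    by (simp only: algebra_simps)
  finally show "PP j x y = - 2 * \<Theta> i j k p * g p (J j p x) y - 2 * eps k * (t k x (J i p y) - t k y (J i p x))"
    using cyc_eps[OF c] by simp
qed

lemma tr_PP:
  assumes c: "(i, j, k) \<in> cyc"
  shows "tr (\<lambda>x y. PP k x (J k p y)) = - 2 * real N * \<Theta> i j k p"
    and "tr (\<lambda>x y. PP j x (J j p y)) = 2 * eps j * real N * \<Theta> i j k p"
proof -
  note i = cyc_in[OF c]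
  note JHi = JH[OF i(1)] JH[OF i(2)] JH[OF i(3)]
  have s: "tr (\<lambda>x y. t j (J k p y) (J i p x)) = 0" "tr (\<lambda>x y. t k (J j p y) (J i p x)) = 0"
    using tr_swap[of "\<lambda>x y. t j (J k p x) (J i p y)"] tr_swap[of "\<lambda>x y. t k (J j p x) (J i p y)"]
      tr_t_JJ(4)[OF cyc_rotate(2)[OF c] i(2)] tr_t_JJ(3)[OF c i(3)] by simp_all
  have "tr (\<lambda>x y. PP k x (J k p y)) = tr (\<lambda>x y. 2 * eps k * \<Theta> i j k p * g p (J k p x) (J k p y)
      + 2 * eps i * (t j x (J i p (J k p y)) - t j (J k p y) (J i p x)))"
    by (rule tr_cong) (rule PP_eq(1)[OF c]; simp add: JHi)
  then show "tr (\<lambda>x y. PP k x (J k p y)) = - 2 * real N * \<Theta> i j k p"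
    unfolding tr_add tr_cmult tr_diff s tr_gJJ[OF i(3,3)] tr_t_JJ(2)[OF cyc_rotate(2)[OF c] i(2)] by simp
  have "tr (\<lambda>x y. PP j x (J j p y)) = tr (\<lambda>x y. - 2 * \<Theta> i j k p * g p (J j p x) (J j p y)
      - 2 * eps k * (t k x (J i p (J j p y)) - t k (J j p y) (J i p x)))"
    by (rule tr_cong) (rule PP_eq(2)[OF c]; simp add: JHi)
  then show "tr (\<lambda>x y. PP j x (J j p y)) = 2 * eps j * real N * \<Theta> i j k p"
    unfolding tr_add tr_cmult tr_diff s tr_gJJ[OF i(2,2)] tr_t_JJ(1)[OF c i(3)] by simp
qed

text \<open>The two formulas of \<open>tr_PP\<close>, for the triples (i, j, k) and (j, k, i),
  compute the same trace of \<open>PP k\<close>; equating them ties the three components together up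
  to sign.\<close>

lemma Theta_Lambda:
  assumes c: "(i, j, k) \<in> cyc" shows "\<Theta> i j k p = eps i * \<Lambda> p"
proof -
  have *: "eps k * \<Theta> j k i p = - \<Theta> i j k p" if c: "(i, j, k) \<in> cyc" for i j k
  proof -
    have "- 2 * real N * \<Theta> i j k p = 2 * eps k * real N * \<Theta> j k i p"
      by (rule trans[OF tr_PP(1)[OF c, symmetric] tr_PP(2)[OF cyc_rotate(1)[OF c]]])
    moreover have "n * (a * b + d) = 0" if "- 2 * n * d = 2 * a * n * b" for n a b d :: real
      using that by (simp add: algebra_simps)
    ultimately have "real N * (eps k * \<Theta> j k i p + \<Theta> i j k p) = 0" by blast
    then have "eps k * \<Theta> j k i p + \<Theta> i j k p = 0" using N_nz by (simp only: mult_eq_0_iff) simp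
    then show ?thesis by simp
  qed
  have "(1, 2, 3) \<in> cyc" "(2, 3, 1) \<in> cyc" by (simp_all add: cyc_def)
  note h = *[OF this(1)] *[OF this(2)]
  show ?thesis
    unfolding \<Lambda>_def by (rule cyc_cases[OF c]) (use h in simp_all)
qed

lemma tensorial_cu:
  assumes "vf W A" "vf W B"
  shows "tensorial p (\<lambda>X. cu A B X p)"
  by (rule tensorialI)
    (simp_all add: cu_add[OF assms _ _ p] cu_scale[OF assms _ _ p] cu_cong[OF assms _ p] hf_vf)

lemma rho_tr:
  assumes A: "vf W A" and B: "vf W B" and j: "j \<in> {1,2,3}"
  shows "tr (\<lambda>x y. g p (cu A B (fld p x) p) (J j p y)) = N * rho M g L D j [A, B] p"
proof -
  have cH: "cu A B X p \<in> H M p" if "hf W X" for X by (rule cu_H[OF W(1) A B that p])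
  have "rho M g L D j [A, B] p = tr (\<lambda>x y. g p (cu A B (fld p x) p) (J j p y)) / N"
    unfolding rho_def htrace_eq tr_def
  proof (intro arg_cong2[of _ _ _ _ "(/)"] sum.cong refl)
    fix a assume "a \<in> {..<N}"
    then have a: "a < N" by simp
    have "cu A B (e a) p = cu A B (fld p (E a)) p"
      by (rule tensorial_point[OF tensorial_cu[OF A B] e[OF a]])
    then show "S a * R4 M g L D ([A, B] ! 0) ([A, B] ! 1) (e a) (Ifield L j (e a)) p
        = S a * g p (cu A B (fld p (E a)) p) (J j p (E a))"
      using gext_H[OF pU cH[OF e[OF a]] JH[OF j EH[OF a]]] by (simp add: R4_def Ifield_def)
  qed simp
  then show ?thesis using N_nz by simp
qed

text \<open>The commutator relation \<open>cu_J\<close> is paired with \<open>J k\<close> and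
  traced. Orthogonality of the I_s singles out \<open>P j\<close>, and both products of
  \<open>J i\<close> and \<open>J k\<close> are multiples of \<open>J j\<close>, so each curvature
  trace is a multiple of \<rho>_j; the two contributions add up to the factor 2.\<close>

lemma rho_PP:
  assumes A: "vf W A" and B: "vf W B" and c: "(i, j, k) \<in> cyc"
  shows "P j A B p = 2 * eps i * rho M g L D j [A, B] p"
proof -
  note i = cyc_in[OF c]
  note JHi = JH[OF i(1)] JH[OF i(2)] JH[OF i(3)]
  note ten = tensorial_cu[OF A B]
  define r where "r x y = g p (cu A B (fld p x) p) y" for x y
  have cH: "cu A B X p \<in> H M p" if "hf W X" for X by (rule cu_H[OF W(1) A B that p])
  have bil_r: "bil r"
    unfolding r_def by (rule bilI) (simp_all add: cH hf_fld lin_on_def[THEN iffD1, rule_format, OF tensorial_lin[OF ten]])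
  have rj: "tr (\<lambda>x y. r x (J j p y)) = N * rho M g L D j [A, B] p"
    unfolding r_def by (rule rho_tr[OF A B i(2)])
  have rJ: "r (J i p x) y = - r x (J i p y) + P j A B p * g p (J k p x) y + eps k * P k A B p * g p (J j p x) y"
    if xy: "x \<in> H M p" "y \<in> H M p" for x y
  proof -
    have "cu A B (fld p (J i p x)) p = cu A B (\<lambda>q. J i q (fld p x q)) p"
      by (rule tensorial_eq[OF ten p hf_fld hf_J[OF W(1) i(1) hf_fld]]) (simp add: p xy JHi)
    also have "\<dots> = J i p (cu A B (fld p x) p) + P j A B p *\<^sub>R J k p x + (eps k * P k A B p) *\<^sub>R J j p x"
      unfolding cu_J[OF A B hf_fld p c] fld_at[OF p xy(1)] ..
    finally show ?thesis
      unfolding r_def using g_J[OF pU i(1) cH[OF hf_fld] xy(2)] cH[OF hf_fld] xy i pU by simp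
  qed
  have "tr (\<lambda>x y. r (J i p x) (J k p y)) = tr (\<lambda>x y. - r x (J i p (J k p y)) + P j A B p * g p (J k p x) (J k p y)
      + eps k * P k A B p * g p (J j p x) (J k p y))"
    by (rule tr_cong) (rule rJ; simp add: JHi)
  also have "\<dots> = - tr (\<lambda>x y. r x (J i p (J k p y))) - eps k * real N * P j A B p"
    unfolding tr_add tr_minus tr_cmult tr_gJJ[OF i(3,3)] tr_gJJ[OF i(2,3)] using cyc_distinct[OF c] by simp
  finally have 1: "tr (\<lambda>x y. r (J i p x) (J k p y))
      = - tr (\<lambda>x y. r x (J i p (J k p y))) - eps k * real N * P j A B p" .
  have 2: "tr (\<lambda>x y. r (J i p x) (J k p y)) = - tr (\<lambda>x y. r x (J k p (J i p y)))"
    by (rule tr_adj[OF bil_JJ(2)[OF bil_r i(3)] i(1)])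
  have 3: "tr (\<lambda>x y. r x (J k p (J i p y))) = tr (\<lambda>x y. (- eps j) * r x (J j p y))"
    by (rule tr_cong) (simp add: J_cyc[OF pU _ cyc_rotate(2)[OF c]] bil_right[OF bil_r] JHi)
  have 4: "tr (\<lambda>x y. r x (J i p (J k p y))) = tr (\<lambda>x y. eps j * r x (J j p y))"
    by (rule tr_cong) (simp add: J_cyc[OF pU _ cyc_rotate(2)[OF c]] bil_right[OF bil_r] JHi)
  have "- (- eps j * (real N * rho M g L D j [A, B] p))
      = - (eps j * (real N * rho M g L D j [A, B] p)) - eps k * real N * P j A B p"
    using 1 unfolding 2 3 4 tr_cmult rj .
  moreover have "n * (2 * a * u) = n * (- d * v)" if "- (- a * (n * u)) = - (a * (n * u)) - d * n * v"
    for n a d u v :: real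
    using that by (simp add: algebra_simps)
  ultimately have "real N * (2 * eps j * rho M g L D j [A, B] p) = real N * (- eps k * P j A B p)"
    by blast
  then have h: "2 * eps j * rho M g L D j [A, B] p = - eps k * P j A B p"
    using N_nz by (simp only: mult_cancel_left) simp
  show ?thesis by (rule cyc_cases[OF c]) (use h in simp_all)
qed

end

context pqc_point
begin

section \<open>The torsion of arbitrary fields\<close>

lemma tor_decomp:
  assumes A: "vf W A" and B: "vf W B" and c: "(i, j, k) \<in> cyc"
  shows "tor A B p = tor (\<lambda>q. h q (A q)) B p + \<eta> i p (A p) *\<^sub>R tor (\<xi> i) B p
    + \<eta> j p (A p) *\<^sub>R tor (\<xi> j) B p + \<eta> k p (A p) *\<^sub>R tor (\<xi> k) B p"
proof -
  note i = cyc_in[OF c]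
  note x = vf_xiW[OF i(1)] vf_xiW[OF i(2)] vf_xiW[OF i(3)]
  note f = sf_eta[OF W(1) i(1) A] sf_eta[OF W(1) i(2) A] sf_eta[OF W(1) i(3) A]
  note hA = hf_vf[OF hf_hproj[OF W(1) A]]
  define V where "V q = \<eta> i q (A q) *\<^sub>R \<xi> i q + \<eta> j q (A q) *\<^sub>R \<xi> j q + \<eta> k q (A q) *\<^sub>R \<xi> k q" for q
  have vV: "vf W V" unfolding V_def by (intro smooth_vfield_add smooth_vfield_scale f x)
  have "tor B A p = tor B (\<lambda>q. h q (A q) + V q) p"
    by (rule tor_cong[OF B smooth_vfield_add[OF hA vV] p]) (simp only: V_def split_cyc[OF c, symmetric])
  also have "\<dots> = tor B (\<lambda>q. h q (A q)) p + tor B V p" by (rule tor_add[OF B hA vV p])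
  finally have "tor A B p = tor (\<lambda>q. h q (A q)) B p + tor V B p"
    by (simp add: tor_skew[of _ B])
  also have "tor V B p = \<eta> i p (A p) *\<^sub>R tor (\<xi> i) B p + \<eta> j p (A p) *\<^sub>R tor (\<xi> j) B p + \<eta> k p (A p) *\<^sub>R tor (\<xi> k) B p"
    by (rule tor_comb_left[OF B x p f]) (simp only: V_def)
  finally show ?thesis by simp
qed

text \<open>By bilinearity over H and the Reeb fields: mixed pairs have horizontal torsion, and of
  the nine pairs of Reeb fields only those formed by \<open>\<xi> j\<close> and
  \<open>\<xi> k\<close> have a component along \<open>\<xi> i\<close>.\<close>

lemma eta_tor:
  assumes A: "vf W A" and B: "vf W B" and c: "(i, j, k) \<in> cyc"
  shows "\<eta> i p (tor A B p) = - 2 * eps i * g p (J i p (h p (A p))) (h p (B p))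
    + eps i * \<Lambda> p * (\<eta> j p (A p) * \<eta> k p (B p) - \<eta> j p (B p) * \<eta> k p (A p))"
proof -
  note i = cyc_in[OF c]
  note hA = hf_hproj[OF W(1) A] and hB = hf_hproj[OF W(1) B]
  have tT: "tor X Y p \<in> T p" if "vf W X" "vf W Y" for X Y by (rule vf_T[OF vf_tor[OF that] p])
  note x = vf_xiW[OF i(1)] vf_xiW[OF i(2)] vf_xiW[OF i(3)]
  have 1: "\<eta> i p (tor X B p) = \<eta> i p (tor X (\<lambda>q. h q (B q)) p) + \<eta> i p (B p) * \<eta> i p (tor X (\<xi> i) p)
      + \<eta> j p (B p) * \<eta> i p (tor X (\<xi> j) p) + \<eta> k p (B p) * \<eta> i p (tor X (\<xi> k) p)" if X: "vf W X" for X
  proof -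
    have "tor X B p = tor X (\<lambda>q. h q (B q)) p + \<eta> i p (B p) *\<^sub>R tor X (\<xi> i) p
      + \<eta> j p (B p) *\<^sub>R tor X (\<xi> j) p + \<eta> k p (B p) *\<^sub>R tor X (\<xi> k) p"
      unfolding tor_skew[of X B p] tor_decomp[OF B X c] by (simp add: tor_skew[of _ X] algebra_simps)
    then show ?thesis
      using tT[OF X hf_vf[OF hB]] tT[OF X x(1)] tT[OF X x(2)] tT[OF X x(3)] pU i by simp
  qed
  have H0: "\<eta> i p (tor (\<xi> s) (\<lambda>q. h q (B q)) p) = 0" "\<eta> i p (tor (\<lambda>q. h q (A q)) (\<xi> s) p) = 0"
    if s: "s \<in> {1,2,3}" for s
  proof -
    show "\<eta> i p (tor (\<xi> s) (\<lambda>q. h q (B q)) p) = 0"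
      by (rule eta_H[OF pU i(1) tor_xi_H[OF hB p s]])
    have "tor (\<lambda>q. h q (A q)) (\<xi> s) p \<in> H M p"
      unfolding tor_skew[of "\<lambda>q. h q (A q)" "\<xi> s"] by (rule H_closed(5)[OF tor_xi_H[OF hA p s]])
    then show "\<eta> i p (tor (\<lambda>q. h q (A q)) (\<xi> s) p) = 0" by (rule eta_H[OF pU i(1)])
  qed
  have "\<eta> i p (tor A B p) = \<eta> i p (tor (\<lambda>q. h q (A q)) B p) + \<eta> i p (A p) * \<eta> i p (tor (\<xi> i) B p)
      + \<eta> j p (A p) * \<eta> i p (tor (\<xi> j) B p) + \<eta> k p (A p) * \<eta> i p (tor (\<xi> k) B p)"
    unfolding tor_decomp[OF A B c]
    using tT[OF hf_vf[OF hA] B] tT[OF x(1) B] tT[OF x(2) B] tT[OF x(3) B] pU i by simp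
  also have "\<dots> = \<eta> i p (tor (\<lambda>q. h q (A q)) (\<lambda>q. h q (B q)) p)
      + \<eta> i p (A p) * (\<eta> i p (B p) * \<Theta> i i i p + \<eta> j p (B p) * \<Theta> i i j p + \<eta> k p (B p) * \<Theta> i i k p)
      + \<eta> j p (A p) * (\<eta> i p (B p) * \<Theta> i j i p + \<eta> j p (B p) * \<Theta> i j j p + \<eta> k p (B p) * \<Theta> i j k p)
      + \<eta> k p (A p) * (\<eta> i p (B p) * \<Theta> i k i p + \<eta> j p (B p) * \<Theta> i k j p + \<eta> k p (B p) * \<Theta> i k k p)"
    unfolding 1[OF hf_vf[OF hA]] 1[OF x(1)] 1[OF x(2)] 1[OF x(3)] \<Theta>_def[symmetric]
      H0[OF i(1)] H0[OF i(2)] H0[OF i(3)] by simp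
  finally show ?thesis
    unfolding eta_tor_HH[OF hA hB p i(1)] Theta_zero[OF c] Theta_zero'[OF c]
      Theta_diag[OF p i(1,1)] Theta_diag[OF p i(1,2)] Theta_diag[OF p i(1,3)] Theta_skew[OF p i(1,3,2)]
      Theta_Lambda[OF c]
    by (simp add: algebra_simps)
qed

section \<open>The trace-free Ricci 2-forms\<close>

lemma P_point:
  assumes X: "hf W X" and Y: "hf W Y" and c: "(i, j, k) \<in> cyc"
  shows "P k X Y p = PP k (X p) (Y p)"
proof -
  note i = cyc_in[OF c]
  show ?thesis
    unfolding structure_point(2)[OF c hf_H[OF X p] hf_H[OF Y p]] structure_equations(2)[OF X Y p c]
      T_t[OF X i(2)] T_t[OF Y i(2)] ..
qed

lemma rho_horizontal:
  assumes X: "hf W X" and Y: "hf W Y" and c: "(i, j, k) \<in> cyc"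
  shows "rho M g L D k [X, Y] p = eps j / 2 * PP k (X p) (Y p)"
proof -
  have "PP k (X p) (Y p) = 2 * eps j * rho M g L D k [X, Y] p"
    unfolding P_point[OF X Y c, symmetric] by (rule rho_PP[OF hf_vf[OF X] hf_vf[OF Y] cyc_rotate(1)[OF c]])
  then show ?thesis by simp
qed

lemma trace_rho:
  assumes c: "(i, j, k) \<in> cyc"
  shows "htrace M g p (\<lambda>X Y. rho M g L D k [X, Ifield L k Y] p) = real N * eps k * \<Lambda> p"
proof -
  note i = cyc_in[OF c]
  have "htrace M g p (\<lambda>X Y. rho M g L D k [X, Ifield L k Y] p)
      = tr (\<lambda>x y. eps j / 2 * PP k x (J k p y))"
    unfolding htrace_eq tr_def
    by (rule sum.cong[OF refl])
      (simp add: Ifield_def rho_horizontal[OF e hf_J[OF W(1) i(3) e] c])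
  also have "\<dots> = real N * - (eps i * eps j) * \<Lambda> p"
    unfolding tr_cmult tr_PP(1)[OF c] Theta_Lambda[OF c] by simp
  finally show ?thesis using cyc_eps[OF c] by simp
qed

text \<open>By \<open>trace_rho\<close> the trace part of \<rho>_s is -\<Lambda> \<omega>_s, so
  removing it amounts to adding \<Lambda> \<omega>_s.\<close>

lemma rho0_eq:
  assumes s: "s \<in> {1,2,3}"
  shows "rho0 M g L D s Xs p = rho M g L D s Xs p + \<Lambda> p * omega g L s Xs p"
proof -
  obtain i k where "(s, i, k) \<in> cyc" using cyc_exists[OF s] by (elim exE)
  then have c: "(i, k, s) \<in> cyc" by (rule cyc_rotate)
  have N: "4 * real (qdim M) = real N" by simp
  have "eps s / real N * (real N * eps s * \<Lambda> p) = \<Lambda> p" using N_nz by simp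
  then show ?thesis unfolding rho0_def N trace_rho[OF c] by simp
qed

section \<open>Symmetric and skew parts of the torsion endomorphisms\<close>

definition t_sym :: "nat \<Rightarrow> 'a tvec \<Rightarrow> 'a tvec \<Rightarrow> real" where
  "t_sym s x y = (t s x y + t s y x) / 2"

definition t_skew :: "nat \<Rightarrow> 'a tvec \<Rightarrow> 'a tvec \<Rightarrow> real" where
  "t_skew s x y = (t s x y - t s y x) / 2"

lemma t_split: "t s x y = t_sym s x y + t_skew s x y" "t s y x = t_sym s x y - t_skew s x y"
  by (simp_all add: t_sym_def t_skew_def field_simps)

lemma bil_t_sym: "s \<in> {1,2,3} \<Longrightarrow> bil (t_sym s)" and bil_t_skew: "s \<in> {1,2,3} \<Longrightarrow> bil (t_skew s)"
  unfolding t_sym_def t_skew_def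
  by (rule bilI; simp add: t_left t_right add_divide_distrib diff_divide_distrib algebra_simps)+

lemmas t_sym_lin = bil_left[OF bil_t_sym] bil_right[OF bil_t_sym]
lemmas t_skew_lin = bil_left[OF bil_t_skew] bil_right[OF bil_t_skew]

lemma t_J_sym:
  assumes i: "i \<in> {1,2,3}" and x: "x \<in> H M p" and y: "y \<in> H M p"
  shows "t i x (J i p y) = t i y (J i p x)"
proof -
  obtain j k where c: "(i, j, k) \<in> cyc" using cyc_exists[OF i] by (elim exE)
  show ?thesis using structure_point(1)[OF c x y] unfolding Theta_zero[OF c] by simp
qed

text \<open>In terms of endomorphisms: the symmetric part of T_\<xi>_i anticommutes with I_i and the
  skew part commutes with it. Both come from \<open>t_J_sym\<close>, used for \<open>x\<close>,
  \<open>y\<close> and for their images under \<open>J i\<close>.\<close>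

lemma t_sym_skew_J:
  assumes i: "i \<in> {1,2,3}" and x: "x \<in> H M p" and y: "y \<in> H M p"
  shows "t_sym i (J i p x) y = t_sym i x (J i p y)" "t_skew i (J i p x) y = - t_skew i x (J i p y)"
proof -
  have 1: "t i x (J i p y) = t i y (J i p x)" by (rule t_J_sym[OF i x y])
  have "t i (J i p x) (J i p (J i p y)) = t i (J i p y) (J i p (J i p x))"
    by (rule t_J_sym[OF i JH[OF i x] JH[OF i y]])
  then have 2: "t i (J i p x) y = t i (J i p y) x"
    using x y i pU JH[OF i x] JH[OF i y] by (simp add: t_right[OF i])
  show "t_sym i (J i p x) y = t_sym i x (J i p y)" "t_skew i (J i p x) y = - t_skew i x (J i p y)"
    using 1 2 by (simp_all add: t_sym_def t_skew_def field_simps)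
qed

text \<open>The skew part of T_\<xi>_i commutes with I_i, so conjugation by I_j and by I_k has the
  same effect on it. Its conjugation average vanishes by \<open>t_perp_sp_n\<close>; therefore this
  common effect is a change of sign, that is, the skew part anticommutes with I_j and I_k.\<close>

lemma t_skew_perp:
  assumes c: "(i, j, k) \<in> cyc" and x: "x \<in> H M p" and y: "y \<in> H M p"
  shows "t_skew i (J j p x) y = t_skew i x (J j p y)" "t_skew i (J k p x) y = t_skew i x (J k p y)"
proof -
  note i = cyc_in[OF c]
  have *: "t_skew i (J j p x) (J j p y) = eps j * t_skew i x y \<and> t_skew i (J k p x) (J k p y) = eps k * t_skew i x y"
    if x: "x \<in> H M p" and y: "y \<in> H M p" for x y
  proof -
    have "t_skew i x y = t_skew i (J 1 p x) (J 1 p y) + t_skew i (J 2 p x) (J 2 p y) - t_skew i (J 3 p x) (J 3 p y)"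
      using t_perp_sp_n[OF i(1) x y] by (simp add: t_skew_def field_simps)
    then have 1: "t_skew i x y = eps i * t_skew i (J i p x) (J i p y) + eps j * t_skew i (J j p x) (J j p y)
        + eps k * t_skew i (J k p x) (J k p y)"
      by (rule_tac cyc_cases[OF c]) simp_all
    have 2: "t_skew i (J i p x) (J i p y) = - eps i * t_skew i x y" if "x \<in> H M p" "y \<in> H M p" for x y
      using t_sym_skew_J(2)[OF i(1) that(1) JH[OF i(1) that(2)]] that i pU by (simp add: t_skew_lin)
    have Jk: "J k p z = (- eps k) *\<^sub>R J i p (J j p z)" if "z \<in> H M p" for z
      unfolding J_cyc(1)[OF pU that c] by simp
    have "t_skew i (J k p x) (J k p y) = (- eps k) * ((- eps k) * t_skew i (J i p (J j p x)) (J i p (J j p y)))"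
      unfolding Jk[OF x] Jk[OF y] using JH[OF i(1) JH[OF i(2) x]] JH[OF i(1) JH[OF i(2) y]] i
      by (simp only: t_skew_lin H_closed)
    then have 3: "t_skew i (J k p x) (J k p y) = - eps i * t_skew i (J j p x) (J j p y)"
      unfolding 2[OF JH[OF i(2) x] JH[OF i(2) y]] by simp
    show ?thesis using 1 unfolding 2[OF x y] 3 by (rule_tac cyc_cases[OF c]) simp_all
  qed
  have "t_skew i (J r p x) y = t_skew i x (J r p y)" if r: "r \<in> {j, k}" for r
  proof -
    have r': "r \<in> {1,2,3}" using that i by blast
    have "t_skew i (J r p x) (J r p (J r p y)) = eps r * t_skew i x (J r p y)"
      using *[OF x JH[OF r' y]] r by blast
    then have "eps r * t_skew i (J r p x) y = eps r * t_skew i x (J r p y)"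
      using J_sq[OF pU r' y] JH[OF r' x] y i by (simp add: t_skew_lin)
    then show ?thesis unfolding mult_cancel_left by simp
  qed
  then show "t_skew i (J j p x) y = t_skew i x (J j p y)" "t_skew i (J k p x) y = t_skew i x (J k p y)" by simp_all
qed

text \<open>What the symmetric torsion contributes to the skew expression
  \<open>t i x (J j p y) - t i y (J j p x)\<close> of \<open>PP_eq\<close>.\<close>

definition sQ :: "nat \<Rightarrow> nat \<Rightarrow> 'a tvec \<Rightarrow> 'a tvec \<Rightarrow> real" where
  "sQ i j x y = t_sym i x (J j p y) - t_sym i (J j p x) y"

lemma Q_eq:
  assumes "i \<in> {1,2,3}" "j \<in> {1,2,3}" "t_skew i (J j p x) y = t_skew i x (J j p y)"
  shows "t i x (J j p y) - t i y (J j p x) = sQ i j x y + 2 * t_skew i x (J j p y)"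
  unfolding t_split(1)[of i x "J j p y"] t_split(2)[of i y "J j p x"] sQ_def using assms(3) by simp

text \<open>Both expressions of \<open>PP_eq\<close> for \<open>PP k\<close> are equal; by
  \<open>Theta_Lambda\<close> their metric terms agree, so the torsion terms agree as well.\<close>

lemma Q_skew:
  assumes c: "(i, j, k) \<in> cyc" and x: "x \<in> H M p" and y: "y \<in> H M p"
  shows "t j x (J i p y) - t j y (J i p x) = - (t i x (J j p y) - t i y (J j p x))"
proof -
  have "2 * eps k * \<Theta> i j k p * g p (J k p x) y + 2 * eps i * (t j x (J i p y) - t j y (J i p x))
    = - 2 * \<Theta> j k i p * g p (J k p x) y - 2 * eps i * (t i x (J j p y) - t i y (J j p x))"
    using PP_eq(1)[OF c x y] PP_eq(2)[OF cyc_rotate(1)[OF c] x y] by simp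
  moreover have "eps k * \<Theta> i j k p = - \<Theta> j k i p"
    unfolding Theta_Lambda[OF c] Theta_Lambda[OF cyc_rotate(1)[OF c]]
    using cyc_eps[OF c] by (simp add: mult.assoc[symmetric])
  then have "2 * eps k * \<Theta> i j k p * g p (J k p x) y = - 2 * \<Theta> j k i p * g p (J k p x) y"
    by (simp add: mult.assoc[of 2])
  ultimately have "2 * eps i * (t j x (J i p y) - t j y (J i p x)) = 2 * eps i * - (t i x (J j p y) - t i y (J j p x))"
    by linarith
  then show ?thesis unfolding mult_cancel_left by simp
qed

text \<open>Conjugation by \<open>I\<^sub>i\<close> separates the symmetric from the skew-symmetric part.\<close>

lemma Q_parts:
  assumes c: "(i, j, k) \<in> cyc" and x: "x \<in> H M p" and y: "y \<in> H M p"
  shows "sQ j i x y = - sQ i j x y" "t_skew j x (J i p y) = - t_skew i x (J j p y)"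
proof -
  note i = cyc_in[OF c]
  note c1 = cyc_rotate(1)[OF c] and c2 = cyc_rotate(2)[OF c]
  have eq: "sQ j i x y + 2 * t_skew j x (J i p y) = - (sQ i j x y + 2 * t_skew i x (J j p y))"
    if "x \<in> H M p" "y \<in> H M p" for x y
    using Q_skew[OF c that] unfolding Q_eq[OF i(1,2) t_skew_perp(1)[OF c that]] Q_eq[OF i(2,1) t_skew_perp(2)[OF c1 that]] .
  have ee: "eps j * eps k = - eps i" using cyc_eps[OF c] by simp
  have H: "J i p x \<in> H M p" "J i p y \<in> H M p" "J k p x \<in> H M p" "J k p y \<in> H M p" "J j p x \<in> H M p" "J j p y \<in> H M p"
    using JH i x y by auto
  have Jji: "J j p (J i p z) = eps k *\<^sub>R J k p z" "J i p (J k p z) = eps j *\<^sub>R J j p z"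
    if "z \<in> H M p" for z
    using J_cyc(2)[OF pU that c] J_cyc(2)[OF pU that c2] by simp_all
  have s1: "sQ j i (J i p x) (J i p y) = - eps i * sQ j i x y"
    unfolding sQ_def J_sq[OF pU i(1) x] J_sq[OF pU i(1) y]
    using H x y i by (simp add: t_sym_lin algebra_simps)
  have a1: "t_skew j (J i p x) (J i p (J i p y)) = eps i * t_skew j x (J i p y)"
    using t_skew_perp(2)[OF c1 x y] H y i unfolding J_sq[OF pU i(1) y] by (simp add: t_skew_lin)
  have "t_sym i (J i p x) (J j p (J i p y)) = eps k * t_sym i x (J i p (J k p y))"
    unfolding Jji(1)[OF y] using t_sym_skew_J(1)[OF i(1) x H(4)] H i by (simp add: t_sym_lin)
  also have "\<dots> = - eps i * t_sym i x (J j p y)"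
    unfolding Jji(2)[OF y] using H x i ee by (simp add: t_sym_lin mult.assoc[symmetric] mult.commute)
  finally have s2a: "t_sym i (J i p x) (J j p (J i p y)) = - eps i * t_sym i x (J j p y)" .
  have "t_sym i (J j p (J i p x)) (J i p y) = eps k * t_sym i (J i p (J k p x)) y"
    unfolding Jji(1)[OF x] using t_sym_skew_J(1)[OF i(1) H(3) y] H i by (simp add: t_sym_lin)
  also have "\<dots> = - eps i * t_sym i (J j p x) y"
    unfolding Jji(2)[OF x] using H y i ee by (simp add: t_sym_lin mult.assoc[symmetric] mult.commute)
  finally have s2b: "t_sym i (J j p (J i p x)) (J i p y) = - eps i * t_sym i (J j p x) y" .
  have s2: "sQ i j (J i p x) (J i p y) = - eps i * sQ i j x y"
    unfolding sQ_def s2a s2b by (simp add: algebra_simps)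
  have "t_skew i (J i p x) (J j p (J i p y)) = - eps k * t_skew i x (J i p (J k p y))"
    unfolding Jji(1)[OF y] using t_sym_skew_J(2)[OF i(1) x H(4)] H i by (simp add: t_skew_lin)
  also have "\<dots> = eps i * t_skew i x (J j p y)"
    unfolding Jji(2)[OF y] using H x i ee by (simp add: t_skew_lin mult.assoc[symmetric] mult.commute)
  finally have a2: "t_skew i (J i p x) (J j p (J i p y)) = eps i * t_skew i x (J j p y)" .
  \<comment> \<open>At \<open>J i p x\<close>, \<open>J i p y\<close> the \<open>sQ\<close> terms
    acquire \<open>- eps i\<close> and the \<open>t_skew\<close> terms \<open>eps i\<close>. This
    second relation, next to the one at \<open>x\<close>, \<open>y\<close>, determines the two kinds
    of terms separately.\<close>
  have "eps i * (- sQ j i x y + 2 * t_skew j x (J i p y)) = eps i * (sQ i j x y - 2 * t_skew i x (J j p y))"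
    using eq[OF H(1,2)] unfolding s1 s2 a1 a2 by (simp add: algebra_simps)
  then have "- sQ j i x y + 2 * t_skew j x (J i p y) = sQ i j x y - 2 * t_skew i x (J j p y)"
    unfolding mult_cancel_left by simp
  then show "sQ j i x y = - sQ i j x y" "t_skew j x (J i p y) = - t_skew i x (J j p y)"
    using eq[OF x y] by simp_all
qed

text \<open>The skew relation of \<open>Q_parts\<close>, taken at \<open>J i p (J j p y)\<close> in
  place of \<open>y\<close>, turns both sides into the expression for \<mu>. It justifies the choice
  of one index in the definition of \<open>mu\<close>.\<close>

lemma mu_independent:
  assumes c: "(i, j, k) \<in> cyc" and x: "x \<in> H M p" and y: "y \<in> H M p"
  shows "eps j * t_skew j (J j p x) y = eps i * t_skew i (J i p x) y"
proof -
  note i = cyc_in[OF c]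
  have H: "J i p y \<in> H M p" "J j p y \<in> H M p" "J k p y \<in> H M p" "J i p (J j p y) \<in> H M p" using JH i y by auto
  have Jy: "J j p (J i p (J j p y)) = (- eps j) *\<^sub>R J i p y"
    using J_cyc[OF pU H(2) c] y pU i by simp
  have "eps i * t_skew j x (J j p y) = t_skew j x (J i p (J i p (J j p y)))"
    using H x i unfolding J_sq[OF pU i(1) H(2)] by (simp add: t_skew_lin)
  also have "\<dots> = - t_skew i x (J j p (J i p (J j p y)))"
    by (rule Q_parts(2)[OF c x H(4)])
  also have "\<dots> = eps j * t_skew i x (J i p y)"
    unfolding Jy using t_skew_lin(5)[OF i(1) x H(1), of "- eps j"] by simp
  also have "\<dots> = - eps j * t_skew i (J i p x) y"
    unfolding t_sym_skew_J(2)[OF i(1) x y] by simp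
  finally have "eps i * t_skew j x (J j p y) = - eps j * t_skew i (J i p x) y" .
  then have "t_skew j x (J j p y) = eps i * (- eps j * t_skew i (J i p x) y)" by (metis eps_square(2))
  then have "eps j * t_skew j (J j p x) y = (eps j * eps j) * (eps i * t_skew i (J i p x) y)"
    unfolding t_sym_skew_J(2)[OF i(2) x y] by (simp only: algebra_simps) simp
  then show ?thesis by simp
qed

lemma mu_any:
  assumes s: "s \<in> {1,2,3}" and x: "x \<in> H M p" and y: "y \<in> H M p"
  shows "t_skew 1 (J 1 p x) y = eps s * t_skew s (J s p x) y"
proof -
  have "(1, 2, 3) \<in> cyc" "(2, 3, 1) \<in> cyc" by (simp_all add: cyc_def)
  from mu_independent[OF this(1) x y] mu_independent[OF this(2) x y] show ?thesis
    using s by auto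
qed

lemma Tor3_t:
  assumes "hf W X" "hf W Y" "s \<in> {1,2,3}"
  shows "Tor3 M g L D (\<xi> s) X Y p = t s (X p) (Y p)"
  unfolding Tor3_def gext_H[OF pU tor_xi_H[OF assms(1) p assms(3)] hf_H[OF assms(2) p]]
  using T_t[OF assms(1,3), of Y] by (simp add: \<T>_def)

lemma tau_eq:
  assumes X: "hf W X" and Y: "hf W Y" and c: "(i, j, k) \<in> cyc"
  shows "tau M g L D X Y p = - (eps i * t_sym i (J i p (X p)) (Y p) + eps j * t_sym j (J j p (X p)) (Y p)
    + eps k * t_sym k (J k p (X p)) (Y p))"
proof -
  note i = cyc_in[OF c]
  have *: "Tor_sym M g L D (xi L s) (Ifield L s X) Y p = t_sym s (J s p (X p)) (Y p)" if s: "s \<in> {1,2,3}" for s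
    unfolding Tor_sym_def Ifield_def t_sym_def
      Tor3_t[OF hf_J[OF W(1) s X] Y s] Tor3_t[OF Y hf_J[OF W(1) s X] s] ..
  show ?thesis unfolding tau_def cyc_sum[OF c] *[OF i(1)] *[OF i(2)] *[OF i(3)] ..
qed

lemma mu_eq:
  assumes X: "hf W X" and Y: "hf W Y" and s: "s \<in> {1,2,3}"
  shows "mu M g L D X Y p = eps s * t_skew s (J s p (X p)) (Y p)"
proof -
  have 1: "1 \<in> {1,2,3::nat}" by simp
  have "mu M g L D X Y p = eps 1 * t_skew 1 (J 1 p (X p)) (Y p)"
    unfolding mu_def Tor_skew_def Ifield_def t_skew_def
      Tor3_t[OF hf_J[OF W(1) 1 X] Y 1] Tor3_t[OF Y hf_J[OF W(1) 1 X] 1] ..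
  also have "\<dots> = t_skew 1 (J 1 p (X p)) (Y p)" by simp
  also have "\<dots> = eps s * t_skew s (J s p (X p)) (Y p)" by (rule mu_any[OF s hf_H[OF X p] hf_H[OF Y p]])
  finally show ?thesis .
qed

text \<open>The metric term of \<open>PP_eq\<close> cancels against \<Lambda> \<omega>_s, leaving
  the symmetric and the skew torsion. In the difference of the two \<tau> values the term of \<xi>_s
  cancels, and the terms of the other two Reeb fields are equal by \<open>Q_parts\<close>; \<mu>
  accounts for the skew part.\<close>

lemma rho0_horizontal:
  assumes X: "hf W X" and Y: "hf W Y" and s: "s \<in> {1,2,3}"
  shows "rho0 M g L D s [X, Y] p = 1 / 2 * (tau M g L D X (Ifield L s Y) p - tau M g L D (Ifield L s X) Y p)
     + 2 * mu M g L D X (Ifield L s Y) p"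
proof -
  obtain i j where c0: "(s, i, j) \<in> cyc" using cyc_exists[OF s] by (elim exE)
  \<comment> \<open>The given index becomes the last entry of a cyclic triple, the position for
    which \<open>PP_eq\<close> has its first expression.\<close>
  define k where "k = s"
  have c: "(i, j, k) \<in> cyc" using cyc_rotate(1)[OF c0] unfolding k_def .
  note c1 = cyc_rotate(1)[OF c] and c2 = cyc_rotate(2)[OF c]
  note i = cyc_in[OF c]
  have ee: "eps i * eps j = - eps k" using cyc_eps[OF c] by simp
  define x y where "x = X p" and "y = Y p"
  have x: "x \<in> H M p" and y: "y \<in> H M p" unfolding x_def y_def by (rule hf_H[OF X p], rule hf_H[OF Y p])
  have H: "J i p x \<in> H M p" "J i p y \<in> H M p" "J k p x \<in> H M p" "J k p y \<in> H M p" "J j p x \<in> H M p" "J j p y \<in> H M p"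
    using JH i x y by auto
  note IX = hf_J[OF W(1) i(3) X] and IY = hf_J[OF W(1) i(3) Y]
  have "omega g L k [X, Y] p = g p (J k p x) y"
    using x y pU by (simp add: omega_def form2_def x_def y_def)
  then have "rho0 M g L D k [X, Y] p = eps j / 2 * PP k x y + \<Lambda> p * g p (J k p x) y"
    unfolding rho0_eq[OF i(3)] rho_horizontal[OF X Y c] x_def[symmetric] y_def[symmetric] by simp
  also have "\<dots> = eps i * eps j * (eps k * \<Lambda> p * g p (J k p x) y) + \<Lambda> p * g p (J k p x) y
      + eps i * eps j * (t j x (J i p y) - t j y (J i p x))"
    unfolding PP_eq(1)[OF c x y] Theta_Lambda[OF c] by (simp add: algebra_simps)
  also have "\<dots> = eps k * (sQ i j x y + 2 * t_skew i x (J j p y))"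
    unfolding ee Q_skew[OF c x y] Q_eq[OF i(1,2) t_skew_perp(1)[OF c x y]] by (simp add: algebra_simps)
  finally have L: "rho0 M g L D k [X, Y] p = eps k * (sQ i j x y + 2 * t_skew i x (J j p y))" .
  have m: "mu M g L D X (Ifield L k Y) p = eps k * t_skew i x (J j p y)"
  proof -
    have "mu M g L D X (Ifield L k Y) p = eps i * t_skew i (J i p x) (J k p y)"
      unfolding Ifield_def mu_eq[OF X IY i(1)] x_def y_def ..
    also have "\<dots> = - (eps i * t_skew i x (J i p (J k p y)))" unfolding t_sym_skew_J(2)[OF i(1) x H(4)] by simp
    also have "J i p (J k p y) = eps j *\<^sub>R J j p y" by (rule J_cyc(2)[OF pU y c2])
    also have "- (eps i * t_skew i x (eps j *\<^sub>R J j p y)) = - (eps i * eps j) * t_skew i x (J j p y)"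
      unfolding t_skew_lin(5)[OF i(1) x H(6)] by simp
    finally show ?thesis unfolding ee by simp
  qed
  have ti: "t_sym i (J i p x) (J k p y) - t_sym i (J i p (J k p x)) y = eps j * sQ i j x y"
    unfolding t_sym_skew_J(1)[OF i(1) x H(4)] J_cyc(2)[OF pU y c2] J_cyc(2)[OF pU x c2] sQ_def
      t_sym_lin(5)[OF i(1) x H(6)] t_sym_lin(2)[OF i(1) y H(5)] by (simp add: algebra_simps)
  have "t_sym j (J j p x) (J k p y) - t_sym j (J j p (J k p x)) y = - eps i * (t_sym j x (J i p y) - t_sym j (J i p x) y)"
    unfolding t_sym_skew_J(1)[OF i(2) x H(4)] J_cyc(1)[OF pU y c1] J_cyc(1)[OF pU x c1]
      t_sym_lin(6)[OF i(2) x H_closed(4)[OF H(2)]] t_sym_lin(3)[OF i(2) y H_closed(4)[OF H(1)]]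
      t_sym_lin(5)[OF i(2) x H(2)] t_sym_lin(2)[OF i(2) y H(1)] by (simp add: algebra_simps)
  also have "t_sym j x (J i p y) - t_sym j (J i p x) y = - sQ i j x y"
    using Q_parts(1)[OF c x y] unfolding sQ_def[of j] .
  finally have tj: "t_sym j (J j p x) (J k p y) - t_sym j (J j p (J k p x)) y = eps i * sQ i j x y" by simp
  have tk: "t_sym k (J k p x) (J k p y) - t_sym k (J k p (J k p x)) y = 0"
    unfolding t_sym_skew_J(1)[OF i(3) x H(4)] J_sq[OF pU i(3) y] J_sq[OF pU i(3) x]
      t_sym_lin(5)[OF i(3) x y] t_sym_lin(2)[OF i(3) y x] by simp
  have "tau M g L D X (Ifield L k Y) p - tau M g L D (Ifield L k X) Y p
      = - (eps i * (t_sym i (J i p x) (J k p y) - t_sym i (J i p (J k p x)) y)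
        + eps j * (t_sym j (J j p x) (J k p y) - t_sym j (J j p (J k p x)) y)
        + eps k * (t_sym k (J k p x) (J k p y) - t_sym k (J k p (J k p x)) y))"
    unfolding Ifield_def tau_eq[OF X IY c] tau_eq[OF IX Y c] x_def y_def by (simp add: algebra_simps)
  also have "\<dots> = - (2 * (eps i * eps j)) * sQ i j x y"
    unfolding ti tj tk by (simp add: algebra_simps)
  finally have tt: "tau M g L D X (Ifield L k Y) p - tau M g L D (Ifield L k X) Y p = 2 * eps k * sQ i j x y"
    unfolding ee by simp
  show ?thesis unfolding k_def[symmetric] L m tt by (simp add: algebra_simps)
qed

section \<open>The scalar curvature\<close>

definition R :: "'a tvec \<Rightarrow> 'a tvec \<Rightarrow> 'a tvec \<Rightarrow> 'a tvec \<Rightarrow> real" where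
  "R x y z w = g p (cu (fld p x) (fld p y) (fld p z) p) w"

lemma cu_H_fld: "hf W X \<Longrightarrow> hf W Y \<Longrightarrow> hf W Z \<Longrightarrow> cu X Y Z p \<in> H M p"
  by (rule cu_H[OF W(1) hf_vf hf_vf _ p])

lemma tensorial_cu_left:
  assumes B: "vf W B" and C: "vf W C"
  shows "tensorial p (\<lambda>A. cu A B C p)"
  by (rule tensorialI)
    (simp_all add: cu_add_left[OF _ _ B C p] cu_scale_left[OF _ B C _ p] cu_cong_left[OF _ B C p] hf_vf)

lemma cu_point:
  assumes X: "hf W X" and Y: "hf W Y" and Z: "hf W Z"
  shows "cu X Y Z p = cu (fld p (X p)) (fld p (Y p)) (fld p (Z p)) p"
proof -
  note vY = hf_vf[OF Y] and vZ = hf_vf[OF Z]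
  have "cu X Y Z p = cu (fld p (X p)) Y Z p"
    by (rule tensorial_point[OF tensorial_cu_left[OF vY vZ] X])
  also have "\<dots> = - cu Y (fld p (X p)) Z p" by (rule cu_skew[OF vY vf_fld vZ p])
  also have "cu Y (fld p (X p)) Z p = cu (fld p (Y p)) (fld p (X p)) Z p"
    by (rule tensorial_point[OF tensorial_cu_left[OF vf_fld vZ] Y])
  also have "cu (fld p (Y p)) (fld p (X p)) Z p = cu (fld p (Y p)) (fld p (X p)) (fld p (Z p)) p"
    by (rule tensorial_point[OF tensorial_cu[OF vf_fld vf_fld] Z])
  also have "- cu (fld p (Y p)) (fld p (X p)) (fld p (Z p)) p = cu (fld p (X p)) (fld p (Y p)) (fld p (Z p)) p"
    by (rule cu_skew[OF vf_fld vf_fld vf_fld p, symmetric])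
  finally show ?thesis .
qed

lemma R_skew: "w \<in> H M p \<Longrightarrow> R y x z w = - R x y z w"
  unfolding R_def cu_skew[OF vf_fld[of p x] vf_fld[of p y] vf_fld[of p z] p]
  by (rule g_left(4)[OF _ cu_H_fld[OF hf_fld hf_fld hf_fld]])

lemma R_lin:
  assumes "w \<in> H M p"
  shows "lin_on (H M p) (\<lambda>x. R x y z w)" "lin_on (H M p) (\<lambda>z. R x y z w)"
  unfolding R_def lin_on_def
  using tensorial_lin[OF tensorial_cu_left[OF vf_fld[of p y] vf_fld[of p z]]]
    tensorial_lin[OF tensorial_cu[OF vf_fld[of p x] vf_fld[of p y]]] assms cu_H_fld[OF hf_fld hf_fld hf_fld]
  by (simp_all add: lin_on_def)

lemma R_J:
  assumes c: "(i, j, k) \<in> cyc" and z: "z \<in> H M p" and w: "w \<in> H M p"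
  shows "R x y (J i p z) w = - R x y z (J i p w) + PP j x y * g p (J k p z) w + eps k * PP k x y * g p (J j p z) w"
proof -
  note i = cyc_in[OF c]
  have C: "cu (fld p x) (fld p y) (fld p z) p \<in> H M p" by (rule cu_H_fld[OF hf_fld hf_fld hf_fld])
  have "cu (fld p x) (fld p y) (fld p (J i p z)) p = cu (fld p x) (fld p y) (\<lambda>q. J i q (fld p z q)) p"
    by (rule tensorial_eq[OF tensorial_cu[OF vf_fld vf_fld] p hf_fld hf_J[OF W(1) i(1) hf_fld]])
      (simp add: p z JH[OF i(1)])
  also have "\<dots> = J i p (cu (fld p x) (fld p y) (fld p z) p) + PP j x y *\<^sub>R J k p z + (eps k * PP k x y) *\<^sub>R J j p z"
    unfolding cu_J[OF vf_fld vf_fld hf_fld p c] fld_at[OF p z] PP_def ..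
  finally show ?thesis
    unfolding R_def using g_J[OF pU i(1) C w] C z w i pU by simp
qed

lemma R_bianchi:
  assumes c: "(i, j, k) \<in> cyc" and x: "x \<in> H M p" and y: "y \<in> H M p" and z: "z \<in> H M p" and w: "w \<in> H M p"
  shows "R x y z w + R y z x w + R z x y w = - 2 *
    (\<Sum>r\<in>{1,2,3}. eps r * (g p (J r p x) y * t r z w + g p (J r p y) z * t r x w + g p (J r p z) x * t r y w))"
proof -
  note i = cyc_in[OF c]
  note C = cu_H_fld[OF hf_fld hf_fld hf_fld, of p _ p _ p]
  have tt: "tor (tor (fld p x) (fld p y)) (fld p z) p \<in> H M p"
    "g p (tor (tor (fld p x) (fld p y)) (fld p z) p) w = - 2 * (eps i * g p (J i p x) y * t i z w
      + eps j * g p (J j p x) y * t j z w + eps k * g p (J k p x) y * t k z w)"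
    if "x \<in> H M p" "y \<in> H M p" "z \<in> H M p" for x y z
    unfolding tor_tor_HH[OF hf_fld[of p x] hf_fld[of p y] vf_fld[of p z] p c, unfolded fld_at[OF p that(1)] fld_at[OF p that(2)]]
    using tor_xi_H[OF hf_fld[of p z] p i(1)] tor_xi_H[OF hf_fld[of p z] p i(2)] tor_xi_H[OF hf_fld[of p z] p i(3)] w
    by (simp_all add: t_def algebra_simps)
  have "R x y z w + R y z x w + R z x y w
      = g p (cu (fld p x) (fld p y) (fld p z) p + cu (fld p y) (fld p z) (fld p x) p + cu (fld p z) (fld p x) (fld p y) p) w"
    unfolding R_def using C w by simp
  also have "\<dots> = g p (tor (tor (fld p x) (fld p y)) (fld p z) p) w + g p (tor (tor (fld p y) (fld p z)) (fld p x) p) w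
      + g p (tor (tor (fld p z) (fld p x)) (fld p y) p) w"
    unfolding bianchi_H[OF hf_fld hf_fld hf_fld p]
    using tt(1)[OF x y z] tt(1)[OF y z x] tt(1)[OF z x y] w by simp
  finally show ?thesis
    unfolding tt(2)[OF x y z] tt(2)[OF y z x] tt(2)[OF z x y] cyc_sum[OF c] by (simp add: algebra_simps)
qed

lemma bil_PP:
  assumes s: "s \<in> {1,2,3}"
  shows "bil (PP s)"
proof -
  obtain i j where "(s, i, j) \<in> cyc" using cyc_exists[OF s] by (elim exE)
  then have c: "(i, j, s) \<in> cyc" by (rule cyc_rotate)
  have i: "i \<in> {1,2,3}" "j \<in> {1,2,3}" using cyc_in[OF c] by auto
  note JHi = JH[OF i(1)] JH[OF i(2)] JH[OF s]
  show ?thesis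
    by (rule bilI)
      (use i s pU in \<open>simp_all add: PP_eq(1)[OF c] JHi t_left[OF i(2)] t_right[OF i(2)] algebra_simps\<close>)
qed

definition tr2 :: "('a tvec \<Rightarrow> 'a tvec \<Rightarrow> real) \<Rightarrow> real" where
  "tr2 F = (\<Sum>b<N. S b * (\<Sum>a<N. S a * F (E a) (E b)))"

lemma tr2_tr: "tr2 F = (\<Sum>b<N. S b * tr (\<lambda>x y. F x (E b)))" "tr2 F = tr (\<lambda>x y. tr (\<lambda>z w. F x z))"
proof -
  show "tr2 F = (\<Sum>b<N. S b * tr (\<lambda>x y. F x (E b)))" by (simp add: tr2_def tr_def)
  have "tr2 F = (\<Sum>a<N. \<Sum>b<N. S b * (S a * F (E a) (E b)))"
    unfolding tr2_def sum_distrib_left by (rule sum.swap)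
  then show "tr2 F = tr (\<lambda>x y. tr (\<lambda>z w. F x z))"
    by (simp add: tr_def sum_distrib_left mult.left_commute)
qed

lemma tr2_cong: "(\<And>x z. x \<in> H M p \<Longrightarrow> z \<in> H M p \<Longrightarrow> F x z = F' x z) \<Longrightarrow> tr2 F = tr2 F'"
  unfolding tr2_def by (intro sum.cong refl arg_cong2[of _ _ _ _ "(*)"]) (simp add: EH)

lemma tr2_add: "tr2 (\<lambda>x z. F x z + F' x z) = tr2 F + tr2 F'"
  by (simp add: tr2_def sum.distrib distrib_left)

lemma tr2_cmult: "tr2 (\<lambda>x z. c * F x z) = c * tr2 F"
  by (simp add: tr2_def sum_distrib_left mult.left_commute)

lemma tr2_minus: "tr2 (\<lambda>x z. - F x z) = - tr2 F"
  using tr2_cmult[of "-1" F] by simp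

lemma tr2_sum: "finite I \<Longrightarrow> tr2 (\<lambda>x z. \<Sum>i\<in>I. F i x z) = (\<Sum>i\<in>I. tr2 (F i))"
  by (induction I rule: finite_induct) (simp_all add: tr2_add, simp add: tr2_def)

lemma tr_rank_one:
  assumes f: "lin_on (H M p) f" and u: "u \<in> H M p"
  shows "tr (\<lambda>z w. g p u z * f z) = f u"
  using lin_expand[OF f u] by (simp add: tr_def)

text \<open>A metric factor in the double trace contracts the free vector \<open>z\<close> with
  \<open>K x\<close>, which leaves a single trace.\<close>

lemma tr2_rank_one:
  assumes "\<And>x. x \<in> H M p \<Longrightarrow> lin_on (H M p) (F x)" "\<And>x. x \<in> H M p \<Longrightarrow> K x \<in> H M p"
  shows "tr2 (\<lambda>x z. g p (K x) z * F x z) = tr (\<lambda>x y. F x (K x))"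
  unfolding tr2_tr(2) by (rule tr_cong) (rule tr_rank_one[OF assms])

text \<open>\<open>J s\<close> commutes or anticommutes with \<open>J r\<close>, and its square is a
  scalar. The value of the factor is irrelevant, since the trace of \<open>t r\<close> against any
  multiple of \<open>J r\<close> vanishes.\<close>

lemma J_conj:
  assumes "s \<in> {1,2,3}" "r \<in> {1,2,3}"
  shows "\<exists>c. \<forall>x\<in>H M p. J s p (J r p (J s p x)) = c *\<^sub>R J r p x"
proof (cases "s = r")
  case True
  then show ?thesis using assms pU by (intro exI[of _ "eps s"]) simp
next
  case False
  obtain j k where c: "(s, j, k) \<in> cyc" using cyc_exists[OF assms(1)] by (elim exE)
  note i = cyc_in[OF c]
  have "J s p (J r p (J s p x)) = (- eps s) *\<^sub>R J r p x" if x: "x \<in> H M p" for x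
  proof -
    have "r = j \<or> r = k" using assms(2) False unfolding cyc_UNIV[OF c] by blast
    then show ?thesis
    proof
      assume "r = j"
      then show ?thesis
        using J_cyc[OF pU JH[OF i(1) x] c] J_cyc[OF pU x c] x i pU JH[OF i(1) x] JH[OF i(2) x] JH[OF i(3) x]
          J_cyc[OF pU x cyc_rotate(2)[OF c]] cyc_eps[OF c] by (simp add: mult.commute)
    next
      assume "r = k"
      then show ?thesis
        using J_cyc[OF pU x cyc_rotate(2)[OF c]] x i pU JH[OF i(1) x] JH[OF i(2) x] JH[OF i(3) x]
          J_cyc[OF pU x c] cyc_eps[OF c] by (simp add: mult.commute)
    qed
  qed
  then show ?thesis by (intro exI[of _ "- eps s"]) blast
qed

lemma tr_t_conj:
  assumes r: "r \<in> {1,2,3}" and s: "s \<in> {1,2,3}"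
  shows "tr (\<lambda>x y. t r x (J s p (J r p (J s p y)))) = 0"
proof -
  obtain c where c: "\<forall>x\<in>H M p. J s p (J r p (J s p x)) = c *\<^sub>R J r p x"
    using J_conj[OF s r] by (elim exE)
  have "tr (\<lambda>x y. t r x (J s p (J r p (J s p y)))) = tr (\<lambda>x y. c * t r x (J r p y))"
    by (rule tr_cong) (use c t_right(2)[OF r _ JH[OF r]] in simp)
  then show ?thesis unfolding tr_cmult using r by simp
qed

lemma Scal_tr2: "Scal M g L D p = tr2 (\<lambda>x z. R z x x z)"
proof -
  have "R4 M g L D (e a) (e b) (e b) (e a) p = R (E a) (E b) (E b) (E a)" if "a < N" "b < N" for a b
    using gext_H[OF pU cu_H_fld[OF e[OF that(1)] e[OF that(2)] e[OF that(2)]] EH[OF that(1)]]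
    unfolding R4_def R_def cu_point[OF e[OF that(1)] e[OF that(2)] e[OF that(2)]] .
  then have "Scal M g L D p = (\<Sum>b<N. S b * (\<Sum>a<N. S a * R (E a) (E b) (E b) (E a)))"
    unfolding Scal_def Ric_def htrace_eq by (intro sum.cong refl arg_cong2[of _ _ _ _ "(*)"]) simp
  also have "\<dots> = (\<Sum>b<N. \<Sum>a<N. S b * (S a * R (E a) (E b) (E b) (E a)))"
    by (simp add: sum_distrib_left)
  also have "\<dots> = (\<Sum>a<N. \<Sum>b<N. S b * (S a * R (E a) (E b) (E b) (E a)))"
    by (rule sum.swap)
  also have "\<dots> = tr2 (\<lambda>x z. R z x x z)"
    unfolding tr2_def sum_distrib_left by (intro sum.cong refl) (simp add: mult.left_commute)
  finally show ?thesis .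
qed

text \<open>The Bianchi identity is traced over \<open>X = e\<^sub>a\<close>, \<open>Y = I\<^sub>i e\<^sub>a\<close>, \<open>Z = e\<^sub>b\<close> and paired with \<open>I\<^sub>i e\<^sub>b\<close>;
  the torsion side vanishes since \<open>T\<^sub>\<xi>\<close> is orthogonal to \<open>sp(1,\<real>)\<close>.\<close>

lemma lam_eq: "lam M g L D p = \<Lambda> p"
proof -
  define i j k :: nat where "i = 1" and "j = 2" and "k = 3"
  have c: "(i, j, k) \<in> cyc" by (simp add: i_def j_def k_def cyc_def)
  note i = cyc_in[OF c]
  note JHi = JH[OF i(1)] JH[OF i(2)] JH[OF i(3)]
  note c1 = cyc_rotate(1)[OF c] and c2 = cyc_rotate(2)[OF c]
  \<comment> \<open>Two of the three curvature contractions in the traced Bianchi identity turn out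
    to be \<open>K\<close>, and \<open>K\<close> is the scalar curvature up to sign and traces of
    \<open>PP\<close>.\<close>
  define K where "K = tr2 (\<lambda>x z. R z x (J i p x) (J i p z))"
  have r: "rho M g L D i [fld p x, fld p (J i p x)] p = eps k / 2 * PP i x (J i p x)" if "x \<in> H M p" for x
    using rho_horizontal[OF hf_fld[of p x] hf_fld[of p "J i p x"] c1]
    unfolding fld_at[OF p that] fld_at[OF p JHi(1)[OF that]] .
  \<comment> \<open>The inner trace is \<open>N\<close> times a Ricci 2-form by definition, the
    outer one is then known from \<open>tr_PP\<close>.\<close>
  have "tr2 (\<lambda>x z. R x (J i p x) z (J i p z)) = tr (\<lambda>x y. real N * (eps k / 2) * PP i x (J i p y))"
    unfolding tr2_tr(2) R_def
  proof (rule tr_cong)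
    fix x assume "x \<in> H M p"
    then show "tr (\<lambda>z w. g p (cu (fld p x) (fld p (J i p x)) (fld p z) p) (J i p z))
        = real N * (eps k / 2) * PP i x (J i p x)"
      using rho_tr[OF vf_fld[of p x] vf_fld[of p "J i p x"] i(1)] r unfolding tr_def
      by (simp only: mult.assoc)
  qed
  also have "\<dots> = real N * real N * - (eps k * eps j) * \<Lambda> p"
    unfolding tr_cmult tr_PP(1)[OF c1] Theta_Lambda[OF c1] by simp
  finally have 1: "tr2 (\<lambda>x z. R x (J i p x) z (J i p z)) = real N * real N * \<Lambda> p"
    by (simp add: i_def j_def k_def)
  \<comment> \<open>Moving \<open>J i\<close> from the first to the third slot and exchanging the
    first two slots cost one sign each.\<close>
  have "tr2 (\<lambda>x z. R (J i p x) z x (J i p z)) = (\<Sum>b<N. S b * - tr (\<lambda>x y. R x (E b) (J i p y) (J i p (E b))))"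
    unfolding tr2_tr(1)
  proof (intro sum.cong refl arg_cong2[of _ _ _ _ "(*)"])
    fix b assume "b \<in> {..<N}"
    then have b: "J i p (E b) \<in> H M p" using EH JHi by simp
    have "bil (\<lambda>x y. R x (E b) y (J i p (E b)))"
      unfolding bil_def using R_lin[OF b] by blast
    from tr_adj[OF this i(1)] show "tr (\<lambda>x y. R (J i p x) (E b) x (J i p (E b)))
        = - tr (\<lambda>x y. R x (E b) (J i p y) (J i p (E b)))" by (simp add: tr_def)
  qed
  also have "\<dots> = K"
    unfolding K_def tr2_tr(1)
  proof (intro sum.cong refl arg_cong2[of _ _ _ _ "(*)"])
    fix b assume "b \<in> {..<N}"
    then have b: "J i p (E b) \<in> H M p" using EH JHi by simp
    show "- tr (\<lambda>x y. R x (E b) (J i p y) (J i p (E b))) = tr (\<lambda>x y. R (E b) x (J i p x) (J i p (E b)))"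
      unfolding tr_minus[symmetric] by (rule tr_cong) (simp add: R_skew[OF b, of "E b"])
  qed
  finally have 2: "tr2 (\<lambda>x z. R (J i p x) z x (J i p z)) = K" .
  have linPP: "lin_on (H M p) (\<lambda>z. PP s z x)" if "s \<in> {1,2,3}" "x \<in> H M p" for s x
    using bil_PP[OF that(1)] that(2) by (simp add: bil_def)
  \<comment> \<open>By \<open>R_J\<close> the endomorphism \<open>J i\<close> passes from the third
    to the fourth slot, where it squares to the scalar \<open>eps i\<close>; the commutator terms
    contract to traces of \<open>PP\<close>.\<close>
  have "K = tr2 (\<lambda>x z. - eps i * R z x x z + (- eps j) * (g p (J j p x) z * PP j z x)
      + g p (J k p x) z * PP k z x)"
    unfolding K_def
  proof (rule tr2_cong)
    fix x z assume xz: "x \<in> H M p" "z \<in> H M p"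
    have 1: "g p (J k p x) (J i p z) = - eps j * g p (J j p x) z"
      using g_J[OF pU i(1) JH[OF i(3) xz(1)] xz(2)] J_cyc(2)[OF pU xz(1) c2] xz i pU by simp
    have 2: "g p (J j p x) (J i p z) = eps k * g p (J k p x) z"
      using g_J[OF pU i(1) JH[OF i(2) xz(1)] xz(2)] J_cyc(1)[OF pU xz(1) c] xz i pU by simp
    have "R z x x (eps i *\<^sub>R z) = eps i * R z x x z"
      unfolding R_def by (rule g_right(3)[OF cu_H_fld[OF hf_fld hf_fld hf_fld] xz(2)])
    then show "R z x (J i p x) (J i p z) = - eps i * R z x x z + (- eps j) * (g p (J j p x) z * PP j z x)
      + g p (J k p x) z * PP k z x"
      unfolding R_J[OF c xz(1) JH[OF i(1) xz(2)]] J_sq[OF pU i(1) xz(2)] 1 2 by simp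
  qed
  also have "\<dots> = - eps i * Scal M g L D p - eps j * tr (\<lambda>x y. PP j (J j p x) y) + tr (\<lambda>x y. PP k (J k p x) y)"
    using tr2_rank_one[of "\<lambda>x z. PP j z x" "J j p", OF linPP[OF i(2)] JH[OF i(2)]]
      tr2_rank_one[of "\<lambda>x z. PP k z x" "J k p", OF linPP[OF i(3)] JH[OF i(3)]]
    unfolding tr2_add tr2_cmult Scal_tr2 by (simp add: tr_def)
  also have "tr (\<lambda>x y. PP j (J j p x) y) = - tr (\<lambda>x y. PP j x (J j p y))"
    by (rule tr_adj[OF bil_PP[OF i(2)] i(2)])
  also have "tr (\<lambda>x y. PP k (J k p x) y) = - tr (\<lambda>x y. PP k x (J k p y))"
    by (rule tr_adj[OF bil_PP[OF i(3)] i(3)])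
  finally have 3: "K = - Scal M g L D p + 4 * real N * \<Lambda> p"
    unfolding tr_PP[OF c] Theta_Lambda[OF c] by (simp add: i_def j_def k_def)
  \<comment> \<open>Contracting the metric factors leaves \<open>t r\<close> traced against
    \<open>J i\<close> in the first group and against \<open>J i\<close>, \<open>J r\<close>,
    \<open>J i\<close> composed, a multiple of \<open>J r\<close>, in the other two.\<close>
  have rhs: "eps r * tr2 (\<lambda>x z. g p (J r p x) (J i p x) * t r z (J i p z) + g p (J r p (J i p x)) z * t r x (J i p z)
      + g p (J r p z) x * t r (J i p x) (J i p z)) = 0" if r: "r \<in> {1,2,3}" for r
  proof -
    have lin: "lin_on (H M p) (\<lambda>z. t r x (J i p z))" if "x \<in> H M p" for x
      using bil_JJ(2)[OF bil_t[OF r] i(1)] that unfolding bil_def by blast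
    have "tr (\<lambda>z w. t r z (J i p z)) = 0"
      using tr_t_J[OF r i(1)] by (simp add: tr_def)
    then have A: "tr2 (\<lambda>x z. g p (J r p x) (J i p x) * t r z (J i p z)) = 0"
      unfolding tr2_tr(2) tr_cmult by (simp add: tr_def)
    have B: "tr2 (\<lambda>x z. g p (J r p (J i p x)) z * t r x (J i p z)) = 0"
      using tr_t_conj[OF r i(1)] tr2_rank_one[of "\<lambda>x z. t r x (J i p z)" "\<lambda>x. J r p (J i p x)", OF lin JH[OF r JH[OF i(1)]]]
      by (simp add: tr_def)
    have "tr2 (\<lambda>x z. g p (J r p z) x * t r (J i p x) (J i p z))
        = tr2 (\<lambda>x z. - (g p (J r p x) z * t r (J i p x) (J i p z)))"
    proof (rule tr2_cong)
      fix x z assume xz: "x \<in> H M p" "z \<in> H M p"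
      show "g p (J r p z) x * t r (J i p x) (J i p z) = - (g p (J r p x) z * t r (J i p x) (J i p z))"
        using g_J[OF pU r xz(2,1)] g_sym[OF xz(2) JH[OF r xz(1)]] by simp
    qed
    also have "\<dots> = - tr (\<lambda>x y. t r (J i p x) (J i p (J r p y)))"
      unfolding tr2_minus
      using tr2_rank_one[of "\<lambda>x z. t r (J i p x) (J i p z)" "J r p", OF lin[OF JH[OF i(1)]] JH[OF r]]
      by (simp add: tr_def)
    also have "tr (\<lambda>x y. t r (J i p x) (J i p (J r p y))) = - tr (\<lambda>x y. t r x (J i p (J r p (J i p y))))"
      by (rule tr_adj[OF bil_JJ(2)[OF bil_JJ(2)[OF bil_t[OF r] i(1)] r] i(1)])
    finally have C: "tr2 (\<lambda>x z. g p (J r p z) x * t r (J i p x) (J i p z)) = 0"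
      using tr_t_conj[OF r i(1)] by simp
    show ?thesis unfolding tr2_add A B C by simp
  qed
  have "tr2 (\<lambda>x z. R x (J i p x) z (J i p z)) + tr2 (\<lambda>x z. R (J i p x) z x (J i p z)) + K = 0"
  proof -
    have "tr2 (\<lambda>x z. R x (J i p x) z (J i p z)) + tr2 (\<lambda>x z. R (J i p x) z x (J i p z)) + K
      = tr2 (\<lambda>x z. - 2 * (\<Sum>r\<in>{1,2,3}. eps r * (g p (J r p x) (J i p x) * t r z (J i p z)
        + g p (J r p (J i p x)) z * t r x (J i p z) + g p (J r p z) x * t r (J i p x) (J i p z))))"
      unfolding K_def tr2_add[symmetric] by (rule tr2_cong) (rule R_bianchi[OF c]; simp add: JHi)
    also have "\<dots> = - 2 * (\<Sum>r\<in>{1,2,3::nat}. 0)"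
      unfolding tr2_cmult tr2_sum[OF finite.insertI[OF finite.insertI[OF finite.insertI[OF finite.emptyI]]]]
      by (intro arg_cong2[of _ _ _ _ "(*)"] refl sum.cong rhs)
    finally show ?thesis by simp
  qed
  \<comment> \<open>The sum reads N^2 \<Lambda> + 2 K = 0 with K = -Scal + 4 N \<Lambda>. As N = 4n,
    this is the origin of the normalising factor 8n(n + 2).\<close>
  then have "Scal M g L D p = 8 * real (qdim M) * (real (qdim M) + 2) * \<Lambda> p"
    unfolding 1 2 3 by (simp add: algebra_simps)
  then have "lam M g L D p = 8 * real (qdim M) * (real (qdim M) + 2) * \<Lambda> p / (8 * real (qdim M) * (real (qdim M) + 2))"
    unfolding lam_def by (rule arg_cong)
  also have "\<dots> = \<Lambda> p"
  proof (rule nonzero_mult_div_cancel_left)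
    show "8 * real (qdim M) * (real (qdim M) + 2) \<noteq> 0" using qdim_pos by simp
  qed
  finally show ?thesis .
qed

end

section \<open>Exterior calculus in low degrees\<close>

lemma form1_1 [simp]: "form1 a [X] p = a p (X p)"
  by (simp add: form1_def)

lemma wedge_add: "wedge k u (\<lambda>Ys q. v Ys q + v' Ys q) Xs p = wedge k u v Xs p + wedge k u v' Xs p"
  by (simp add: wedge_def sum.distrib algebra_simps)

lemma wedge_cmult: "wedge k u (\<lambda>Ys q. f q * v Ys q) Xs p = f p * wedge k u v Xs p"
  by (simp add: wedge_def sum_distrib_left algebra_simps)

text \<open>Forms of even degree commute with all forms; the few instances that occur are checked by
  expansion on five arguments.\<close>

lemma wedge_2_2_commute:
  "wedge 2 u (wedge 2 v a) [A, B, C, X, Y] p = wedge 2 v (wedge 2 u a) [A, B, C, X, Y] p"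
  unfolding wedge_2_5 wedge_2_3 by (simp add: algebra_simps)

lemma wedge_1_2_2_commute:
  "wedge 1 a (wedge 2 u v) [A, B, C, X, Y] p = wedge 2 u (wedge 2 v a) [A, B, C, X, Y] p"
  unfolding wedge_1_5 wedge_2_4 wedge_2_5 wedge_2_3 by (simp add: algebra_simps)

lemma wedge_1_2_11_commute:
  "wedge 1 d (wedge 2 u (wedge 1 a b)) [A, B, C, X, Y] p = wedge 2 u (wedge 1 d (wedge 1 a b)) [A, B, C, X, Y] p"
  unfolding wedge_1_5 wedge_2_4 wedge_2_5 wedge_1_3 wedge_1_2 by (simp add: algebra_simps)

context manifold
begin

definition form1_on :: "'m set \<Rightarrow> ('m \<Rightarrow> 'm tvec \<Rightarrow> real) \<Rightarrow> bool" where
  "form1_on W a \<longleftrightarrow> (\<forall>X. smooth_vfield A W X \<longrightarrow> smooth_fun A W (\<lambda>q. a q (X q))) \<and>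
     (\<forall>q\<in>W. lin_on (tangent_space A q) (a q))"

definition form2_on :: "'m set \<Rightarrow> 'm dform \<Rightarrow> bool" where
  "form2_on W w \<longleftrightarrow> (\<forall>X Y. smooth_vfield A W X \<longrightarrow> smooth_vfield A W Y \<longrightarrow> smooth_fun A W (w [X, Y]))"

lemma form1_on_sf: "form1_on W a \<Longrightarrow> smooth_vfield A W X \<Longrightarrow> smooth_fun A W (\<lambda>q. a q (X q))"
  by (simp add: form1_on_def)

lemma form2_on_sf: "form2_on W w \<Longrightarrow> smooth_vfield A W X \<Longrightarrow> smooth_vfield A W Y \<Longrightarrow> smooth_fun A W (w [X, Y])"
  by (simp add: form2_on_def)

lemma act_add_on:
  "v \<in> tangent_space A p \<Longrightarrow> p \<in> W \<Longrightarrow> smooth_fun A W f \<Longrightarrow> smooth_fun A W k \<Longrightarrow>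
    act v (\<lambda>q. f q + k q) = act v f + act v k"
  by (rule tangent_add) (auto intro: smooth_atI)

lemma act_diff_on:
  "v \<in> tangent_space A p \<Longrightarrow> p \<in> W \<Longrightarrow> smooth_fun A W f \<Longrightarrow> smooth_fun A W k \<Longrightarrow>
    act v (\<lambda>q. f q - k q) = act v f - act v k"
  by (rule tangent_diff) (auto intro: smooth_atI)

lemma act_mult_on:
  "v \<in> tangent_space A p \<Longrightarrow> p \<in> W \<Longrightarrow> smooth_fun A W f \<Longrightarrow> smooth_fun A W k \<Longrightarrow>
    act v (\<lambda>q. f q * k q) = act v f * k p + f p * act v k"
  by (rule tangent_mult) (auto intro: smooth_atI)

lemma act_cmult_on:
  "v \<in> tangent_space A p \<Longrightarrow> p \<in> W \<Longrightarrow> smooth_fun A W f \<Longrightarrow> act v (\<lambda>q. c * f q) = c * act v f"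
  by (rule tangent_cmult) (auto intro: smooth_atI)

text \<open>The second derivatives pair off through \<open>act_bracket\<close>, and the double
  brackets add up to zero by the Jacobi identity.\<close>

lemma ext_d_ext_d:
  assumes a: "form1_on W a" and X: "smooth_vfield A W X" and Y: "smooth_vfield A W Y"
    and Z: "smooth_vfield A W Z" and p: "p \<in> W"
  shows "ext_d A (ext_d A (form1 a)) [X, Y, Z] p = 0"
proof -
  have d: "act (X p) (ext_d A (form1 a) [Y, Z]) = act (X p) (\<lambda>q. act (Y q) (\<lambda>r. a r (Z r)))
      - act (X p) (\<lambda>q. act (Z q) (\<lambda>r. a r (Y r))) - act (X p) (\<lambda>q. a q (bracket A Y Z q))"
    if X: "smooth_vfield A W X" and Y: "smooth_vfield A W Y" and Z: "smooth_vfield A W Z" for X Y Z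
  proof -
    note Xp = smooth_vfield_tangent[OF X p]
    have s: "smooth_fun A W (\<lambda>q. act (Y q) (\<lambda>r. a r (Z r)))" "smooth_fun A W (\<lambda>q. act (Z q) (\<lambda>r. a r (Y r)))"
      by (rule smooth_vfield_act[OF Y form1_on_sf[OF a Z] order_refl],
          rule smooth_vfield_act[OF Z form1_on_sf[OF a Y] order_refl])
    note b = form1_on_sf[OF a smooth_vfield_bracket[OF Y Z]]
    have "ext_d A (form1 a) [Y, Z] = (\<lambda>q. act (Y q) (\<lambda>r. a r (Z r)) - act (Z q) (\<lambda>r. a r (Y r)) - a q (bracket A Y Z q))"
      by (rule ext) (rule ext_d_form1)
    then show ?thesis
      by (simp only: act_diff_on[OF Xp p smooth_fun_diff[OF s] b] act_diff_on[OF Xp p s])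
  qed
  have d': "ext_d A (form1 a) [bracket A X Y, Z] p = act (X p) (\<lambda>q. act (Y q) (\<lambda>r. a r (Z r)))
      - act (Y p) (\<lambda>q. act (X q) (\<lambda>r. a r (Z r))) - act (Z p) (\<lambda>q. a q (bracket A X Y q))
      - a p (bracket A (bracket A X Y) Z p)"
    if Z: "smooth_vfield A W Z" for X Y Z
    unfolding ext_d_form1 act_bracket[OF smooth_atI[OF form1_on_sf[OF a Z] p]] ..
  have lin: "lin_on (tangent_space A p) (a p)" using a p by (simp add: form1_on_def)
  have t: "bracket A X (bracket A Y Z) p \<in> tangent_space A p" "bracket A Y (bracket A Z X) p \<in> tangent_space A p"
    "bracket A Z (bracket A X Y) p \<in> tangent_space A p"
    by (intro bracket_tangent[OF _ _ p] smooth_vfield_bracket X Y Z)+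
  have "a p (bracket A X (bracket A Y Z) p + bracket A Y (bracket A Z X) p + bracket A Z (bracket A X Y) p) = 0"
    unfolding jacobi[OF X Y Z p] by (rule lin_on_zero[OF lin t(1)])
  then have j: "a p (bracket A X (bracket A Y Z) p) + a p (bracket A Y (bracket A Z X) p)
      + a p (bracket A Z (bracket A X Y) p) = 0"
    by (simp only: lin_on_add[OF lin tangent_plus[OF t(1,2)] t(3)] lin_on_add[OF lin t(1,2)])
  have neg: "a p (- v) = - a p v" if "v \<in> tangent_space A p" for v
    using lin_on_scaleR[OF lin that, of "-1"] by simp
  have b: "bracket A (bracket A Y Z) X p = - bracket A X (bracket A Y Z) p"
    "bracket A (bracket A X Y) Z p = - bracket A Z (bracket A X Y) p"
    by (rule bracket_skew)+
  have "bracket A (bracket A X Z) Y p = bracket A Y (bracket A Z X) p"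
  proof -
    have "bracket A Y (bracket A X Z) p = bracket A Y (\<lambda>q. (-1) *\<^sub>R bracket A Z X q) p"
      by (rule bracket_cong[OF Y smooth_vfield_cscale[OF smooth_vfield_bracket[OF Z X]] p])
        (simp_all add: bracket_skew[of X Z])
    also have "\<dots> = - bracket A Y (bracket A Z X) p"
      using bracket_scale_right[OF Y smooth_vfield_bracket[OF Z X] smooth_fun_const[OF smooth_vfield_open[OF X], of "-1"] p]
        tangent_const[OF smooth_vfield_tangent[OF Y p]] by simp
    finally show ?thesis using bracket_skew[of "bracket A X Z" Y p] by simp
  qed
  then show ?thesis
    unfolding ext_d_3 d[OF X Y Z] d[OF Y X Z] d[OF Z X Y] d'[OF Z] d'[OF Y] d'[OF X] b
      neg[OF t(1)] neg[OF t(3)]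
    using j by simp
qed

lemma ext_d_wedge_1_1:
  assumes a: "form1_on W a" and b: "form1_on W b" and X: "smooth_vfield A W X" and Y: "smooth_vfield A W Y"
    and Z: "smooth_vfield A W Z" and p: "p \<in> W"
  shows "ext_d A (wedge 1 (form1 a) (form1 b)) [X, Y, Z] p
    = wedge 2 (ext_d A (form1 a)) (form1 b) [X, Y, Z] p - wedge 1 (form1 a) (ext_d A (form1 b)) [X, Y, Z] p"
proof -
  have d: "act (X p) (wedge 1 (form1 a) (form1 b) [Y, Z])
      = act (X p) (\<lambda>q. a q (Y q)) * b p (Z p) + a p (Y p) * act (X p) (\<lambda>q. b q (Z q))
        - (act (X p) (\<lambda>q. a q (Z q)) * b p (Y p) + a p (Z p) * act (X p) (\<lambda>q. b q (Y q)))"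
    if X: "smooth_vfield A W X" and Y: "smooth_vfield A W Y" and Z: "smooth_vfield A W Z" for X Y Z
  proof -
    note Xp = smooth_vfield_tangent[OF X p]
    note s = form1_on_sf[OF a Y] form1_on_sf[OF b Z] form1_on_sf[OF a Z] form1_on_sf[OF b Y]
    have "wedge 1 (form1 a) (form1 b) [Y, Z] = (\<lambda>q. a q (Y q) * b q (Z q) - a q (Z q) * b q (Y q))"
      by (rule ext) (simp only: wedge_1_2 form1_1)
    then show ?thesis
      by (simp only: act_diff_on[OF Xp p smooth_fun_mult[OF s(1,2)] smooth_fun_mult[OF s(3,4)]]
          act_mult_on[OF Xp p s(1,2)] act_mult_on[OF Xp p s(3,4)])
  qed
  show ?thesis
    unfolding ext_d_3 d[OF X Y Z] d[OF Y X Z] d[OF Z X Y] wedge_1_2 wedge_1_3 wedge_2_3 ext_d_form1 form1_1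
    by (simp add: algebra_simps)
qed

lemma ext_d_fun_mult:
  assumes f: "smooth_fun A W f" and w: "form2_on W w" and X: "smooth_vfield A W X" and Y: "smooth_vfield A W Y"
    and Z: "smooth_vfield A W Z" and p: "p \<in> W"
  shows "ext_d A (\<lambda>Xs q. f q * w Xs q) [X, Y, Z] p = wedge 1 (ext_d A (form0 f)) w [X, Y, Z] p + f p * ext_d A w [X, Y, Z] p"
  unfolding ext_d_3 wedge_1_3 ext_d_0
    act_mult_on[OF smooth_vfield_tangent[OF X p] p f form2_on_sf[OF w Y Z]]
    act_mult_on[OF smooth_vfield_tangent[OF Y p] p f form2_on_sf[OF w X Z]]
    act_mult_on[OF smooth_vfield_tangent[OF Z p] p f form2_on_sf[OF w X Y]]
  by (simp add: algebra_simps)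

lemma ext_d_cmult:
  assumes w: "form2_on W w" and X: "smooth_vfield A W X" and Y: "smooth_vfield A W Y"
    and Z: "smooth_vfield A W Z" and p: "p \<in> W"
  shows "ext_d A (\<lambda>Xs q. c * w Xs q) [X, Y, Z] p = c * ext_d A w [X, Y, Z] p"
  unfolding ext_d_3
    act_cmult_on[OF smooth_vfield_tangent[OF X p] p form2_on_sf[OF w Y Z]]
    act_cmult_on[OF smooth_vfield_tangent[OF Y p] p form2_on_sf[OF w X Z]]
    act_cmult_on[OF smooth_vfield_tangent[OF Z p] p form2_on_sf[OF w X Y]]
  by (simp add: algebra_simps)

lemma ext_d_add:
  assumes w: "form2_on W w" and v: "form2_on W v" and X: "smooth_vfield A W X" and Y: "smooth_vfield A W Y"
    and Z: "smooth_vfield A W Z" and p: "p \<in> W"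
  shows "ext_d A (\<lambda>Xs q. w Xs q + v Xs q) [X, Y, Z] p = ext_d A w [X, Y, Z] p + ext_d A v [X, Y, Z] p"
  unfolding ext_d_3
    act_add_on[OF smooth_vfield_tangent[OF X p] p form2_on_sf[OF w Y Z] form2_on_sf[OF v Y Z]]
    act_add_on[OF smooth_vfield_tangent[OF Y p] p form2_on_sf[OF w X Z] form2_on_sf[OF v X Z]]
    act_add_on[OF smooth_vfield_tangent[OF Z p] p form2_on_sf[OF w X Y] form2_on_sf[OF v X Y]]
  by (simp add: algebra_simps)

lemma form2_on_add: "form2_on W w \<Longrightarrow> form2_on W v \<Longrightarrow> form2_on W (\<lambda>Xs q. w Xs q + v Xs q)"
  unfolding form2_on_def by (blast intro: smooth_fun_add)

lemma form2_on_mult: "smooth_fun A W f \<Longrightarrow> form2_on W w \<Longrightarrow> form2_on W (\<lambda>Xs q. f q * w Xs q)"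
  unfolding form2_on_def by (blast intro: smooth_fun_mult)

lemma form2_on_cmult: "open W \<Longrightarrow> form2_on W w \<Longrightarrow> form2_on W (\<lambda>Xs q. c * w Xs q)"
  by (rule form2_on_mult[OF smooth_fun_const])

lemma form2_on_wedge:
  assumes "form1_on W a" "form1_on W b" shows "form2_on W (wedge 1 (form1 a) (form1 b))"
  unfolding form2_on_def
proof (intro allI impI)
  fix X Y assume X: "smooth_vfield A W X" and Y: "smooth_vfield A W Y"
  show "smooth_fun A W (wedge 1 (form1 a) (form1 b) [X, Y])"
    by (rule smooth_fun_cong[OF smooth_fun_diff[OF smooth_fun_mult[OF form1_on_sf[OF assms(1) X] form1_on_sf[OF assms(2) Y]]
          smooth_fun_mult[OF form1_on_sf[OF assms(1) Y] form1_on_sf[OF assms(2) X]]]])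
      (simp only: wedge_1_2 form1_1)
qed

text \<open>Equality on the whole of \<open>W\<close> is what can be differentiated. It allows
  \<open_placeholder_removed> the first equation, once known on \<open>W\<close>, to be inserted
  under the exterior derivative.\<close>

lemma ext_d_cong:
  assumes v: "form2_on W v" and X: "smooth_vfield A W X" and Y: "smooth_vfield A W Y"
    and Z: "smooth_vfield A W Z" and p: "p \<in> W"
    and eq: "\<And>X Y q. smooth_vfield A W X \<Longrightarrow> smooth_vfield A W Y \<Longrightarrow> q \<in> W \<Longrightarrow> w [X, Y] q = v [X, Y] q"
  shows "ext_d A w [X, Y, Z] p = ext_d A v [X, Y, Z] p"
proof -
  have "act (X p) (w [Y, Z]) = act (X p) (v [Y, Z])"
    if X: "smooth_vfield A W X" and Y: "smooth_vfield A W Y" and Z: "smooth_vfield A W Z" for X Y Z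
    by (rule tangent_cong[OF smooth_vfield_tangent[OF X p] smooth_atI[OF form2_on_sf[OF v Y Z] p] smooth_vfield_open[OF X] p])
      (rule eq[OF Y Z])
  from this[OF X Y Z] this[OF Y X Z] this[OF Z X Y] show ?thesis
    unfolding ext_d_3
    by (simp only: eq[OF smooth_vfield_bracket[OF X Y] Z p] eq[OF smooth_vfield_bracket[OF X Z] Y p]
        eq[OF smooth_vfield_bracket[OF Y Z] X p])
qed

lemma smooth_wedge_2_2:
  assumes w: "form2_on W w" and X: "smooth_vfield A W X" "smooth_vfield A W Y" "smooth_vfield A W Z" "smooth_vfield A W V"
  shows "smooth_fun A W (wedge 2 w w [X, Y, Z, V])"
  by (rule smooth_fun_cong[of _ "\<lambda>q. 2 * (w [X, Y] q * w [Z, V] q - w [X, Z] q * w [Y, V] q + w [X, V] q * w [Y, Z] q)"])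
    (intro smooth_fun_mult smooth_fun_add smooth_fun_diff smooth_fun_const form2_on_sf[OF w] X smooth_vfield_open[OF X(1)],
     simp add: wedge_2_4)

lemma act_wedge_2_2:
  assumes w: "form2_on W w" and X: "smooth_vfield A W X" "smooth_vfield A W Y" "smooth_vfield A W Z" "smooth_vfield A W V"
    and p: "p \<in> W" and v: "v \<in> tangent_space A p"
  shows "act v (wedge 2 w w [X, Y, Z, V]) = 2 *
    (act v (w [X, Y]) * w [Z, V] p + w [X, Y] p * act v (w [Z, V])
      - (act v (w [X, Z]) * w [Y, V] p + w [X, Z] p * act v (w [Y, V]))
      + (act v (w [X, V]) * w [Y, Z] p + w [X, V] p * act v (w [Y, Z])))"
proof -
  note s = form2_on_sf[OF w]
  note m = smooth_fun_mult[OF s[OF X(1,2)] s[OF X(3,4)]] smooth_fun_mult[OF s[OF X(1,3)] s[OF X(2,4)]]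
    smooth_fun_mult[OF s[OF X(1,4)] s[OF X(2,3)]]
  have "wedge 2 w w [X, Y, Z, V] = (\<lambda>q. 2 * (w [X, Y] q * w [Z, V] q - w [X, Z] q * w [Y, V] q + w [X, V] q * w [Y, Z] q))"
    by (rule ext) (simp add: wedge_2_4)
  then show ?thesis
    by (simp only: act_cmult_on[OF v p smooth_fun_add[OF smooth_fun_diff[OF m(1,2)] m(3)]]
        act_add_on[OF v p smooth_fun_diff[OF m(1,2)] m(3)] act_diff_on[OF v p m(1,2)]
        act_mult_on[OF v p s[OF X(1,2)] s[OF X(3,4)]] act_mult_on[OF v p s[OF X(1,3)] s[OF X(2,4)]]
        act_mult_on[OF v p s[OF X(1,4)] s[OF X(2,3)]])
qed

text \<open>Both terms of the Leibniz rule coincide because 2-forms commute with 3-forms, hence the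
  factor 2.\<close>

lemma ext_d_wedge_2_2:
  assumes w: "form2_on W w" and X: "smooth_vfield A W X1" "smooth_vfield A W X2" "smooth_vfield A W X3"
    "smooth_vfield A W X4" "smooth_vfield A W X5" and p: "p \<in> W"
  shows "ext_d A (wedge 2 w w) [X1, X2, X3, X4, X5] p = 2 * wedge 2 w (ext_d A w) [X1, X2, X3, X4, X5] p"
  unfolding ext_d_5
    act_wedge_2_2[OF w X(2,3,4,5) p smooth_vfield_tangent[OF X(1) p]]
    act_wedge_2_2[OF w X(1,3,4,5) p smooth_vfield_tangent[OF X(2) p]]
    act_wedge_2_2[OF w X(1,2,4,5) p smooth_vfield_tangent[OF X(3) p]]
    act_wedge_2_2[OF w X(1,2,3,5) p smooth_vfield_tangent[OF X(4) p]]
    act_wedge_2_2[OF w X(1,2,3,4) p smooth_vfield_tangent[OF X(5) p]]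
    wedge_2_4 wedge_2_5 ext_d_3
  by (simp add: algebra_simps)

lemma ext_d_4_comb:
  fixes u v w :: "'m dform"
  assumes s: "\<And>X Y Z V. smooth_vfield A W X \<Longrightarrow> smooth_vfield A W Y \<Longrightarrow> smooth_vfield A W Z \<Longrightarrow> smooth_vfield A W V \<Longrightarrow>
      smooth_fun A W (u [X, Y, Z, V]) \<and> smooth_fun A W (v [X, Y, Z, V]) \<and> smooth_fun A W (w [X, Y, Z, V])"
    and X: "smooth_vfield A W X1" "smooth_vfield A W X2" "smooth_vfield A W X3"
    "smooth_vfield A W X4" "smooth_vfield A W X5" and p: "p \<in> W"
  shows "ext_d A (\<lambda>Xs p. - u Xs p - v Xs p + w Xs p) [X1, X2, X3, X4, X5] p =
    - ext_d A u [X1, X2, X3, X4, X5] p - ext_d A v [X1, X2, X3, X4, X5] p + ext_d A w [X1, X2, X3, X4, X5] p"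
proof -
  have a: "act (X p) (\<lambda>q. - u [Y, Z, V, V'] q - v [Y, Z, V, V'] q + w [Y, Z, V, V'] q)
      = - act (X p) (u [Y, Z, V, V']) - act (X p) (v [Y, Z, V, V']) + act (X p) (w [Y, Z, V, V'])"
    if X: "smooth_vfield A W X" and Y: "smooth_vfield A W Y" "smooth_vfield A W Z" "smooth_vfield A W V" "smooth_vfield A W V'"
    for X Y Z V V'
  proof -
    note Xp = smooth_vfield_tangent[OF X p]
    have m: "smooth_fun A W (u [Y, Z, V, V'])" "smooth_fun A W (v [Y, Z, V, V'])" "smooth_fun A W (w [Y, Z, V, V'])"
      using s[OF Y] by simp_all
    have "act (X p) (\<lambda>q. - u [Y, Z, V, V'] q) = - act (X p) (u [Y, Z, V, V'])"
      using act_cmult_on[OF Xp p m(1), of "-1"] by simp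
    then show ?thesis
      by (simp only: act_add_on[OF Xp p smooth_fun_diff[OF smooth_fun_minus[OF m(1)] m(2)] m(3)]
          act_diff_on[OF Xp p smooth_fun_minus[OF m(1)] m(2)])
  qed
  show ?thesis
    unfolding ext_d_5 a[OF X(1) X(2,3,4,5)] a[OF X(2) X(1,3,4,5)] a[OF X(3) X(1,2,4,5)]
      a[OF X(4) X(1,2,3,5)] a[OF X(5) X(1,2,3,4)]
    by (simp add: algebra_simps)
qed

end

section \<open>The structure equations\<close>

context pqc_data
begin

text \<open>The chosen frame comes with its own domain, which is cut down to
  \<open>W0\<close>.\<close>

lemma point_frame:
  assumes "W0 \<subseteq> U" "open W0" "p \<in> W0"
  obtains W e where "W \<subseteq> W0" "open W" "p \<in> W" "pqc_point M g D U L \<alpha> W e p"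
proof -
  define e where "e = (SOME e. orthonormal_frame M g p e)"
  have "orthonormal_frame M g p e" unfolding e_def by (rule someI_ex[OF orthonormal_frame_exists])
  then obtain W where W: "p \<in> W" "\<forall>a<N. hf W (e a)"
    "\<forall>q\<in>W. \<forall>a<N. g q (e a q) (e a q) \<in> {1, - 1} \<and> (\<forall>b<N. a \<noteq> b \<longrightarrow> g q (e a q) (e b q) = 0)"
    unfolding orthonormal_frame_def by (elim exE conjE) (rule that)
  have N: "0 < N" using qdim_pos by simp
  have oW: "open (W \<inter> W0)" by (rule open_Int[OF hf_open[OF W(2)[rule_format, OF N]] assms(2)])
  have "pqc_point M g D U L \<alpha> (W \<inter> W0) e p"
  proof (unfold_locales)
    show "W \<inter> W0 \<subseteq> U" using assms(1) by blast
    show "hf (W \<inter> W0) (e a)" if "a < N" for a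
      by (rule hf_subset[OF W(2)[rule_format, OF that] Int_lower1 oW])
    show "g q (e a q) (e a q) \<in> {1, - 1}" if "q \<in> W \<inter> W0" "a < N" for q a
      using W(3) that by blast
    show "g q (e a q) (e b q) = 0" if "q \<in> W \<inter> W0" "a < N" "b < N" "a \<noteq> b" for q a b
      using W(3) that by blast
  qed (use oW W(1) assms(3) e_def in simp_all)
  then show thesis using that[of "W \<inter> W0" e] oW W(1) assms(3) by simp
qed

lemma lam_Lambda:
  assumes "p \<in> U" shows "lam M g L D p = \<Lambda> p"
proof -
  obtain W e where "pqc_point M g D U L \<alpha> W e p"
    using point_frame[OF order_refl open_U assms] by metis
  then interpret pqc_point M g D U L \<alpha> W e p .
  show ?thesis by (rule lam_eq)
qed

lemma omega_2: "omega g L s [A, B] p = g p (J s p (h p (A p))) (h p (B p))"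
  by (simp add: omega_def form2_def)

text \<open>The frame belongs to the point, but the statement mentions no frame; so it holds at all
  points of \<open>W0\<close> at once and can be differentiated.\<close>

lemma eta_torsion:
  assumes W0: "W0 \<subseteq> U" and A: "vf W0 A" and B: "vf W0 B" and p: "p \<in> W0" and c: "(i, j, k) \<in> cyc"
  shows "\<eta> i p (tor A B p) = - 2 * eps i * omega g L i [A, B] p
    + eps i * \<Lambda> p * (\<eta> j p (A p) * \<eta> k p (B p) - \<eta> j p (B p) * \<eta> k p (A p))"
proof -
  obtain W e where WW: "W \<subseteq> W0" "open W" and "pqc_point M g D U L \<alpha> W e p"
    using point_frame[OF W0 smooth_vfield_open[OF A] p] by metis
  then interpret pqc_point M g D U L \<alpha> W e p by simp
  show ?thesis
    unfolding omega_2 by (rule eta_tor[OF smooth_vfield_subset[OF A WW] smooth_vfield_subset[OF B WW] c])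
qed

end

context pqc_frame
begin

text \<open>As a component of the torsion of smooth fields, \<Lambda> is smooth by construction;
  \<open>lam\<close> inherits this through \<open>lam_Lambda\<close>.\<close>

lemma sf_Lambda: "sf W \<Lambda>"
  unfolding \<Lambda>_def[abs_def] \<Theta>_def
  by (rule sf_eta[OF W(1)]) (simp_all add: vf_tor vf_xiW)

lemma form1_eta: "s \<in> {1,2,3} \<Longrightarrow> form1_on W (\<eta> s)"
  unfolding form1_on_def using sf_eta[OF W(1)] eta_lin WU by blast

lemma form1_alpha: "s \<in> {1,2,3} \<Longrightarrow> form1_on W (\<alpha> s)"
  unfolding form1_on_def using sf_alpha alpha_lin by blast

lemma form2_omega:
  assumes s: "s \<in> {1,2,3}" shows "form2_on W (omega g L s)"
  unfolding form2_on_def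
proof (intro allI impI)
  fix X Y assume "vf W X" "vf W Y"
  then have "sf W (\<lambda>q. g q (J s q (h q (X q))) (h q (Y q)))"
    by (intro sf_g hf_J[OF W(1) s] hf_hproj[OF W(1)])
  then show "sf W (omega g L s [X, Y])" by (rule smooth_fun_cong) (rule omega_2)
qed

lemma d_eta_form:
  assumes A: "vf W A" and B: "vf W B" and p: "p \<in> W" and c: "(i, j, k) \<in> cyc"
  shows "ext_d (atlas M) (form1 (\<eta> i)) [A, B] p = - 2 * eps i * omega g L i [A, B] p
    + (wedge 1 (form1 (\<eta> j)) (form1 (\<alpha> k)) [A, B] p
    + (eps j * wedge 1 (form1 (\<eta> k)) (form1 (\<alpha> j)) [A, B] p
    + eps i * (\<Lambda> p * wedge 1 (form1 (\<eta> j)) (form1 (\<eta> k)) [A, B] p)))"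
  unfolding ext_d_form1 d_eta[OF A B p c] eta_torsion[OF W(1) A B p c] wedge_1_2 form1_1
  by (simp add: algebra_simps)

end

context pqc_point
begin

lemma d_alpha_form:
  assumes A: "vf W A" and B: "vf W B" and c: "(i, j, k) \<in> cyc"
  shows "ext_d (atlas M) (form1 (\<alpha> i)) [A, B] p = 2 * eps k * rho M g L D i [A, B] p
    - eps i * wedge 1 (form1 (\<alpha> j)) (form1 (\<alpha> k)) [A, B] p"
proof -
  have "P i A B p = 2 * eps k * rho M g L D i [A, B] p" by (rule rho_PP[OF A B cyc_rotate(2)[OF c]])
  then show ?thesis
    unfolding P_def ext_d_form1 wedge_1_2 form1_1 using suc3_cyc[OF c] by (simp add: algebra_simps)
qed

lemma d_lam:
  assumes A: "vf W A"
  shows "ext_d (atlas M) (form0 (lam M g L D)) [A] p = ext_d (atlas M) (form0 \<Lambda>) [A] p"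
  unfolding ext_d_0
  by (rule tangent_cong[OF vf_T[OF A p] smooth_atI[OF sf_Lambda p] W(2) p]) (rule lam_Lambda[OF WU])

text \<open>Applying d to the first equation leaves the derivative of \<omega>_i as the only
  unknown: derivatives of the \<eta>_s are known from the same equation, those of the \<alpha>_s
  from the Ricci 2-forms.\<close>

lemma d_omega_form:
  assumes A: "vf W A" and B: "vf W B" and C: "vf W C" and c: "(i, j, k) \<in> cyc"
  shows "eps i * ext_d (atlas M) (omega g L i) [A, B, C] p =
     wedge 2 (omega g L j) (form1 (\<lambda>q v. - eps j * \<alpha> k q v + eps k * lam M g L D q * eta L k q v)) [A, B, C] p
   + wedge 2 (omega g L k) (form1 (\<lambda>q v. eps i * \<alpha> j q v - eps j * lam M g L D q * eta L j q v)) [A, B, C] p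
   - eps j * wedge 2 (rho M g L D k) (form1 (eta L j)) [A, B, C] p
   + eps k * wedge 2 (rho M g L D j) (form1 (eta L k)) [A, B, C] p
   + 1 / 2 * eps i * wedge 1 (ext_d (atlas M) (form0 (lam M g L D)))
       (wedge 1 (form1 (eta L j)) (form1 (eta L k))) [A, B, C] p"
proof -
  note i = cyc_in[OF c]
  note c1 = cyc_rotate(1)[OF c] and c2 = cyc_rotate(2)[OF c]
  note \<eta>f = form1_eta[OF i(1)] form1_eta[OF i(2)] form1_eta[OF i(3)]
  note \<alpha>f = form1_alpha[OF i(1)] form1_alpha[OF i(2)] form1_alpha[OF i(3)]
  let ?d = "ext_d (atlas M)"
  let ?w1 = "wedge 1 (form1 (\<eta> j)) (form1 (\<alpha> k))" and ?w2 = "wedge 1 (form1 (\<eta> k)) (form1 (\<alpha> j))"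
    and ?w3 = "wedge 1 (form1 (\<eta> j)) (form1 (\<eta> k))"
  note w1 = form2_on_wedge[OF \<eta>f(2) \<alpha>f(3)] and w2 = form2_on_wedge[OF \<eta>f(3) \<alpha>f(2)] and w3 = form2_on_wedge[OF \<eta>f(2,3)]
  note \<omega>f = form2_omega[OF i(1)]
  note Lw = form2_on_mult[OF sf_Lambda w3]
  note s1 = form2_on_cmult[OF W(2) \<omega>f, of "- 2 * eps i"] and s2 = form2_on_cmult[OF W(2) w2, of "eps j"]
    and s3 = form2_on_cmult[OF W(2) Lw, of "eps i"]
  note s23 = form2_on_add[OF s2 s3]
  note s123 = form2_on_add[OF w1 s23]
  have "0 = ?d (?d (form1 (\<eta> i))) [A, B, C] p" by (rule ext_d_ext_d[OF \<eta>f(1) A B C p, symmetric])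
  also have "\<dots> = ?d (\<lambda>Xs q. - 2 * eps i * omega g L i Xs q + (?w1 Xs q + (eps j * ?w2 Xs q + eps i * (\<Lambda> q * ?w3 Xs q)))) [A, B, C] p"
    by (rule ext_d_cong[OF form2_on_add[OF s1 s123] A B C p]) (rule d_eta_form[OF _ _ _ c])
  also have "\<dots> = - 2 * eps i * ?d (omega g L i) [A, B, C] p + (?d ?w1 [A, B, C] p + (eps j * ?d ?w2 [A, B, C] p
      + eps i * (wedge 1 (?d (form0 \<Lambda>)) ?w3 [A, B, C] p + \<Lambda> p * ?d ?w3 [A, B, C] p)))"
    by (simp only: ext_d_add[OF s1 s123 A B C p] ext_d_cmult[OF \<omega>f A B C p] ext_d_add[OF w1 s23 A B C p]
        ext_d_add[OF s2 s3 A B C p] ext_d_cmult[OF w2 A B C p] ext_d_cmult[OF Lw A B C p]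
        ext_d_fun_mult[OF sf_Lambda w3 A B C p])
  \<comment> \<open>The factor 2 stems from the coefficient of \<omega>_i in the first equation; it
    halves the terms in \<omega> and \<rho>, which carry a 2 of their own, and leaves 1/2 before the
    derivative of \<lambda>.\<close>
  finally have key: "2 * (eps i * ?d (omega g L i) [A, B, C] p) = ?d ?w1 [A, B, C] p + (eps j * ?d ?w2 [A, B, C] p
      + eps i * (wedge 1 (?d (form0 \<Lambda>)) ?w3 [A, B, C] p + \<Lambda> p * ?d ?w3 [A, B, C] p))"
    by simp
  \<comment> \<open>After substitution this is a polynomial identity in values of forms. Products of
    one \<eta> with two \<alpha>, and of \<Lambda> with two \<eta> and one \<alpha>, cancel; the
    case split makes the \<open>eps\<close> numeric.\<close>
  show ?thesis
    using key
    unfolding ext_d_wedge_1_1[OF \<eta>f(2) \<alpha>f(3) A B C p] ext_d_wedge_1_1[OF \<eta>f(3) \<alpha>f(2) A B C p]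
      ext_d_wedge_1_1[OF \<eta>f(2,3) A B C p]
    unfolding wedge_2_3 wedge_1_3
    unfolding d_eta_form[OF A B p c1] d_eta_form[OF A C p c1] d_eta_form[OF B C p c1]
      d_eta_form[OF A B p c2] d_eta_form[OF A C p c2] d_eta_form[OF B C p c2]
      d_alpha_form[OF A B c1] d_alpha_form[OF A C c1] d_alpha_form[OF B C c1]
      d_alpha_form[OF A B c2] d_alpha_form[OF A C c2] d_alpha_form[OF B C c2]
      d_lam[OF A] d_lam[OF B] d_lam[OF C] wedge_1_2 form1_1 lam_Lambda[OF pU]
    by (rule_tac cyc_cases[OF c]) (simp_all add: algebra_simps)
qed

lemma wedge_2_5_cong:
  assumes "vf W X1" "vf W X2" "vf W X3" "vf W X4" "vf W X5"
    and "\<And>A B C. vf W A \<Longrightarrow> vf W B \<Longrightarrow> vf W C \<Longrightarrow> v [A, B, C] p = v' [A, B, C] p"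
  shows "wedge 2 u v [X1, X2, X3, X4, X5] p = wedge 2 u v' [X1, X2, X3, X4, X5] p"
  unfolding wedge_2_5 by (simp only: assms)

text \<open>In the cyclic sum each product of \<omega>_i, \<omega>_j with \<alpha>_k, and likewise
  with \<Lambda> \<eta>_k, arises twice with opposite signs. The Ricci terms survive; there \<rho>
  may be exchanged for \<rho>^0, because the correction, \<Lambda> times the product of \<omega>_j,
  \<omega>_k and \<eta>_i, cancels in the difference.\<close>

lemma d_Omega_form:
  assumes X: "vf W X1" "vf W X2" "vf W X3" "vf W X4" "vf W X5"
  shows "ext_d (atlas M) (Omega g L) [X1, X2, X3, X4, X5] p =
    (\<Sum>(i, j, k)\<in>cyc. - eps i *
      (2 * wedge 1 (form1 (eta L i))
         (\<lambda>Ys q. wedge 2 (rho0 M g L D k) (omega g L j) Ys q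
                 - wedge 2 (rho0 M g L D j) (omega g L k) Ys q) [X1, X2, X3, X4, X5] p
       + wedge 1 (ext_d (atlas M) (form0 (lam M g L D)))
           (wedge 2 (omega g L i) (wedge 1 (form1 (eta L j)) (form1 (eta L k)))) [X1, X2, X3, X4, X5] p))"
proof -
  let ?Xs = "[X1, X2, X3, X4, X5]"
  let ?d = "ext_d (atlas M)"
  let ?dl = "?d (form0 (lam M g L D))"
  define \<omega> where "\<omega> = omega g L"
  define \<rho> where "\<rho> = rho M g L D"
  \<comment> \<open>\<open>Z\<close> and \<open>Y\<close> serve as atoms, so that the final
    comparison is linear in them and never expands a product on five arguments.\<close>
  define Z where "Z u v a = wedge 2 u (wedge 2 v (form1 a)) ?Xs p" for u v a
  define Y where "Y i j k = wedge 2 (\<omega> i) (wedge 1 ?dl (wedge 1 (form1 (\<eta> j)) (form1 (\<eta> k)))) ?Xs p" for i j k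
  have Z_sym: "Z u v a = Z v u a" for u v a
    unfolding Z_def by (rule wedge_2_2_commute)
  have B: "wedge 2 (\<omega> i) (\<lambda>Xs q. eps i * ?d (\<omega> i) Xs q) ?Xs p
      = - eps j * Z (\<omega> i) (\<omega> j) (\<alpha> k) + eps k * \<Lambda> p * Z (\<omega> i) (\<omega> j) (\<eta> k)
        + eps i * Z (\<omega> i) (\<omega> k) (\<alpha> j) - eps j * \<Lambda> p * Z (\<omega> i) (\<omega> k) (\<eta> j)
        - eps j * Z (\<omega> i) (\<rho> k) (\<eta> j) + eps k * Z (\<omega> i) (\<rho> j) (\<eta> k) + 1 / 2 * eps i * Y i j k"
    if c: "(i, j, k) \<in> cyc" for i j k
  proof -
    have lp: "lam M g L D p = \<Lambda> p" by (rule lam_Lambda[OF pU])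
    \<comment> \<open>Wedge products are evaluated pointwise, so \<lambda> may be frozen to the
      number \<open>\<Lambda> p\<close>.\<close>
    let ?v = "\<lambda>Xs q. (- eps j) * wedge 2 (\<omega> j) (form1 (\<alpha> k)) Xs q
        + ((eps k * \<Lambda> p) * wedge 2 (\<omega> j) (form1 (\<eta> k)) Xs q
        + (eps i * wedge 2 (\<omega> k) (form1 (\<alpha> j)) Xs q
        + ((- eps j * \<Lambda> p) * wedge 2 (\<omega> k) (form1 (\<eta> j)) Xs q
        + ((- eps j) * wedge 2 (\<rho> k) (form1 (\<eta> j)) Xs q
        + (eps k * wedge 2 (\<rho> j) (form1 (\<eta> k)) Xs q
        + (1 / 2 * eps i) * wedge 1 ?dl (wedge 1 (form1 (\<eta> j)) (form1 (\<eta> k))) Xs q)))))"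
    have "wedge 2 (\<omega> i) (\<lambda>Xs q. eps i * ?d (\<omega> i) Xs q) ?Xs p = wedge 2 (\<omega> i) ?v ?Xs p"
    proof (rule wedge_2_5_cong[OF X])
      fix A B C assume ABC: "vf W A" "vf W B" "vf W C"
      show "eps i * ?d (\<omega> i) [A, B, C] p = ?v [A, B, C] p"
        unfolding \<omega>_def \<rho>_def d_omega_form[OF ABC c]
        unfolding wedge_2_3 form1_1 lp by (simp add: algebra_simps)
    qed
    then show ?thesis
      unfolding wedge_add wedge_cmult[of _ _ "\<lambda>_. _"] Z_def[symmetric] Y_def[symmetric]
      by (simp add: algebra_simps)
  qed
  have sm: "sf W (wedge 2 (\<omega> 1) (\<omega> 1) [X, Y, Z, V]) \<and> sf W (wedge 2 (\<omega> 2) (\<omega> 2) [X, Y, Z, V])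
      \<and> sf W (wedge 2 (\<omega> 3) (\<omega> 3) [X, Y, Z, V])" if "vf W X" "vf W Y" "vf W Z" "vf W V" for X Y Z V
    unfolding \<omega>_def by (intro conjI smooth_wedge_2_2 form2_omega that) simp_all
  have dd: "?d (wedge 2 (\<omega> s) (\<omega> s)) ?Xs p = 2 * eps s * wedge 2 (\<omega> s) (\<lambda>Xs q. eps s * ?d (\<omega> s) Xs q) ?Xs p"
    if s: "s \<in> {1,2,3}" for s
    unfolding wedge_cmult[of _ _ "\<lambda>_. _"]
    using ext_d_wedge_2_2[OF form2_omega[OF s] X p] by (simp add: \<omega>_def)
  have L: "?d (Omega g L) ?Xs p = - ?d (wedge 2 (\<omega> 1) (\<omega> 1)) ?Xs p
      - ?d (wedge 2 (\<omega> 2) (\<omega> 2)) ?Xs p + ?d (wedge 2 (\<omega> 3) (\<omega> 3)) ?Xs p"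
    unfolding Omega_def \<omega>_def[symmetric] by (rule ext_d_4_comb[where u = "wedge 2 (\<omega> 1) (\<omega> 1)" and v = "wedge 2 (\<omega> 2) (\<omega> 2)"
          and w = "wedge 2 (\<omega> 3) (\<omega> 3)", OF sm X p])
  have R: "wedge 1 (form1 (eta L i)) (\<lambda>Ys q. wedge 2 (rho0 M g L D k) (omega g L j) Ys q
        - wedge 2 (rho0 M g L D j) (omega g L k) Ys q) ?Xs p = Z (\<rho> k) (\<omega> j) (\<eta> i) - Z (\<rho> j) (\<omega> k) (\<eta> i)"
    if c: "(i, j, k) \<in> cyc" for i j k
  proof -
    note i = cyc_in[OF c]
    have r: "wedge 1 (form1 (\<eta> i)) (wedge 2 (rho0 M g L D s) u) ?Xs p
        = Z (\<rho> s) u (\<eta> i) + \<Lambda> p * Z (\<omega> s) u (\<eta> i)" if s: "s \<in> {1,2,3}" for s u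
      unfolding wedge_1_2_2_commute Z_def wedge_2_5 rho0_eq[OF s] \<rho>_def \<omega>_def by (simp add: algebra_simps)
    have "wedge 1 (form1 (\<eta> i)) (\<lambda>Ys q. wedge 2 (rho0 M g L D k) (\<omega> j) Ys q
        + (- 1) * wedge 2 (rho0 M g L D j) (\<omega> k) Ys q) ?Xs p = Z (\<rho> k) (\<omega> j) (\<eta> i) - Z (\<rho> j) (\<omega> k) (\<eta> i)"
      unfolding wedge_add wedge_cmult[of _ _ "\<lambda>_. _"] r[OF i(3)] r[OF i(2)] Z_sym[of "\<omega> k"] by simp
    then show ?thesis by (simp add: \<omega>_def)
  qed
  have R': "wedge 1 ?dl (wedge 2 (omega g L i) (wedge 1 (form1 (eta L j)) (form1 (eta L k)))) ?Xs p = Y i j k" for i j k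
    unfolding Y_def \<omega>_def by (rule wedge_1_2_11_commute)
  have c: "(1, 2, 3) \<in> cyc" "(2, 3, 1) \<in> cyc" "(3, 1, 2) \<in> cyc" by (simp_all add: cyc_def)
  have cs: "(\<Sum>(i, j, k)\<in>cyc. f i j k) = f 1 2 3 + f 2 3 1 + f 3 1 2" for f :: "nat \<Rightarrow> nat \<Rightarrow> nat \<Rightarrow> real"
    by (simp add: cyc_def)
  have s: "1 \<in> {1,2,3::nat}" "2 \<in> {1,2,3::nat}" "3 \<in> {1,2,3::nat}" by simp_all
  show ?thesis
    unfolding L dd[OF s(1)] dd[OF s(2)] dd[OF s(3)] B[OF c(1)] B[OF c(2)] B[OF c(3)] cs
      R[OF c(1)] R[OF c(2)] R[OF c(3)] R'
      Z_sym[of "\<omega> 2" "\<omega> 1"] Z_sym[of "\<omega> 3" "\<omega> 1"] Z_sym[of "\<omega> 3" "\<omega> 2"]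
      Z_sym[of "\<rho> 1" "\<omega> _"] Z_sym[of "\<rho> 2" "\<omega> _"] Z_sym[of "\<rho> 3" "\<omega> _"]
    by (simp add: algebra_simps del: One_nat_def)
qed

end

section \<open>From identities at a point to equations of forms\<close>

theorem proposition6p4:
  fixes M :: "('m::{t2_space, second_countable_topology}, 'e::euclidean_space) pqc"
    and g :: "'m metric"
    and D :: "'m conn"
    and U :: "'m set"
    and L :: "'m local_data"
    and \<alpha> :: "nat \<Rightarrow> 'm \<Rightarrow> 'm tvec \<Rightarrow> real"
  assumes "pqc_manifold M"
    and "g \<in> conf M"
    and "canonical_connection M g D"
    and "compatible M g U L"
    and "reeb M U L"
    and "connection_forms M D U L \<alpha>"
  shows "(\<forall>(i, j, k)\<in>cyc.
      form_eq (atlas M) U 2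
        (ext_d (atlas M) (form1 (eta L i)))
        (\<lambda>Xs p. - 2 * eps i * omega g L i Xs p
           + wedge 1 (form1 (eta L j)) (form1 (\<alpha> k)) Xs p
           + eps j * wedge 1 (form1 (eta L k)) (form1 (\<alpha> j)) Xs p
           + eps i * lam M g L D p * wedge 1 (form1 (eta L j)) (form1 (eta L k)) Xs p))
    \<and> (\<forall>(i, j, k)\<in>cyc.
      form_eq (atlas M) U 3
        (\<lambda>Xs p. eps i * ext_d (atlas M) (omega g L i) Xs p)
        (\<lambda>Xs p.
           wedge 2 (omega g L j)
             (form1 (\<lambda>q v. - eps j * \<alpha> k q v + eps k * lam M g L D q * eta L k q v)) Xs p
           + wedge 2 (omega g L k)
             (form1 (\<lambda>q v. eps i * \<alpha> j q v - eps j * lam M g L D q * eta L j q v)) Xs p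
           - eps j * wedge 2 (rho M g L D k) (form1 (eta L j)) Xs p
           + eps k * wedge 2 (rho M g L D j) (form1 (eta L k)) Xs p
           + 1 / 2 * eps i * wedge 1 (ext_d (atlas M) (form0 (lam M g L D)))
               (wedge 1 (form1 (eta L j)) (form1 (eta L k))) Xs p))
    \<and> form_eq (atlas M) U 5
        (ext_d (atlas M) (Omega g L))
        (\<lambda>Xs p. \<Sum>(i, j, k)\<in>cyc. - eps i *
           (2 * wedge 1 (form1 (eta L i))
              (\<lambda>Ys q. wedge 2 (rho0 M g L D k) (omega g L j) Ys q
                      - wedge 2 (rho0 M g L D j) (omega g L k) Ys q) Xs p
            + wedge 1 (ext_d (atlas M) (form0 (lam M g L D)))
                (wedge 2 (omega g L i) (wedge 1 (form1 (eta L j)) (form1 (eta L k)))) Xs p))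
    \<and> (\<forall>s\<in>{1,2,3}. \<forall>W X Y. W \<subseteq> U \<and> hfield M W X \<and> hfield M W Y \<longrightarrow> (\<forall>p\<in>W.
        rho0 M g L D s [X, Y] p =
          1 / 2 * (tau M g L D X (Ifield L s Y) p - tau M g L D (Ifield L s X) Y p)
          + 2 * mu M g L D X (Ifield L s Y) p))"
proof -
  interpret pqc_data M g D U L \<alpha> by unfold_locales (fact assms)+
  have list: "\<exists>A B. Xs = [A, B]" if "length Xs = 2" for Xs :: "'m vfield list"
    using that by (auto simp: length_Suc_conv numeral_nat)
  have list3: "\<exists>A B C. Xs = [A, B, C]" if "length Xs = 3" for Xs :: "'m vfield list"
    using that by (auto simp: length_Suc_conv numeral_nat)
  have list5: "\<exists>A B C X Y. Xs = [A, B, C, X, Y]" if "length Xs = 5" for Xs :: "'m vfield list"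
    using that by (auto simp: length_Suc_conv numeral_nat)
  \<comment> \<open>Each equation is tested at one point, so the given fields may be restricted to
    the domain of the frame chosen there.\<close>
  have local: thesis
    if 1: "W0 \<subseteq> U" and 2: "\<forall>X\<in>set Xs. vf W0 X" and 3: "Xs \<noteq> []" and 4: "p \<in> W0"
      and 5: "\<And>W e. pqc_point M g D U L \<alpha> W e p \<Longrightarrow> W \<subseteq> W0 \<Longrightarrow> open W \<Longrightarrow> \<forall>X\<in>set Xs. vf W X \<Longrightarrow> thesis"
    for W0 Xs p thesis
  proof -
    have o: "open W0" using 2 3 smooth_vfield_open[of W0 "hd Xs"] by simp
    obtain W e where W: "W \<subseteq> W0" "open W" "pqc_point M g D U L \<alpha> W e p"
      using point_frame[OF 1 o 4] by metis
    have "\<forall>X\<in>set Xs. vf W X"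
      using 2 smooth_vfield_subset[OF _ W(1,2)] by blast
    then show thesis by (rule 5[OF W(3,1,2)])
  qed
  show ?thesis
  proof (intro conjI ballI)
    fix c :: "nat \<times> nat \<times> nat" assume "c \<in> cyc"
    then obtain i j k where c: "c = (i, j, k)" "(i, j, k) \<in> cyc" by (cases c) auto
    show "case c of (i, j, k) \<Rightarrow> form_eq (atlas M) U 2
        (ext_d (atlas M) (form1 (eta L i)))
        (\<lambda>Xs p. - 2 * eps i * omega g L i Xs p
           + wedge 1 (form1 (eta L j)) (form1 (\<alpha> k)) Xs p
           + eps j * wedge 1 (form1 (eta L k)) (form1 (\<alpha> j)) Xs p
           + eps i * lam M g L D p * wedge 1 (form1 (eta L j)) (form1 (eta L k)) Xs p)"
      unfolding c(1) prod.case form_eq_def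
    proof (intro allI impI ballI, elim conjE)
      fix W0 Xs p assume a: "W0 \<subseteq> U" "length Xs = 2" "\<forall>X\<in>set Xs. vf W0 X" and p: "p \<in> W0"
      have ne: "Xs \<noteq> []" using a(2) by auto
      show "ext_d (atlas M) (form1 (eta L i)) Xs p = - 2 * eps i * omega g L i Xs p
           + wedge 1 (form1 (eta L j)) (form1 (\<alpha> k)) Xs p
           + eps j * wedge 1 (form1 (eta L k)) (form1 (\<alpha> j)) Xs p
           + eps i * lam M g L D p * wedge 1 (form1 (eta L j)) (form1 (eta L k)) Xs p"
      proof (rule local[OF a(1,3) ne p])
        fix W e assume "pqc_point M g D U L \<alpha> W e p" and X: "\<forall>X\<in>set Xs. vf W X"
        then interpret pqc_point M g D U L \<alpha> W e p by simp
        obtain A B where Xs: "Xs = [A, B]" using list[OF a(2)] by (elim exE)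
        show ?thesis
          using d_eta_form[OF _ _ _ c(2), of A B p] X p lam_Lambda[OF pU] by (simp add: Xs)
      qed
    qed
  next
    fix c :: "nat \<times> nat \<times> nat" assume "c \<in> cyc"
    then obtain i j k where c: "c = (i, j, k)" "(i, j, k) \<in> cyc" by (cases c) auto
    show "case c of (i, j, k) \<Rightarrow> form_eq (atlas M) U 3
        (\<lambda>Xs p. eps i * ext_d (atlas M) (omega g L i) Xs p)
        (\<lambda>Xs p.
           wedge 2 (omega g L j)
             (form1 (\<lambda>q v. - eps j * \<alpha> k q v + eps k * lam M g L D q * eta L k q v)) Xs p
           + wedge 2 (omega g L k)
             (form1 (\<lambda>q v. eps i * \<alpha> j q v - eps j * lam M g L D q * eta L j q v)) Xs p
           - eps j * wedge 2 (rho M g L D k) (form1 (eta L j)) Xs p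
           + eps k * wedge 2 (rho M g L D j) (form1 (eta L k)) Xs p
           + 1 / 2 * eps i * wedge 1 (ext_d (atlas M) (form0 (lam M g L D)))
               (wedge 1 (form1 (eta L j)) (form1 (eta L k))) Xs p)"
      unfolding c(1) prod.case form_eq_def
    proof (intro allI impI ballI, elim conjE)
      fix W0 Xs p assume a: "W0 \<subseteq> U" "length Xs = 3" "\<forall>X\<in>set Xs. vf W0 X" and p: "p \<in> W0"
      have ne: "Xs \<noteq> []" using a(2) by auto
      obtain A B C where Xs: "Xs = [A, B, C]" using list3[OF a(2)] by (elim exE)
      show "eps i * ext_d (atlas M) (omega g L i) Xs p =
           wedge 2 (omega g L j)
             (form1 (\<lambda>q v. - eps j * \<alpha> k q v + eps k * lam M g L D q * eta L k q v)) Xs p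
           + wedge 2 (omega g L k)
             (form1 (\<lambda>q v. eps i * \<alpha> j q v - eps j * lam M g L D q * eta L j q v)) Xs p
           - eps j * wedge 2 (rho M g L D k) (form1 (eta L j)) Xs p
           + eps k * wedge 2 (rho M g L D j) (form1 (eta L k)) Xs p
           + 1 / 2 * eps i * wedge 1 (ext_d (atlas M) (form0 (lam M g L D)))
               (wedge 1 (form1 (eta L j)) (form1 (eta L k))) Xs p"
      proof (rule local[OF a(1,3) ne p])
        fix W e assume "pqc_point M g D U L \<alpha> W e p" and X: "\<forall>X\<in>set Xs. vf W X"
        then interpret pqc_point M g D U L \<alpha> W e p by simp
        show ?thesis
          unfolding Xs by (rule d_omega_form[OF _ _ _ c(2)]) (use X Xs in simp_all)
      qed
    qed
  next
    show "form_eq (atlas M) U 5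
        (ext_d (atlas M) (Omega g L))
        (\<lambda>Xs p. \<Sum>(i, j, k)\<in>cyc. - eps i *
           (2 * wedge 1 (form1 (eta L i))
              (\<lambda>Ys q. wedge 2 (rho0 M g L D k) (omega g L j) Ys q
                      - wedge 2 (rho0 M g L D j) (omega g L k) Ys q) Xs p
            + wedge 1 (ext_d (atlas M) (form0 (lam M g L D)))
                (wedge 2 (omega g L i) (wedge 1 (form1 (eta L j)) (form1 (eta L k)))) Xs p))"
      unfolding form_eq_def
    proof (intro allI impI ballI, elim conjE)
      fix W0 Xs p assume a: "W0 \<subseteq> U" "length Xs = 5" "\<forall>X\<in>set Xs. vf W0 X" and p: "p \<in> W0"
      have ne: "Xs \<noteq> []" using a(2) by auto
      obtain A B C X Y where Xs: "Xs = [A, B, C, X, Y]" using list5[OF a(2)] by (elim exE)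
      show "ext_d (atlas M) (Omega g L) Xs p = (\<Sum>(i, j, k)\<in>cyc. - eps i *
           (2 * wedge 1 (form1 (eta L i))
              (\<lambda>Ys q. wedge 2 (rho0 M g L D k) (omega g L j) Ys q
                      - wedge 2 (rho0 M g L D j) (omega g L k) Ys q) Xs p
            + wedge 1 (ext_d (atlas M) (form0 (lam M g L D)))
                (wedge 2 (omega g L i) (wedge 1 (form1 (eta L j)) (form1 (eta L k)))) Xs p))"
      proof (rule local[OF a(1,3) ne p])
        fix W e assume "pqc_point M g D U L \<alpha> W e p" and X: "\<forall>X\<in>set Xs. vf W X"
        then interpret pqc_point M g D U L \<alpha> W e p by simp
        show ?thesis
          unfolding Xs by (rule d_Omega_form) (use X Xs in simp_all)
      qed
    qed
  next
    fix s :: nat assume s: "s \<in> {1,2,3}"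
    show "\<forall>W X Y. W \<subseteq> U \<and> hfield M W X \<and> hfield M W Y \<longrightarrow> (\<forall>p\<in>W.
        rho0 M g L D s [X, Y] p =
          1 / 2 * (tau M g L D X (Ifield L s Y) p - tau M g L D (Ifield L s X) Y p)
          + 2 * mu M g L D X (Ifield L s Y) p)"
    proof (intro allI impI ballI, elim conjE)
      fix W0 X Y p assume a: "W0 \<subseteq> U" and X: "hf W0 X" and Y: "hf W0 Y" and p: "p \<in> W0"
      obtain W e where WW: "W \<subseteq> W0" "open W" and "pqc_point M g D U L \<alpha> W e p"
        using point_frame[OF a hf_open[OF X] p] by metis
      then interpret pqc_point M g D U L \<alpha> W e p by simp
      show "rho0 M g L D s [X, Y] p =
          1 / 2 * (tau M g L D X (Ifield L s Y) p - tau M g L D (Ifield L s X) Y p)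
          + 2 * mu M g L D X (Ifield L s Y) p"
        by (rule rho0_horizontal[OF hf_subset[OF X WW] hf_subset[OF Y WW] s])
    qed
  qed
qed

end
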